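(* Let $M\ge1$, let $\{\rho_m,m=0,1,\ldots,M\}$ be a strictly positive sequence with $\rho_0=P_0$, and let $$D_M=\Big\{f(\lambda)\ \Big|\ \frac1{2\pi}\int_{-\pi}^\pi f(\lambda)\cos(m\lambda)d\lambda=\rho_m,\ m=0,1,\ldots,M\Big\}.$$ Consider the equation $$D^\mu AW^\mu\varphi=\alpha\overline\varphi,\qquad\alpha\in\mathbb C,\qquad(\mathrm E)$$ and densities of the form $$f^0(\lambda)=\frac{\big|c_0\sum_{k=0}^\infty(D^\mu A\varphi_\mu)_ke^{i\lambda k}\big|^2}{\big|\sum_{k=1}^Mc_ke^{-i\lambda k}\big|^2},\qquad\varphi_\mu=W^\mu\varphi,\ c_0,\ldots,c_M\text{ constants}.\qquad(\mathrm F)$$ Let $\nu_MP_0$ be the maximum value of $\|D^\mu AW^\mu\varphi\|^2$ on the set of solutions $\varphi$ of (E) which satisfy $\|\varphi\|^2=P_0$ and determine the canonical factorization of the spectral density $f^0(\lambda)=|\sum_{k\ge0}\varphi(k)e^{-i\lambda k}|^2\in D_M$. Let $\nu_M^+P_0$ be the maximum value of $\|D^\mu AW^\mu\varphi\|^2$ on the set of those $\varphi$ which satisfy $\|\varphi\|^2=P_0$ and determine the canonical factorization of the spectral density $f^0(\lambda)\in D_M$ given by (F). 1. If there exists a solution $\varphi^0=\{\varphi^0(m):m\ge0\}$ of (E) which satisfies $\|\varphi^0\|^2=P_0$ and $\nu_MP_0=\nu_M^+P_0=\|D^\mu AW^\mu\varphi^0\|^2$, then the spectral density $$f^0(\lambda)=\Big|\sum_{k=0}^\infty\varphi^0(k)e^{-i\lambda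 k}\Big|^2$$ is least favorable in the class $D_M$ for the optimal extrapolation of the functional $A\xi=\sum_{k=0}^\infty a(k)\xi(k)$ of the unknown values $\xi(k)$, $k\ge0$, of the stochastic sequence with stationary $n$th increments. 2. If $\nu_M<\nu_M^+$, the density (F) which admits the canonical factorization is least favorable in the class $D_M$. Here the sequence $\varphi_\mu=\{\varphi_\mu(k):k\ge0\}$ and the unknown parameters $c_m$, $m=0,1,\ldots,M$, are determined by the equation $\varphi_\mu=W^\mu\varphi$, by the conditional extremum problem $$\|D^\mu A\varphi_\mu\|^2\to\max,\qquad f(\lambda)=\Big|\sum_{k=0}^\infty\varphi(k)e^{-i\lambda k}\Big|^2\in D_M,$$ and by the conditions $\int_{-\pi}^\pi f(\lambda)\cos(m\lambda)d\lambda=2\pi\rho_m$, $m=0,1,\ldots,M$.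
   Context: Let $n\ge 1$ and $\mu>0$ be integers. For a stochastic sequence $\{\xi(m),m\in\mathbb Z\}$ put $\xi^{(n)}(m,\mu)=\sum_{l=0}^n(-1)^l\binom nl\xi(m-l\mu)$. The sequence has stationary $n$th increments if $\mathrm E\xi^{(n)}(m_0,\mu)$ and $\mathrm E\xi^{(n)}(m_0+m,\mu_1)\overline{\xi^{(n)}(m_0,\mu_2)}$ exist for all integers $m_0,m,\mu,\mu_1,\mu_2$ and do not depend on $m_0$; the mean of the increments is assumed to be $0$. It has spectral density $f$ if $\xi^{(n)}(m,\mu)=\int_{-\pi}^{\pi}e^{i\lambda m}(1-e^{-i\mu\lambda})^n(i\lambda)^{-n}dZ(\lambda)$ with an orthogonal stochastic measure $Z$, $\mathrm E|Z(d\lambda)|^2=\frac1{2\pi}f(\lambda)d\lambda$. A sequence $\rho_0,\ldots,\rho_M$ is strictly positive if the Toeplitz matrix $(\rho_{|i-j|})_{i,j=0}^M$ is positive definite. Canonical factorization of $f$: $f(\lambda)=|\Phi(e^{-i\lambda})|^2$, $\Phi(z)=\sum_{k\ge0}\varphi(k)z^k$, with convergence radius $>1$ and no zeros of $\Phi$ in $\{|z|\le1\}$; the sequence $\varphi=(\varphi(0),\varphi(1),\ldots)\in\ell_2$ is said to define (determine) the factorization. Let $w_\mu(z)=\sum_{k\ge0}w_\mu(k)z^k=\exp\{\frac1{4\pi}\int_{-\pi}^{\pi}\frac{e^{i\lambda}+z}{e^{i\lambda}-z}\ln\frac{|1-e^{-i\lambda\mu}|^{2n}}{\lambda^{2n}}d\lambda\}$,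 so $|w_\mu(e^{-i\lambda})|^2=|1-e^{-i\lambda\mu}|^{2n}\lambda^{-2n}$. $W^\mu$ is the operator in $\ell_2$ with elements $W^\mu_{j,k}=w_\mu(j-k)$ for $0\le k\le j$, $0$ for $j<k$; $\varphi_\mu=W^\mu\varphi$ and $\Phi_\mu(z)=\sum_k\varphi_\mu(k)z^k=w_\mu(z)\Phi(z)$. The numbers $d_\mu(k)$ are defined by $\sum_{k\ge0}d_\mu(k)x^k=(\sum_{j\ge0}x^{\mu j})^n$. $D^\mu$ is the operator in $\ell_2$ with elements $d_\mu(j-k)$ for $0\le k\le j$, $0$ for $j<k$; $A$ has elements $(A)_{k,j}=a(k+j)$, $k,j\ge0$; $a=(a(0),a(1),\ldots)^T$. Standing assumption: $\sum_k|(D^\mu a)_k|<\infty$, $\sum_k(k+1)|(D^\mu a)_k|^2<\infty$. Norms are $\ell_2$ norms; the bar is coordinatewise conjugation. Estimation: $A\xi$ is understood as $A\xi=B\xi-V\xi$, $B\xi=\sum_{k\ge0}b_\mu(k)\xi^{(n)}(k,\mu)$, $b_\mu(k)=(D^\mu a)_k$, $V\xi=\sum_{k=-\mu n}^{-1}v_\mu(k)\xi(k)$, $v_\mu(k)=\sum_{l=\lceil-k/\mu\rceil}^n(-1)^l\binom nlb_\mu(l\mu+k)$. The observations are $\xi(m)$, $m\le-1$. $L_2^{0-}(f)$ is the closed subspace of $L_2(f)$ generated by $e^{i\lambda k}(1-e^{-i\lambda\mu})^n(i\lambda)^{-n}$, $k\le-1$. A linear estimate with spectral characteristic $h$ is $\hat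 A\xi=-V\xi+\int h(\lambda)(1-e^{-i\lambda\mu})^n(i\lambda)^{-n}dZ(\lambda)$ with $h(\lambda)(1-e^{-i\lambda\mu})^n(i\lambda)^{-n}\in L_2^{0-}(f)$; $\Delta(h;f)=\mathrm E|A\xi-\hat A\xi|^2$ is its mean square error under $f$, and $h^{(a)}_\mu(f)$ is the spectral characteristic minimizing it. If $f$ admits the canonical factorization, $\Delta(h^{(a)}_\mu(f);f)=\|D^\mu A\varphi_\mu\|^2$. A density $f^0\in D$ is least favorable in a class $D$ for the optimal linear estimation of $A\xi$ if $\Delta(h^{(a)}_\mu(f^0);f^0)=\max_{f\in D}\Delta(h^{(a)}_\mu(f);f)$. *)

theory Defs
  imports "HOL-Probability.Probability" "HOL-Complex_Analysis.Complex_Analysis"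
begin

section \<open>Sequences and infinite matrices\<close>

definition mat_app :: "(nat \<Rightarrow> nat \<Rightarrow> complex) \<Rightarrow> (nat \<Rightarrow> complex) \<Rightarrow> nat \<Rightarrow> complex" where
  "mat_app P x i = (\<Sum>j. P i j * x j)"

definition mat_mult :: "(nat \<Rightarrow> nat \<Rightarrow> complex) \<Rightarrow> (nat \<Rightarrow> nat \<Rightarrow> complex) \<Rightarrow> nat \<Rightarrow> nat \<Rightarrow> complex" where
  "mat_mult P Q i k = (\<Sum>j. P i j * Q j k)"

definition l2_norm :: "(nat \<Rightarrow> complex) \<Rightarrow> real" where
  "l2_norm x = sqrt (\<Sum>k. (cmod (x k))\<^sup>2)"

definition toeplitz_pos_def :: "nat \<Rightarrow> (nat \<Rightarrow> real) \<Rightarrow> bool" where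
  "toeplitz_pos_def M \<rho> \<longleftrightarrow>
     (\<forall>x :: nat \<Rightarrow> real. (\<exists>i\<le>M. x i \<noteq> 0) \<longrightarrow>
        (\<Sum>i\<le>M. \<Sum>j\<le>M. \<rho> (nat \<bar>int i - int j\<bar>) * x i * x j) > 0)"

definition d_coeff :: "nat \<Rightarrow> nat \<Rightarrow> nat \<Rightarrow> complex" where
  "d_coeff n \<mu> k = fps_nth ((Abs_fps (\<lambda>i. if \<mu> dvd i then 1 else 0)) ^ n) k"

text \<open>The row index comes first: the matrix is upper triangular, so that
  \<open>(D a)(k) = (\<Sum>j\<ge>k. d(j - k) a(j))\<close>, as the identity \<open>A\<xi> = B\<xi> - V\<xi>\<close> requires.\<close>

definition D_mat :: "nat \<Rightarrow> nat \<Rightarrow> nat \<Rightarrow> nat \<Rightarrow> complex" where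
  "D_mat n \<mu> k j = (if k \<le> j then d_coeff n \<mu> (j - k) else 0)"

definition A_mat :: "(nat \<Rightarrow> complex) \<Rightarrow> nat \<Rightarrow> nat \<Rightarrow> complex" where
  "A_mat a k j = a (k + j)"

text \<open>The points of \<open>{-pi..pi}\<close> where the argument of \<open>ln\<close> is \<open>0\<close> or \<open>0 / 0\<close> form a
  finite set and do not affect the integral.\<close>

definition w_fun :: "nat \<Rightarrow> nat \<Rightarrow> complex \<Rightarrow> complex" where
  "w_fun n \<mu> z =
     exp (complex_of_real (1 / (4 * pi)) *
       (LINT t:{-pi..pi}|lborel. (cis t + z) / (cis t - z) *
          complex_of_real (ln (cmod (1 - cis (- (t * real \<mu>))) ^ (2 * n) / t ^ (2 * n)))))"

definition w_coeff :: "nat \<Rightarrow> nat \<Rightarrow> nat \<Rightarrow> complex" where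
  "w_coeff n \<mu> k = fps_nth (fps_expansion (w_fun n \<mu>) 0) k"

definition W_mat :: "nat \<Rightarrow> nat \<Rightarrow> nat \<Rightarrow> nat \<Rightarrow> complex" where
  "W_mat n \<mu> j k = (if k \<le> j then w_coeff n \<mu> (j - k) else 0)"

text \<open>\<open>DA\<close> is the operator whose matrix is the product of the matrices of \<open>D\<close> and \<open>A\<close>;
  since \<open>D\<close> alone is unbounded, this is not the same as applying \<open>D\<close> after \<open>A\<close> termwise.\<close>

definition DA_app :: "nat \<Rightarrow> nat \<Rightarrow> (nat \<Rightarrow> complex) \<Rightarrow> (nat \<Rightarrow> complex) \<Rightarrow> nat \<Rightarrow> complex" where
  "DA_app n \<mu> a x = mat_app (mat_mult (D_mat n \<mu>) (A_mat a)) x"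

definition b_seq :: "nat \<Rightarrow> nat \<Rightarrow> (nat \<Rightarrow> complex) \<Rightarrow> nat \<Rightarrow> complex" where
  "b_seq n \<mu> a = mat_app (D_mat n \<mu>) a"

text \<open>The first conjunct says that the coordinates of \<open>D a\<close> exist.\<close>

definition coeff_condition :: "nat \<Rightarrow> nat \<Rightarrow> (nat \<Rightarrow> complex) \<Rightarrow> bool" where
  "coeff_condition n \<mu> a \<longleftrightarrow>
     (\<forall>k. summable (\<lambda>j. D_mat n \<mu> k j * a j)) \<and>
     summable (\<lambda>k. cmod (b_seq n \<mu> a k)) \<and>
     summable (\<lambda>k. (real k + 1) * (cmod (b_seq n \<mu> a k))\<^sup>2)"


section \<open>Stochastic sequences with stationary increments\<close>

definition incr :: "nat \<Rightarrow> (int \<Rightarrow> 'w \<Rightarrow> complex) \<Rightarrow> int \<Rightarrow> int \<Rightarrow> 'w \<Rightarrow> complex" where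
  "incr n \<xi> m \<mu> \<omega> = (\<Sum>l\<le>n. (-1) ^ l * of_nat (n choose l) * \<xi> (m - int l * \<mu>) \<omega>)"

definition stationary_increments ::
    "nat \<Rightarrow> 'w measure \<Rightarrow> (int \<Rightarrow> 'w \<Rightarrow> complex) \<Rightarrow> bool" where
  "stationary_increments n P \<xi> \<longleftrightarrow>
     prob_space P \<and>
     (\<forall>m. \<xi> m \<in> borel_measurable P) \<and>
     (\<forall>m\<^sub>0 \<mu>. integrable P (incr n \<xi> m\<^sub>0 \<mu>) \<and> (LINT \<omega>|P. incr n \<xi> m\<^sub>0 \<mu> \<omega>) = 0) \<and>
     (\<forall>m\<^sub>0 m \<mu>\<^sub>1 \<mu>\<^sub>2. integrable P (\<lambda>\<omega>. incr n \<xi> (m\<^sub>0 + m) \<mu>\<^sub>1 \<omega> * cnj (incr n \<xi> m\<^sub>0 \<mu>\<^sub>2 \<omega>))) \<and>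
     (\<forall>m\<^sub>0 m\<^sub>0' m \<mu>\<^sub>1 \<mu>\<^sub>2.
        (LINT \<omega>|P. incr n \<xi> (m\<^sub>0 + m) \<mu>\<^sub>1 \<omega> * cnj (incr n \<xi> m\<^sub>0 \<mu>\<^sub>2 \<omega>)) =
        (LINT \<omega>|P. incr n \<xi> (m\<^sub>0' + m) \<mu>\<^sub>1 \<omega> * cnj (incr n \<xi> m\<^sub>0' \<mu>\<^sub>2 \<omega>)))"

definition is_density :: "(real \<Rightarrow> real) \<Rightarrow> bool" where
  "is_density f \<longleftrightarrow> (\<forall>t\<in>{-pi..pi}. f t \<ge> 0) \<and> set_integrable lborel {-pi..pi} f"

definition L2 :: "(real \<Rightarrow> real) \<Rightarrow> (real \<Rightarrow> complex) set" where
  "L2 f = {g. set_borel_measurable lborel {-pi..pi} g \<and>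
              set_integrable lborel {-pi..pi} (\<lambda>t. (cmod (g t))\<^sup>2 * f t)}"

definition L2_dist2 :: "(real \<Rightarrow> real) \<Rightarrow> (real \<Rightarrow> complex) \<Rightarrow> (real \<Rightarrow> complex) \<Rightarrow> real" where
  "L2_dist2 f g h = 1 / (2 * pi) * (LINT t:{-pi..pi}|lborel. (cmod (g t - h t))\<^sup>2 * f t)"

text \<open>Orthogonal stochastic measure on \<open>{-pi..pi}\<close> with structure function
  \<open>E |Z(dt)|\<^sup>2 = f(t) dt / (2 pi)\<close>. Mean-square countable additivity follows from the
  clauses below.\<close>

definition orthogonal_measure ::
    "'w measure \<Rightarrow> (real \<Rightarrow> real) \<Rightarrow> (real set \<Rightarrow> 'w \<Rightarrow> complex) \<Rightarrow> bool" where
  "orthogonal_measure P f Z \<longleftrightarrow>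
     (\<forall>S\<in>sets borel. S \<subseteq> {-pi..pi} \<longrightarrow>
        Z S \<in> borel_measurable P \<and> integrable P (\<lambda>\<omega>. (cmod (Z S \<omega>))\<^sup>2) \<and>
        (LINT \<omega>|P. (cmod (Z S \<omega>))\<^sup>2) = 1 / (2 * pi) * (LINT t:S|lborel. f t)) \<and>
     (\<forall>S\<in>sets borel. \<forall>T\<in>sets borel. S \<subseteq> {-pi..pi} \<longrightarrow> T \<subseteq> {-pi..pi} \<longrightarrow> S \<inter> T = {} \<longrightarrow>
        (AE \<omega> in P. Z (S \<union> T) \<omega> = Z S \<omega> + Z T \<omega>) \<and>
        (LINT \<omega>|P. Z S \<omega> * cnj (Z T \<omega>)) = 0)"

definition simple_integral_Z ::
    "(real set \<Rightarrow> 'w \<Rightarrow> complex) \<Rightarrow> (real \<Rightarrow> complex) \<Rightarrow> 'w \<Rightarrow> complex" where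
  "simple_integral_Z Z s \<omega> = (\<Sum>c\<in>s ` {-pi..pi}. c * Z ({-pi..pi} \<inter> s -` {c}) \<omega>)"

definition has_stoch_integral ::
    "'w measure \<Rightarrow> (real \<Rightarrow> real) \<Rightarrow> (real set \<Rightarrow> 'w \<Rightarrow> complex) \<Rightarrow>
     (real \<Rightarrow> complex) \<Rightarrow> ('w \<Rightarrow> complex) \<Rightarrow> bool" where
  "has_stoch_integral P f Z g X \<longleftrightarrow>
     g \<in> L2 f \<and> X \<in> borel_measurable P \<and> integrable P (\<lambda>\<omega>. (cmod (X \<omega>))\<^sup>2) \<and>
     (\<exists>s :: nat \<Rightarrow> real \<Rightarrow> complex.
        (\<forall>j. simple_function borel (s j)) \<and>
        (\<lambda>j. L2_dist2 f g (s j)) \<longlonglongrightarrow> 0 \<and>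
        (\<lambda>j. LINT \<omega>|P. (cmod (X \<omega> - simple_integral_Z Z (s j) \<omega>))\<^sup>2) \<longlonglongrightarrow> 0)"

definition stoch_integral ::
    "'w measure \<Rightarrow> (real \<Rightarrow> real) \<Rightarrow> (real set \<Rightarrow> 'w \<Rightarrow> complex) \<Rightarrow>
     (real \<Rightarrow> complex) \<Rightarrow> 'w \<Rightarrow> complex" where
  "stoch_integral P f Z g = (SOME X. has_stoch_integral P f Z g X)"

definition incr_kernel :: "nat \<Rightarrow> int \<Rightarrow> real \<Rightarrow> complex" where
  "incr_kernel n \<mu> t = (1 - cis (- (of_int \<mu> * t))) ^ n / (\<i> * complex_of_real t) ^ n"

definition has_spectral_density ::
    "nat \<Rightarrow> 'w measure \<Rightarrow> (int \<Rightarrow> 'w \<Rightarrow> complex) \<Rightarrow> (real set \<Rightarrow> 'w \<Rightarrow> complex) \<Rightarrow>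
     (real \<Rightarrow> real) \<Rightarrow> bool" where
  "has_spectral_density n P \<xi> Z f \<longleftrightarrow>
     is_density f \<and> orthogonal_measure P f Z \<and>
     (\<forall>m. \<forall>\<mu>>0. has_stoch_integral P f Z
        (\<lambda>t. cis (of_int m * t) * incr_kernel n \<mu> t) (incr n \<xi> m \<mu>))"


section \<open>The estimation problem\<close>

text \<open>The series converges absolutely almost surely under \<^const>\<open>coeff_condition\<close>, to the
  same limit as in mean square.\<close>

definition B_fun :: "nat \<Rightarrow> nat \<Rightarrow> (nat \<Rightarrow> complex) \<Rightarrow> (int \<Rightarrow> 'w \<Rightarrow> complex) \<Rightarrow> 'w \<Rightarrow> complex" where
  "B_fun n \<mu> a \<xi> \<omega> = (\<Sum>k. b_seq n \<mu> a k * incr n \<xi> (int k) (int \<mu>) \<omega>)"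

definition v_coeff :: "nat \<Rightarrow> nat \<Rightarrow> (nat \<Rightarrow> complex) \<Rightarrow> int \<Rightarrow> complex" where
  "v_coeff n \<mu> a k =
     (\<Sum>l = nat \<lceil>- real_of_int k / real \<mu>\<rceil>..n.
        (-1) ^ l * of_nat (n choose l) * b_seq n \<mu> a (nat (int (l * \<mu>) + k)))"

definition V_fun :: "nat \<Rightarrow> nat \<Rightarrow> (nat \<Rightarrow> complex) \<Rightarrow> (int \<Rightarrow> 'w \<Rightarrow> complex) \<Rightarrow> 'w \<Rightarrow> complex" where
  "V_fun n \<mu> a \<xi> \<omega> = (\<Sum>k\<in>{- int (\<mu> * n)..-1}. v_coeff n \<mu> a k * \<xi> k \<omega>)"

definition A_fun :: "nat \<Rightarrow> nat \<Rightarrow> (nat \<Rightarrow> complex) \<Rightarrow> (int \<Rightarrow> 'w \<Rightarrow> complex) \<Rightarrow> 'w \<Rightarrow> complex" where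
  "A_fun n \<mu> a \<xi> \<omega> = B_fun n \<mu> a \<xi> \<omega> - V_fun n \<mu> a \<xi> \<omega>"

definition L2_past :: "nat \<Rightarrow> nat \<Rightarrow> (real \<Rightarrow> real) \<Rightarrow> (real \<Rightarrow> complex) set" where
  "L2_past n \<mu> f = {g \<in> L2 f. \<forall>\<epsilon>>0. \<exists>K c. finite K \<and> K \<subseteq> {..(-1::int)} \<and>
      L2_dist2 f g (\<lambda>t. \<Sum>k\<in>K. c k * (cis (of_int k * t) * incr_kernel n (int \<mu>) t)) < \<epsilon>}"

definition admissible :: "nat \<Rightarrow> nat \<Rightarrow> (real \<Rightarrow> real) \<Rightarrow> (real \<Rightarrow> complex) \<Rightarrow> bool" where
  "admissible n \<mu> f h \<longleftrightarrow> (\<lambda>t. h t * incr_kernel n (int \<mu>) t) \<in> L2_past n \<mu> f"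

definition estimate ::
    "nat \<Rightarrow> nat \<Rightarrow> (nat \<Rightarrow> complex) \<Rightarrow> 'w measure \<Rightarrow> (int \<Rightarrow> 'w \<Rightarrow> complex) \<Rightarrow>
     (real set \<Rightarrow> 'w \<Rightarrow> complex) \<Rightarrow> (real \<Rightarrow> real) \<Rightarrow> (real \<Rightarrow> complex) \<Rightarrow> 'w \<Rightarrow> complex" where
  "estimate n \<mu> a P \<xi> Z f h \<omega> =
     - V_fun n \<mu> a \<xi> \<omega> + stoch_integral P f Z (\<lambda>t. h t * incr_kernel n (int \<mu>) t) \<omega>"

text \<open>From here on \<open>P\<close>, \<open>\<xi>\<close>, \<open>Z\<close> are families indexed by the density: \<open>\<xi> f\<close> is a sequence
  on the probability space \<open>P f\<close> with spectral density \<open>f\<close>, represented by \<open>Z f\<close>, so that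
  \<open>mse n \<mu> a P \<xi> Z h f\<close> is the mean square error of \<open>h\<close> under \<open>f\<close>.\<close>

definition mse ::
    "nat \<Rightarrow> nat \<Rightarrow> (nat \<Rightarrow> complex) \<Rightarrow> ((real \<Rightarrow> real) \<Rightarrow> 'w measure) \<Rightarrow>
     ((real \<Rightarrow> real) \<Rightarrow> int \<Rightarrow> 'w \<Rightarrow> complex) \<Rightarrow> ((real \<Rightarrow> real) \<Rightarrow> real set \<Rightarrow> 'w \<Rightarrow> complex) \<Rightarrow>
     (real \<Rightarrow> complex) \<Rightarrow> (real \<Rightarrow> real) \<Rightarrow> real" where
  "mse n \<mu> a P \<xi> Z h f =
     (LINT \<omega>|P f. (cmod (A_fun n \<mu> a (\<xi> f) \<omega> - estimate n \<mu> a (P f) (\<xi> f) (Z f) f h \<omega>))\<^sup>2)"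

definition optimal_char ::
    "nat \<Rightarrow> nat \<Rightarrow> (nat \<Rightarrow> complex) \<Rightarrow> ((real \<Rightarrow> real) \<Rightarrow> 'w measure) \<Rightarrow>
     ((real \<Rightarrow> real) \<Rightarrow> int \<Rightarrow> 'w \<Rightarrow> complex) \<Rightarrow> ((real \<Rightarrow> real) \<Rightarrow> real set \<Rightarrow> 'w \<Rightarrow> complex) \<Rightarrow>
     (real \<Rightarrow> real) \<Rightarrow> real \<Rightarrow> complex" where
  "optimal_char n \<mu> a P \<xi> Z f =
     (SOME h. admissible n \<mu> f h \<and>
        (\<forall>h'. admissible n \<mu> f h' \<longrightarrow> mse n \<mu> a P \<xi> Z h f \<le> mse n \<mu> a P \<xi> Z h' f))"

definition least_favorable ::
    "nat \<Rightarrow> nat \<Rightarrow> (nat \<Rightarrow> complex) \<Rightarrow> ((real \<Rightarrow> real) \<Rightarrow> 'w measure) \<Rightarrow>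
     ((real \<Rightarrow> real) \<Rightarrow> int \<Rightarrow> 'w \<Rightarrow> complex) \<Rightarrow> ((real \<Rightarrow> real) \<Rightarrow> real set \<Rightarrow> 'w \<Rightarrow> complex) \<Rightarrow>
     (real \<Rightarrow> real) set \<Rightarrow> (real \<Rightarrow> real) \<Rightarrow> bool" where
  "least_favorable n \<mu> a P \<xi> Z D f\<^sub>0 \<longleftrightarrow>
     f\<^sub>0 \<in> D \<and>
     (\<forall>f\<in>D. mse n \<mu> a P \<xi> Z (optimal_char n \<mu> a P \<xi> Z f) f
            \<le> mse n \<mu> a P \<xi> Z (optimal_char n \<mu> a P \<xi> Z f\<^sub>0) f\<^sub>0)"


section \<open>The class of densities and the two extremum problems\<close>

definition D_class :: "nat \<Rightarrow> (nat \<Rightarrow> real) \<Rightarrow> (real \<Rightarrow> real) set" where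
  "D_class M \<rho> = {f. is_density f \<and>
     (\<forall>m\<le>M. 1 / (2 * pi) * (LINT t:{-pi..pi}|lborel. f t * cos (real m * t)) = \<rho> m)}"

definition spec :: "(nat \<Rightarrow> complex) \<Rightarrow> real \<Rightarrow> real" where
  "spec \<phi> t = (cmod (\<Sum>k. \<phi> k * cis (- (real k * t))))\<^sup>2"

definition canonical_factorization :: "(nat \<Rightarrow> complex) \<Rightarrow> (real \<Rightarrow> real) \<Rightarrow> bool" where
  "canonical_factorization \<phi> f \<longleftrightarrow>
     conv_radius \<phi> > 1 \<and>
     (\<forall>z. cmod z \<le> 1 \<longrightarrow> (\<Sum>k. \<phi> k * z ^ k) \<noteq> 0) \<and>
     (AE t in lborel. t \<in> {-pi..pi} \<longrightarrow> f t = (cmod (\<Sum>k. \<phi> k * cis (- t) ^ k))\<^sup>2)"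

definition eq_E :: "nat \<Rightarrow> nat \<Rightarrow> (nat \<Rightarrow> complex) \<Rightarrow> (nat \<Rightarrow> complex) \<Rightarrow> bool" where
  "eq_E n \<mu> a \<phi> \<longleftrightarrow>
     (\<exists>\<alpha>. \<forall>k. DA_app n \<mu> a (mat_app (W_mat n \<mu>) \<phi>) k = \<alpha> * cnj (\<phi> k))"

text \<open>The sum in the denominator starts at \<open>k = 1\<close>; the identity of densities is almost
  everywhere because the denominator may vanish at finitely many points.\<close>

definition form_F ::
    "nat \<Rightarrow> nat \<Rightarrow> (nat \<Rightarrow> complex) \<Rightarrow> nat \<Rightarrow> (nat \<Rightarrow> complex) \<Rightarrow> (nat \<Rightarrow> complex) \<Rightarrow>
     (real \<Rightarrow> real) \<Rightarrow> bool" where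
  "form_F n \<mu> a M c \<phi> f \<longleftrightarrow>
     (AE t in lborel. t \<in> {-pi..pi} \<longrightarrow>
        f t = (cmod (c 0 * (\<Sum>k. DA_app n \<mu> a (mat_app (W_mat n \<mu>) \<phi>) k * cis (real k * t))))\<^sup>2
              / (cmod (\<Sum>k=1..M. c k * cis (- (real k * t))))\<^sup>2)"

definition objective :: "nat \<Rightarrow> nat \<Rightarrow> (nat \<Rightarrow> complex) \<Rightarrow> (nat \<Rightarrow> complex) \<Rightarrow> real" where
  "objective n \<mu> a \<phi> = (l2_norm (DA_app n \<mu> a (mat_app (W_mat n \<mu>) \<phi>)))\<^sup>2"

definition factor_set :: "nat \<Rightarrow> (nat \<Rightarrow> real) \<Rightarrow> (nat \<Rightarrow> complex) set" where
  "factor_set M \<rho> = {\<phi>. canonical_factorization \<phi> (spec \<phi>) \<and> spec \<phi> \<in> D_class M \<rho>}"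

definition E_set ::
    "nat \<Rightarrow> nat \<Rightarrow> (nat \<Rightarrow> complex) \<Rightarrow> nat \<Rightarrow> (nat \<Rightarrow> real) \<Rightarrow> real \<Rightarrow> (nat \<Rightarrow> complex) set" where
  "E_set n \<mu> a M \<rho> P\<^sub>0 =
     {\<phi> \<in> factor_set M \<rho>. eq_E n \<mu> a \<phi> \<and> (l2_norm \<phi>)\<^sup>2 = P\<^sub>0}"

definition F_set ::
    "nat \<Rightarrow> nat \<Rightarrow> (nat \<Rightarrow> complex) \<Rightarrow> nat \<Rightarrow> (nat \<Rightarrow> real) \<Rightarrow> real \<Rightarrow> (nat \<Rightarrow> complex) set" where
  "F_set n \<mu> a M \<rho> P\<^sub>0 =
     {\<phi> \<in> factor_set M \<rho>. (\<exists>c. form_F n \<mu> a M c \<phi> (spec \<phi>)) \<and> (l2_norm \<phi>)\<^sup>2 = P\<^sub>0}"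

text \<open>Extended reals, so that the maximum over an empty set is \<open>-\<infinity>\<close>.\<close>

definition nu :: "nat \<Rightarrow> nat \<Rightarrow> (nat \<Rightarrow> complex) \<Rightarrow> nat \<Rightarrow> (nat \<Rightarrow> real) \<Rightarrow> real \<Rightarrow> ereal" where
  "nu n \<mu> a M \<rho> P\<^sub>0 = (SUP \<phi>\<in>E_set n \<mu> a M \<rho> P\<^sub>0. ereal (objective n \<mu> a \<phi>)) / ereal P\<^sub>0"

definition nu_plus :: "nat \<Rightarrow> nat \<Rightarrow> (nat \<Rightarrow> complex) \<Rightarrow> nat \<Rightarrow> (nat \<Rightarrow> real) \<Rightarrow> real \<Rightarrow> ereal" where
  "nu_plus n \<mu> a M \<rho> P\<^sub>0 = (SUP \<phi>\<in>F_set n \<mu> a M \<rho> P\<^sub>0. ereal (objective n \<mu> a \<phi>)) / ereal P\<^sub>0"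

definition solves_extremum ::
    "nat \<Rightarrow> nat \<Rightarrow> (nat \<Rightarrow> complex) \<Rightarrow> nat \<Rightarrow> (nat \<Rightarrow> real) \<Rightarrow> (nat \<Rightarrow> complex) \<Rightarrow> bool" where
  "solves_extremum n \<mu> a M \<rho> \<phi> \<longleftrightarrow>
     \<phi> \<in> factor_set M \<rho> \<and> (\<forall>\<psi>\<in>factor_set M \<rho>. objective n \<mu> a \<psi> \<le> objective n \<mu> a \<phi>)"

end

theory Submission
  imports Defs
begin

text \<open>
  Let \<open>f\<^sub>0 = |\<Phi>|\<^sup>2\<close> be the canonical factorization, let \<open>K\<close> be the kernel of the increments, \<open>W\<close> the outer function with
  \<open>|W| = |K|\<close> on the circle, and \<open>b\<close> the power series with the coefficients \<open>b_seq n \<mu> a\<close>. The isometry of the stochastic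
  integral transports the estimation problem to the spectral domain: under a density \<open>f\<close> the characteristic \<open>h\<close> has the
  error \<open>1/(2\<pi>) \<integral> |b - h|\<^sup>2 |K|\<^sup>2 f\<close> (\<open>mse_eq\<close>).

  Split the product of \<open>b(cis t)\<close> and \<open>(\<Phi> * W)(cis (- t))\<close> into the part \<open>r\<close> with nonnegative frequencies and the
  part \<open>N\<close> with negative ones. The coefficients of \<open>r\<close> are \<open>D A W \<phi>\<close>, because \<open>D A\<close> is the Hankel matrix of \<open>b\<close>. The
  characteristic \<open>N / (\<Phi> * W)\<close> is admissible for every density, since division by the outer function does not leave the
  past (\<open>L2_past_quotient\<close>), and its error \<open>1/(2\<pi>) \<integral> |r|\<^sup>2 / |\<Phi>|\<^sup>2 f\<close> is linear in the density
  (\<open>canonical_characteristic\<close>). Under \<open>f\<^sub>0\<close> it is optimal, with the error \<open>1/(2\<pi>) \<integral> |r|\<^sup>2\<close>, the objective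
  (\<open>canonical_lower_bound\<close>, \<open>objective_eq\<close>). Hence \<open>f\<^sub>0\<close> is least favorable as soon as the linear functional attains its
  maximum over the class at \<open>f\<^sub>0\<close> (\<open>least_favorable_canonical\<close>). In both parts the functional is in fact constant on the class.

  If \<open>\<phi>\<close> solves \<open>D A W \<phi> = \<alpha> cnj \<phi>\<close>, then \<open>|r|\<^sup>2 / |\<Phi>|\<^sup>2\<close> is the constant \<open>|\<alpha>|\<^sup>2\<close>, and all densities of the class have the
  same integral \<open>2\<pi> \<rho> 0\<close>.

  If \<open>f\<^sub>0\<close> has the rational form, then \<open>|r|\<^sup>2 / |\<Phi>|\<^sup>2\<close> is a trigonometric polynomial of degree less than \<open>M\<close>. The integrals of
  its even part are prescribed in the class, but those of its odd part \<open>v\<close> are not, since the class fixes cosine moments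
  only. The extremum problem shows that \<open>v\<close> vanishes. For small \<open>\<epsilon> > 0\<close> the density \<open>f\<^sub>0 + \<epsilon> v\<close> again belongs to the class
  and has a canonical factorization, whose factor \<open>\<Phi> * (1 + U)\<close> comes from a contraction argument
  (\<open>factor_perturbation\<close>). To first order in \<open>\<epsilon>\<close> the objective grows by at least \<open>\<epsilon> / (2\<pi>) \<integral> |r|\<^sup>2 / |\<Phi>|\<^sup>2 v\<close>
  (\<open>objective_variation\<close>), which is \<open>\<epsilon> / (2\<pi>) \<integral> v\<^sup>2\<close> because even and odd functions are orthogonal. By extremality this is
  not positive, hence \<open>v = 0\<close>.
\<close>

section \<open>Absolutely convergent power series on the closed unit disk\<close>

lemma suminf_exchange:
  fixes f :: "nat \<Rightarrow> nat \<Rightarrow> complex"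
  assumes f: "\<And>m. summable (\<lambda>k. norm (f m k))" and B: "summable (\<lambda>m. \<Sum>k. norm (f m k))"
  shows "(\<Sum>k. \<Sum>m. f m k) = (\<Sum>m. \<Sum>k. f m k)"
    and "summable (\<lambda>k. norm (\<Sum>m. f m k))"
    and "\<And>k. summable (\<lambda>m. norm (f m k))"
    and "summable (\<lambda>m. norm (\<Sum>k. f m k))"
proof -
  have le: "norm (f m k) \<le> (\<Sum>k. norm (f m k))" for m k
    using sum_le_suminf[OF f, of "{k}" m] by auto
  show *: "summable (\<lambda>m. norm (f m k))" for k
    by (rule summable_comparison_test[OF _ B]) (use le in auto)
  have int: "integrable (count_space UNIV) (f m)" for m
    using f by (simp add: integrable_count_space_nat_iff)
  have e: "(LINT k|count_space UNIV. norm (f m k)) = (\<Sum>k. norm (f m k))" for m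
    by (rule integral_count_space_nat) (use f in \<open>simp add: integrable_count_space_nat_iff\<close>)
  have i2: "integrable (count_space UNIV) (\<lambda>k. \<Sum>m. f m k)"
    by (rule integrable_suminf[OF int]) (use * e B in auto)
  then show "summable (\<lambda>k. norm (\<Sum>m. f m k))"
    by (simp add: integrable_count_space_nat_iff)
  have "(LINT k|count_space UNIV. (\<Sum>m. f m k)) = (\<Sum>m. LINT k|count_space UNIV. f m k)"
    by (rule integral_suminf[OF int]) (use * e B in auto)
  then show "(\<Sum>k. \<Sum>m. f m k) = (\<Sum>m. \<Sum>k. f m k)"
    using integral_count_space_nat[OF i2] integral_count_space_nat[OF int] by simp
  show "summable (\<lambda>m. norm (\<Sum>k. f m k))"
    by (rule summable_comparison_test[OF _ B]) (use summable_norm[OF f] in auto)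
qed

text \<open>Power series with absolutely summable coefficients. They form an algebra that contains the exponentials
  of its elements, they are continuous up to the unit circle, and the product of a series in \<open>cis t\<close> with a series in
  \<open>cis (- t)\<close> may be rearranged freely.\<close>

definition wiener :: "(complex \<Rightarrow> complex) \<Rightarrow> (nat \<Rightarrow> complex) \<Rightarrow> bool" where
  "wiener F x \<longleftrightarrow> summable (\<lambda>k. norm (x k)) \<and> (\<forall>z. norm z \<le> 1 \<longrightarrow> F z = (\<Sum>k. x k * z ^ k))"

lemma wiener_summable_norm: "wiener F x \<Longrightarrow> summable (\<lambda>k. norm (x k))"
  by (simp add: wiener_def)

lemma wiener_summable_norm':
  assumes "wiener F x" "norm z \<le> 1" shows "summable (\<lambda>k. norm (x k * z ^ k))"
proof -
  have "norm z ^ k \<le> 1" for k using assms by (simp add: power_le_one)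
  then have "norm (x k * z ^ k) \<le> norm (x k)" for k
    using mult_left_mono[of "norm z ^ k" 1 "norm (x k)"] by (simp add: norm_mult norm_power)
  then show ?thesis
    by (intro summable_comparison_test[OF _ wiener_summable_norm[OF assms(1)]]) auto
qed

lemma wiener_sums: "wiener F x \<Longrightarrow> norm z \<le> 1 \<Longrightarrow> (\<lambda>k. x k * z ^ k) sums F z"
  using wiener_summable_norm'[of F x z] by (auto simp: wiener_def intro: summable_norm_cancel summable_sums)

lemma wiener_bound:
  assumes "wiener F x" "norm z \<le> 1" shows "norm (F z) \<le> (\<Sum>k. norm (x k))"
proof -
  have "norm z ^ k \<le> 1" for k using assms by (simp add: power_le_one)
  then have "norm (x k * z ^ k) \<le> norm (x k)" for k
    using mult_left_mono[of "norm z ^ k" 1 "norm (x k)"] by (simp add: norm_mult norm_power)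
  then show ?thesis
    using assms norm_suminf_le[OF _ wiener_summable_norm[OF assms(1)], of "\<lambda>k. x k * z ^ k"]
    by (auto simp: wiener_def)
qed

lemma wiener_cong: "wiener F x \<Longrightarrow> (\<And>z. norm z \<le> 1 \<Longrightarrow> G z = F z) \<Longrightarrow> wiener G x"
  by (simp add: wiener_def)

lemma wiener_add: "wiener F x \<Longrightarrow> wiener G y \<Longrightarrow> wiener (\<lambda>z. F z + G z) (\<lambda>k. x k + y k)"
proof -
  assume F: "wiener F x" and G: "wiener G y"
  have "summable (\<lambda>k. norm (x k + y k))"
    by (rule summable_comparison_test[OF _ summable_add[OF wiener_summable_norm[OF F] wiener_summable_norm[OF G]]])
       (auto intro: norm_triangle_ineq)
  moreover have "F z + G z = (\<Sum>k. (x k + y k) * z ^ k)" if "norm z \<le> 1" for z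
    using sums_add[OF wiener_sums[OF F that] wiener_sums[OF G that]]
    by (simp add: sums_iff ring_distribs)
  ultimately show ?thesis by (simp add: wiener_def)
qed

lemma wiener_cmult: "wiener F x \<Longrightarrow> wiener (\<lambda>z. c * F z) (\<lambda>k. c * x k)"
proof -
  assume F: "wiener F x"
  have "c * F z = (\<Sum>k. (c * x k) * z ^ k)" if "norm z \<le> 1" for z
    using sums_mult[OF wiener_sums[OF F that], of c] by (simp add: sums_iff mult.assoc)
  then show ?thesis using wiener_summable_norm[OF F]
    by (simp add: wiener_def norm_mult summable_mult)
qed

lemma wiener_diff: "wiener F x \<Longrightarrow> wiener G y \<Longrightarrow> wiener (\<lambda>z. F z - G z) (\<lambda>k. x k - y k)"
  using wiener_add[of F x "\<lambda>z. -1 * G z" "\<lambda>k. -1 * y k"] wiener_cmult[of G y "-1"] by simp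

lemma wiener_const: "wiener (\<lambda>_. c) (\<lambda>k. if k = 0 then c else 0)"
proof -
  have "summable (\<lambda>k::nat. norm (if k = 0 then c else 0))"
    by (rule summable_finite[of "{0}"]) auto
  moreover have "(\<Sum>k::nat. (if k = 0 then c else 0) * z ^ k) = c" for z
    by (subst suminf_finite[of "{0}"]) auto
  ultimately show ?thesis by (simp add: wiener_def)
qed

lemma wiener_mult:
  assumes F: "wiener F x" and G: "wiener G y"
  shows "wiener (\<lambda>z. F z * G z) (\<lambda>k. \<Sum>i\<le>k. x i * y (k - i))"
proof -
  have "summable (\<lambda>k. \<Sum>i\<le>k. norm (x i) * norm (y (k - i)))"
    by (rule summable_Cauchy_product) (use F G in \<open>auto dest: wiener_summable_norm\<close>)
  then have "summable (\<lambda>k. norm (\<Sum>i\<le>k. x i * y (k - i)))"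
    by (rule summable_comparison_test[rotated]) (auto intro!: exI order_trans[OF norm_sum] simp: norm_mult)
  moreover have "F z * G z = (\<Sum>k. (\<Sum>i\<le>k. x i * y (k - i)) * z ^ k)" if z: "norm z \<le> 1" for z
  proof -
    have "F z * G z = (\<Sum>k. \<Sum>i\<le>k. x i * z ^ i * (y (k - i) * z ^ (k - i)))"
      using Cauchy_product[OF wiener_summable_norm'[OF F z] wiener_summable_norm'[OF G z]] F G z
      by (simp add: wiener_def)
    also have "\<dots> = (\<Sum>k. (\<Sum>i\<le>k. x i * y (k - i)) * z ^ k)"
      unfolding sum_distrib_right
      by (intro suminf_cong sum.cong) (auto simp: algebra_simps simp flip: power_add)
    finally show ?thesis .
  qed
  ultimately show ?thesis by (simp add: wiener_def)
qed

text \<open>The bound on the norm makes the exponential series converge in \<open>wiener_exp\<close>.\<close>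

lemma wiener_power: "wiener F x \<Longrightarrow> \<exists>y. wiener (\<lambda>z. F z ^ m) y \<and> (\<Sum>k. norm (y k)) \<le> (\<Sum>k. norm (x k)) ^ m"
proof (induction m)
  case 0
  have "(\<Sum>k::nat. norm (if k = 0 then 1 else 0 :: complex)) = 1"
    by (subst suminf_finite[of "{0}"]) auto
  then show ?case using wiener_const[of 1] by force
next
  case (Suc m)
  then obtain y where y: "wiener (\<lambda>z. F z ^ m) y" "(\<Sum>k. norm (y k)) \<le> (\<Sum>k. norm (x k)) ^ m" by blast
  let ?w = "\<lambda>k. \<Sum>i\<le>k. x i * y (k - i)"
  have w: "wiener (\<lambda>z. F z ^ Suc m) ?w"
    using wiener_mult[OF Suc.prems y(1)] by simp
  have s: "summable (\<lambda>k. norm (x k))" "summable (\<lambda>k. norm (y k))"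
    using Suc.prems y wiener_summable_norm by auto
  have "(\<Sum>k. norm (?w k)) \<le> (\<Sum>k. \<Sum>i\<le>k. norm (x i) * norm (y (k - i)))"
    by (rule suminf_le[OF _ wiener_summable_norm[OF w] summable_Cauchy_product])
       (use s in \<open>auto intro!: order_trans[OF norm_sum] simp: norm_mult\<close>)
  also have "\<dots> = (\<Sum>k. norm (x k)) * (\<Sum>k. norm (y k))"
    by (rule Cauchy_product[symmetric]) (use s in auto)
  also have "\<dots> \<le> (\<Sum>k. norm (x k)) ^ Suc m"
    using y(2) s by (auto intro!: mult_left_mono suminf_nonneg)
  finally show ?case using w by blast
qed

lemma wiener_suminf:
  assumes F: "\<And>m. wiener (F m) (x m)" and le: "\<And>m. (\<Sum>k. norm (x m k)) \<le> B m" and B: "summable B"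
  shows "wiener (\<lambda>z. \<Sum>m. F m z) (\<lambda>k. \<Sum>m. x m k)"
proof -
  have s: "summable (\<lambda>m. \<Sum>k. norm (x m k))"
    by (rule summable_comparison_test[OF _ B])
       (use le in \<open>auto simp: suminf_nonneg wiener_summable_norm[OF F]\<close>)
  have "(\<Sum>m. F m z) = (\<Sum>k. (\<Sum>m. x m k) * z ^ k)" if z: "norm z \<le> 1" for z
  proof -
    have s1: "summable (\<lambda>k. norm (x m k * z ^ k))" for m by (rule wiener_summable_norm'[OF F z])
    have "norm z ^ k \<le> 1" for k using z by (simp add: power_le_one)
    then have "norm (x m k * z ^ k) \<le> norm (x m k)" for m k
      using mult_left_mono[of "norm z ^ k" 1 "norm (x m k)"] by (simp add: norm_mult norm_power)
    then have "summable (\<lambda>m. \<Sum>k. norm (x m k * z ^ k))"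
      by (intro summable_comparison_test[OF _ s])
         (auto intro!: suminf_le exI s1 wiener_summable_norm[OF F] simp: suminf_nonneg[OF s1])
    from suminf_exchange(1)[OF s1 this]
    have "(\<Sum>k. \<Sum>m. x m k * z ^ k) = (\<Sum>m. F m z)" using F z by (simp add: wiener_def)
    moreover have "(\<Sum>m. x m k * z ^ k) = (\<Sum>m. x m k) * z ^ k" for k
      using suminf_exchange(3)[OF wiener_summable_norm[OF F] s, of k]
      by (intro suminf_mult2[symmetric]) (rule summable_norm_cancel)
    ultimately show ?thesis by simp
  qed
  then show ?thesis using suminf_exchange(2)[OF wiener_summable_norm[OF F] s]
    by (simp add: wiener_def)
qed

lemma wiener_exp: assumes "wiener F x" shows "\<exists>y. wiener (\<lambda>z. exp (F z)) y"
proof -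
  have "\<exists>y. wiener (\<lambda>z. F z ^ m) y \<and> (\<Sum>k. norm (y k)) \<le> (\<Sum>k. norm (x k)) ^ m" for m
    by (rule wiener_power[OF assms])
  then obtain y where y: "\<And>m. wiener (\<lambda>z. F z ^ m) (y m)" "\<And>m. (\<Sum>k. norm (y m k)) \<le> (\<Sum>k. norm (x k)) ^ m"
    by metis
  have "wiener (\<lambda>z. inverse (fact m) * F z ^ m) (\<lambda>k. inverse (fact m) * y m k)" for m
    by (rule wiener_cmult[OF y(1)])
  moreover have "(\<Sum>k. norm (inverse (fact m) * y m k)) \<le> inverse (fact m) * (\<Sum>k. norm (x k)) ^ m" for m
    using y(2)[of m] wiener_summable_norm[OF y(1)[of m]]
    by (simp add: norm_mult norm_inverse norm_fact suminf_mult)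
  moreover have "summable (\<lambda>m. inverse (fact m) * (\<Sum>k. norm (x k)) ^ m)" by (rule summable_exp)
  ultimately have "wiener (\<lambda>z. \<Sum>m. inverse (fact m) * F z ^ m) (\<lambda>k. \<Sum>m. inverse (fact m) * y m k)"
    by (intro wiener_suminf)
  moreover have "(\<Sum>m. inverse (fact m) * F z ^ m) = exp (F z)" for z
    by (simp add: exp_def scaleR_conv_of_real of_real_inverse)
  ultimately show ?thesis by auto
qed

lemma wiener_cnj:
  assumes F: "wiener F x" shows "wiener (\<lambda>z. cnj (F (cnj z))) (\<lambda>k. cnj (x k))"
proof -
  have "cnj (F (cnj z)) = (\<Sum>k. cnj (x k) * z ^ k)" if "norm z \<le> 1" for z
  proof -
    have "(\<lambda>k. x k * cnj z ^ k) sums F (cnj z)" using wiener_sums[OF F] that by simp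
    then have "(\<lambda>k. cnj (x k * cnj z ^ k)) sums cnj (F (cnj z))" by (simp only: sums_cnj)
    then show ?thesis by (simp add: sums_iff)
  qed
  then show ?thesis using F by (simp add: wiener_def)
qed

lemma wiener_scale:
  assumes F: "wiener F x" and c: "norm c \<le> 1" shows "wiener (\<lambda>z. F (c * z)) (\<lambda>k. x k * c ^ k)"
proof -
  have "norm (c * z) \<le> 1" if "norm z \<le> 1" for z
    using that c by (metis mult_le_one norm_ge_zero norm_mult)
  then show ?thesis using F wiener_summable_norm'[OF F c]
    by (auto simp: wiener_def power_mult_distrib mult_ac)
qed

lemma wiener_monomial: "wiener (\<lambda>z. z ^ m) (\<lambda>k. if k = m then 1 else 0)"
proof -
  have "summable (\<lambda>k::nat. norm (if k = m then 1 else 0 :: complex))"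
    by (rule summable_finite[of "{m}"]) auto
  moreover have "(\<Sum>k::nat. (if k = m then 1 else 0) * z ^ k) = z ^ m" for z :: complex
    by (subst suminf_finite[of "{m}"]) auto
  ultimately show ?thesis by (simp add: wiener_def)
qed

lemma wiener_sum:
  "finite A \<Longrightarrow> (\<And>i. i \<in> A \<Longrightarrow> wiener (F i) (x i)) \<Longrightarrow> wiener (\<lambda>z. \<Sum>i\<in>A. F i z) (\<lambda>k. \<Sum>i\<in>A. x i k)"
proof (induction A rule: finite_induct)
  case empty then show ?case using wiener_const[of 0] by (simp cong: if_cong)
next
  case (insert i A) then show ?case using wiener_add[of "F i" "x i"] by simp
qed

lemma wiener_at_0: "wiener F x \<Longrightarrow> F 0 = x 0"
  using powser_zero[of x] by (simp add: wiener_def)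

lemma wiener_continuous_on: assumes "wiener F x" shows "continuous_on (cball 0 1) F"
proof -
  have 1: "norm (x k * z ^ k) \<le> norm (x k)" if "z \<in> cball 0 1" for k and z :: complex
    using mult_left_mono[of "norm z ^ k" 1 "norm (x k)"] that by (simp add: norm_mult norm_power power_le_one)
  have "uniform_limit (cball 0 1) (\<lambda>n z. \<Sum>k<n. x k * z ^ k) (\<lambda>z. \<Sum>k. x k * z ^ k) sequentially"
    by (rule Weierstrass_m_test[OF 1 wiener_summable_norm[OF assms]])
  then have "continuous_on (cball 0 1) (\<lambda>z. \<Sum>k. x k * z ^ k)"
    by (rule uniform_limit_theorem[rotated]) (auto intro!: always_eventually continuous_intros)
  then show ?thesis
    by (rule continuous_on_eq) (use assms in \<open>auto simp: wiener_def\<close>)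
qed

lemma wiener_holomorphic:
  assumes "F holomorphic_on ball 0 R" "R > 1"
  obtains x where "wiener F x"
    "\<And>z. norm z < R \<Longrightarrow> (\<lambda>k. x k * z ^ k) sums F z" "\<And>r. 0 \<le> r \<Longrightarrow> r < R \<Longrightarrow> summable (\<lambda>k. norm (x k) * r ^ k)"
proof -
  define x where "x k = (deriv ^^ k) F 0 / fact k" for k
  have s: "(\<lambda>k. x k * z ^ k) sums F z" if "norm z < R" for z
    using holomorphic_power_series[OF assms(1), of z] that by (simp add: x_def)
  have sum: "summable (\<lambda>k. norm (x k) * r ^ k)" if "0 \<le> r" "r < R" for r
  proof -
    have "summable (\<lambda>k. x k * of_real ((r + R) / 2) ^ k)"
      using s[of "of_real ((r + R) / 2)"] that unfolding norm_of_real by (auto simp: sums_iff)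
    then have "summable (\<lambda>k. norm (x k * of_real r ^ k))"
      by (rule powser_insidea) (use that in \<open>auto simp del: of_real_add of_real_divide simp: norm_of_real\<close>)
    then show ?thesis using that by (simp add: norm_mult norm_power)
  qed
  have "wiener F x"
    unfolding wiener_def using sum[of 1] s \<open>R > 1\<close> by (auto simp: sums_iff)
  with s sum that show thesis by blast
qed

lemma wiener_conv_radius:
  assumes "conv_radius x > 1" shows "wiener (\<lambda>z. \<Sum>k. x k * z ^ k) x"
  using abs_summable_in_conv_radius[of 1 x] assms by (simp add: wiener_def one_ereal_def)

section \<open>Fourier integrals over the circle\<close>

abbreviation circ :: "real measure" where "circ \<equiv> restrict_space lborel {-pi..pi}"

lemma circ_integral: "(LINT t:{-pi..pi}|lborel. F t) = (LINT t|circ. F t)"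
  for F :: "real \<Rightarrow> 'a::{banach, second_countable_topology}"
  by (simp add: set_lebesgue_integral_def integral_restrict_space)

lemma circ_integrable: "set_integrable lborel {-pi..pi} F \<longleftrightarrow> integrable circ F"
  for F :: "real \<Rightarrow> 'a::{banach, second_countable_topology}"
  by (simp add: set_integrable_def integrable_restrict_space)

lemma circ_measurable: "set_borel_measurable lborel {-pi..pi} F \<longleftrightarrow> F \<in> borel_measurable circ"
  for F :: "real \<Rightarrow> 'a::real_normed_vector"
  by (simp add: set_borel_measurable_def borel_measurable_restrict_space_iff)

lemma circ_AE: "(AE t in lborel. t \<in> {-pi..pi} \<longrightarrow> Q t) \<longleftrightarrow> (AE t in circ. Q t)"
  by (simp add: AE_restrict_space_iff)

lemma space_circ [simp]: "space circ = {-pi..pi}"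
  by (simp add: space_restrict_space)

lemma measure_circ [simp]: "measure circ {-pi..pi} = 2 * pi"
  by (simp add: measure_restrict_space)

lemma finite_measure_circ: "finite_measure circ"
  by (rule finite_measureI) (simp add: emeasure_restrict_space)

interpretation circ: finite_measure circ by (rule finite_measure_circ)

lemma circ_AE_countable: assumes "countable S" "\<And>t. t \<in> {-pi..pi} \<Longrightarrow> t \<notin> S \<Longrightarrow> Q t" shows "AE t in circ. Q t"
proof -
  have "S \<in> null_sets lborel" using assms(1) by (rule countable_imp_null_set_lborel)
  then have "AE t in lborel. t \<notin> S" by (rule AE_not_in)
  then show ?thesis unfolding circ_AE[symmetric] using assms(2) by auto
qed

lemma circ_continuous_integrable:
  fixes F :: "real \<Rightarrow> 'a::{banach, second_countable_topology}"
  assumes "continuous_on {-pi..pi} F" shows "integrable circ F"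
  using borel_integrable_compact[OF _ assms]
  by (simp add: integrable_restrict_space indicator_scaleR_eq_if cong: if_cong)

lemma circ_integral_cis: "(LINT t|circ. cis (of_int k * t)) = (if k = 0 then 2 * pi else 0)"
proof (cases "k = 0")
  case False
  have "(LINT t|circ. cis (of_int k * t)) = (LINT t|lborel. indicator {-pi..pi} t *\<^sub>R cis (of_int k * t))"
    by (simp add: integral_restrict_space)
  also have "\<dots> = cis (of_int k * pi) / (\<i> * of_int k) - cis (of_int k * (-pi)) / (\<i> * of_int k)"
  proof (rule integral_FTC_Icc)
    fix t :: real
    have "((\<lambda>t. cis (of_int k * t) / (\<i> * of_int k)) has_vector_derivative cis (of_int k * t)) (at t within {-pi..pi})"
      unfolding cis_conv_exp using False
      by (auto intro!: derivative_eq_intros has_vector_derivative_real_field simp: field_simps)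
    then show "((\<lambda>t. cis (of_int k * t) / (\<i> * of_int k)) has_vector_derivative cis (of_int k * t)) (at t within {-pi..pi})" .
  qed (auto intro!: continuous_intros)
  also have "cis (of_int k * pi) = cis (of_int k * (-pi))"
    using sin_zero_iff_int2[of "of_int k * pi"] by (auto simp add: cis.ctr complex_eq_iff)
  finally show ?thesis using False by simp
qed (simp add: scaleR_conv_of_real)

lemma wiener_circle_continuous:
  assumes "wiener F x" shows "continuous_on {-pi..pi} (\<lambda>t. F (cis t))" "continuous_on {-pi..pi} (\<lambda>t. F (cis (- t)))"
  by (auto intro!: continuous_on_compose2[OF wiener_continuous_on[OF assms]] continuous_intros)

text \<open>Used with \<open>cis\<close> and with \<open>\<lambda>t. cis (- t)\<close> for \<open>c\<close>; the coefficients times \<open>|g|\<close> dominate the series.\<close>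

lemma wiener_integral_sums:
  assumes F: "wiener F x" and g: "integrable circ g" and s: "\<And>t. norm (c t :: complex) = 1" "c \<in> borel_measurable borel"
  shows "(\<lambda>k. x k * (LINT t|circ. g t * c t ^ k)) sums (LINT t|circ. g t * F (c t))"
proof -
  have [measurable]: "c \<in> borel_measurable circ"
    using s(2) by (simp add: measurable_restrict_space1)
  have [measurable]: "g \<in> borel_measurable circ" using g by simp
  have i: "integrable circ (\<lambda>t. g t * (x k * c t ^ k))" for k
    by (rule Bochner_Integration.integrable_bound[where f = "\<lambda>t. norm (x k) * norm (g t)"])
       (use g s in \<open>auto simp: norm_mult norm_power\<close>)
  have 1: "norm (g t * (x k * c t ^ k)) = norm (g t) * norm (x k)" for t k
    by (simp add: norm_mult norm_power s)
  have "(\<lambda>k. LINT t|circ. g t * (x k * c t ^ k)) sums (LINT t|circ. (\<Sum>k. g t * (x k * c t ^ k)))"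
    by (rule sums_integral[OF i])
       (auto simp: 1 intro!: summable_mult wiener_summable_norm[OF F])
  moreover have "(\<Sum>k. g t * (x k * c t ^ k)) = g t * F (c t)" for t
    using sums_mult[OF wiener_sums[OF F, of "c t"], of "g t"] s by (simp add: sums_iff)
  moreover have "(LINT t|circ. g t * (x k * c t ^ k)) = x k * (LINT t|circ. g t * c t ^ k)" for k
    by (subst integral_mult_right_zero[symmetric]) (simp add: mult_ac)
  ultimately show ?thesis by simp
qed

lemma wiener_coeff_integral:
  assumes F: "wiener F x"
  shows "(LINT t|circ. cis t ^ k * F (cis (- t))) = complex_of_real (2 * pi) * x k"
proof -
  have "(\<lambda>j. x j * (LINT t|circ. cis t ^ k * cis (- t) ^ j)) sums (LINT t|circ. cis t ^ k * F (cis (- t)))"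
    by (rule wiener_integral_sums[OF F])
       (rule circ_continuous_integrable borel_measurable_continuous_onI | simp | intro continuous_intros)+
  moreover have "(LINT t|circ. cis t ^ k * cis (- t) ^ j) = (if j = k then complex_of_real (2 * pi) else 0)" for j
  proof -
    have "cis t ^ k * cis (- t) ^ j = cis (of_int (int k - int j) * t)" for t
      by (simp add: Complex.DeMoivre cis_mult algebra_simps)
    then show ?thesis by (simp only: circ_integral_cis) auto
  qed
  moreover have "(\<lambda>j. x j * (if j = k then complex_of_real (2 * pi) else 0)) sums (x k * complex_of_real (2 * pi))"
    using sums_single[of k "\<lambda>j. x j * complex_of_real (2 * pi)"] by (simp only: if_distrib[of "(*) _"] mult_zero_right)
  ultimately show ?thesis by (simp only: sums_iff mult.commute)
qed

lemma wiener_pairing: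
  assumes F: "wiener F x" and G: "wiener G y"
  shows "(\<lambda>k. x k * y k) sums ((LINT t|circ. F (cis t) * G (cis (- t))) / (2 * pi))"
proof -
  have "(\<lambda>k. x k * (LINT t|circ. G (cis (- t)) * cis t ^ k)) sums (LINT t|circ. G (cis (- t)) * F (cis t))"
    by (rule wiener_integral_sums[OF F])
       (rule circ_continuous_integrable wiener_circle_continuous[OF G] borel_measurable_continuous_onI | simp | intro continuous_intros)+
  then have "(\<lambda>k. x k * (complex_of_real (2 * pi) * y k)) sums (LINT t|circ. F (cis t) * G (cis (- t)))"
    using wiener_coeff_integral[OF G] by (simp add: mult.commute)
  from sums_divide[OF this, of "complex_of_real (2 * pi)"] show ?thesis by simp
qed

lemma wiener_parseval:
  assumes F: "wiener F x"
  shows "(\<lambda>k. (cmod (x k))\<^sup>2) sums ((LINT t|circ. (cmod (F (cis t)))\<^sup>2) / (2 * pi))"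
proof -
  have "(\<lambda>k. x k * cnj (x k)) sums ((LINT t|circ. F (cis t) * cnj (F (cnj (cis (- t))))) / (2 * pi))"
    by (rule wiener_pairing[OF F wiener_cnj[OF F]])
  then have "(\<lambda>k. complex_of_real ((cmod (x k))\<^sup>2)) sums of_real ((LINT t|circ. (cmod (F (cis t)))\<^sup>2) / (2 * pi))"
    by (simp add: cis_cnj complex_norm_square[symmetric] flip: of_real_power)
  then show ?thesis by (simp only: sums_of_real_iff)
qed

lemma wiener_mean: assumes "wiener F x" shows "(LINT t|circ. F (cis t)) = complex_of_real (2 * pi) * F 0"
proof -
  have "(\<lambda>k. x k * (if k = 0 then 1 else 0)) sums ((LINT t|circ. F (cis t) * 1) / (2 * pi))"
    by (rule wiener_pairing[OF assms wiener_const[of 1]])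
  moreover have "(\<lambda>k. x k * (if k = 0 then 1 else 0)) sums (x 0)"
    using sums_single[of 0 x] by (simp only: if_distrib[of "(*) _"] mult_zero_right mult_1_right)
  ultimately have "x 0 = (LINT t|circ. F (cis t)) / (2 * pi)" by (simp add: sums_iff)
  then show ?thesis using wiener_at_0[OF assms] by (simp add: field_simps)
qed

section \<open>The Fourier series of the logarithm of the sinc function\<close>

definition csinc :: "complex \<Rightarrow> complex" where
  "csinc z = (if z = 0 then 1 else sin (z / 2) / (z / 2))"

lemma csinc_holomorphic: "csinc holomorphic_on UNIV"
proof (rule no_isolated_singularity')
  have "((\<lambda>z::complex. sin (z / 2) / (z / 2)) \<longlongrightarrow> 1) (at 0)"
  proof -
    have "((\<lambda>z::complex. sin z) has_field_derivative cos 0) (at 0)" by (rule DERIV_sin)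
    then have "((\<lambda>z::complex. sin z / z) \<longlongrightarrow> 1) (at 0)" by (simp add: has_field_derivative_iff)
    moreover have "filterlim (\<lambda>z::complex. z / 2) (at 0) (at 0)"
      by (rule filterlim_atI) (auto intro!: tendsto_eq_intros simp: eventually_at_filter)
    ultimately show ?thesis by (rule filterlim_compose)
  qed
  then have "(csinc \<longlongrightarrow> 1) (at 0)"
    by (rule Lim_transform_eventually) (auto simp: csinc_def eventually_at_filter)
  then show "(csinc \<longlongrightarrow> csinc z) (at z within UNIV)" if "z \<in> {0}" for z
    using that by (simp add: csinc_def)
  have "(\<lambda>z. sin (z / 2) / (z / 2)) holomorphic_on UNIV - {0}" by (intro holomorphic_intros) auto
  then show "csinc holomorphic_on UNIV - {0}"
    by (rule holomorphic_transform) (auto simp: csinc_def)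
qed auto

definition rsinc :: "real \<Rightarrow> real" where
  "rsinc t = (if t = 0 then 1 else sin (t / 2) / (t / 2))"

lemma csinc_of_real: "csinc (of_real t) = of_real (rsinc t)"
  using sin_of_real[of "t / 2", where ?'a = complex] by (simp add: csinc_def rsinc_def)

lemma rsinc_pos: assumes "t \<in> {-pi..pi}" shows "rsinc t > 0"
proof -
  consider "t = 0" | "t > 0" | "t < 0" by linarith
  then show ?thesis
  proof cases
    case 2
    then have "sin (t / 2) > 0" using assms by (intro sin_gt_zero) auto
    then show ?thesis using 2 by (simp add: rsinc_def)
  next
    case 3
    then have "sin (- t / 2) > 0" using assms by (intro sin_gt_zero) auto
    then show ?thesis using 3 by (simp add: rsinc_def divide_neg_neg)
  qed (simp add: rsinc_def)
qed

lemma rsinc_even: "rsinc (- t) = rsinc t"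
  by (simp add: rsinc_def)

lemma cmod_one_minus_cis: "cmod (1 - cis t) = 2 * \<bar>sin (t / 2)\<bar>"
proof -
  have "(cmod (1 - cis t))\<^sup>2 = (1 - cos t)\<^sup>2 + (sin t)\<^sup>2"
    by (simp add: cmod_power2)
  also have "\<dots> = 2 - 2 * cos t"
    using sin_cos_squared_add[of t] by (simp add: power2_diff)
  also have "cos t = 1 - 2 * (sin (t / 2))\<^sup>2"
    using cos_double_sin[of "t / 2"] by simp
  finally have "(cmod (1 - cis t))\<^sup>2 = (2 * \<bar>sin (t / 2)\<bar>)\<^sup>2" by (simp add: power_mult_distrib)
  then show ?thesis by (simp only: power2_eq_iff_nonneg norm_ge_zero abs_ge_zero mult_nonneg_nonneg zero_le_numeral)
qed

lemma cmod_one_minus_cis_rsinc: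
  assumes "t \<in> {-pi..pi}" "t \<noteq> 0" shows "cmod (1 - cis (- t)) / \<bar>t\<bar> = rsinc t"
proof -
  have "cmod (1 - cis (- t)) / \<bar>t\<bar> = \<bar>rsinc t\<bar>"
    using assms by (simp add: cmod_one_minus_cis rsinc_def abs_mult)
  then show ?thesis using rsinc_pos[OF assms(1)] by simp
qed

text \<open>Two integrations by parts give the decay. The boundary terms of the first one cancel because the function is
  even; those of the second one survive, since the derivative of the periodic continuation jumps at \<open>\<pi>\<close>.\<close>

lemma ln_rsinc_coeff_bound:
  "\<exists>C. \<forall>k\<ge>1. \<bar>LINT t|circ. ln (rsinc t) * cos (real k * t)\<bar> \<le> C / (real k)\<^sup>2"
proof -
  define S where "S = {z. csinc z \<notin> \<real>\<^sub>\<le>\<^sub>0}"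
  have contS: "continuous_on UNIV csinc" by (rule holomorphic_on_imp_continuous_on[OF csinc_holomorphic])
  have "S = csinc -` (- \<real>\<^sub>\<le>\<^sub>0)" by (auto simp: S_def)
  then have opS: "open S" using contS by (simp add: continuous_on_open_vimage open_Compl)
  have IS: "complex_of_real t \<in> S" if "t \<in> {-pi..pi}" for t
    using rsinc_pos[OF that] by (simp add: S_def csinc_of_real complex_nonpos_Reals_iff)
  define V where "V z = Ln (csinc z)" for z
  have hV: "V holomorphic_on S"
    unfolding V_def by (rule holomorphic_on_Ln') (auto simp: S_def intro: holomorphic_on_subset[OF csinc_holomorphic])
  have hD: "deriv V holomorphic_on S" "deriv (deriv V) holomorphic_on S"
    by (intro holomorphic_deriv hV opS)+
  have Vr: "V (of_real t) = of_real (ln (rsinc t))" if "t \<in> {-pi..pi}" for t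
    using rsinc_pos[OF that] by (simp add: V_def csinc_of_real Ln_of_real)
  have dV: "((\<lambda>t. V (of_real t)) has_vector_derivative deriv V (of_real t)) (at t within {-pi..pi})"
    if "t \<in> {-pi..pi}" for t
    using has_vector_derivative_real_field[OF holomorphic_derivI[OF hV opS IS[OF that], where T = UNIV]] by simp
  have dD: "((\<lambda>t. deriv V (of_real t)) has_vector_derivative deriv (deriv V) (of_real t)) (at t within {-pi..pi})"
    if "t \<in> {-pi..pi}" for t
    using has_vector_derivative_real_field[OF holomorphic_derivI[OF hD(1) opS IS[OF that], where T = UNIV]] by simp
  have c2: "continuous_on {-pi..pi} (\<lambda>t. deriv (deriv V) (complex_of_real t))"
    by (rule continuous_on_compose2[OF holomorphic_on_imp_continuous_on[OF hD(2)]]) (use IS in \<open>auto intro!: continuous_intros\<close>)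
  have c0: "continuous_on {-pi..pi} (\<lambda>t. V (complex_of_real t))"
    by (rule continuous_on_compose2[OF holomorphic_on_imp_continuous_on[OF hV]]) (use IS in \<open>auto intro!: continuous_intros\<close>)
  define C where "C = cmod (deriv V (of_real pi)) + cmod (deriv V (of_real (-pi))) + (LINT t|circ. cmod (deriv (deriv V) (of_real t)))"
  have "\<bar>LINT t|circ. ln (rsinc t) * cos (real k * t)\<bar> \<le> C / (real k)\<^sup>2" if k: "k \<ge> 1" for k
  proof -
    define c where "c = \<i> * complex_of_real (real k)"
    define E where "E t = exp (c * complex_of_real t)" for t
    have c: "c \<noteq> 0" "c * c = - of_real ((real k)\<^sup>2)" using k by (auto simp: c_def power2_eq_square algebra_simps complex_eq_iff)
    have E1: "cmod (E t) = 1" for t by (simp add: E_def c_def)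
    have dE: "(E has_vector_derivative c * E t) (at t within {-pi..pi})" for t
    proof -
      have "((\<lambda>z. exp (c * z)) has_field_derivative c * exp (c * of_real t)) (at (of_real t))"
        by (auto intro!: derivative_eq_intros)
      from has_vector_derivative_real_field[OF this] show ?thesis unfolding E_def[abs_def] by simp
    qed
    have Epi: "E (- pi) = E pi"
    proof -
      have "E (- pi) = cis (- (real k * pi))" "E pi = cis (real k * pi)" by (simp_all add: E_def c_def cis_conv_exp mult.assoc)
      moreover have "sin (real k * pi) = 0" by (simp add: sin_npi)
      ultimately show ?thesis by (simp add: complex_eq_iff)
    qed
    let ?A = "\<lambda>t. V (of_real t) * E t / c - deriv V (of_real t) * E t / (c * c)"
    let ?a = "\<lambda>t. V (of_real t) * E t - deriv (deriv V) (of_real t) * E t / (c * c)"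
    have cE: "continuous_on {-pi..pi} E" unfolding E_def by (intro continuous_intros)
    have "(LINT t|lborel. indicator {-pi..pi} t *\<^sub>R ?a t) = ?A pi - ?A (- pi)"
    proof (rule integral_FTC_Icc)
      fix t :: real assume t: "-pi \<le> t" "t \<le> pi"
      then have t': "t \<in> {-pi..pi}" by simp
      have "(?A has_vector_derivative
         ((V (of_real t) * (c * E t) + deriv V (of_real t) * E t) / c
          - (deriv V (of_real t) * (c * E t) + deriv (deriv V) (of_real t) * E t) / (c * c))) (at t within {-pi..pi})"
        by (intro has_vector_derivative_diff has_vector_derivative_divide has_vector_derivative_mult dV[OF t'] dD[OF t'] dE)
      also have "((V (of_real t) * (c * E t) + deriv V (of_real t) * E t) / c
          - (deriv V (of_real t) * (c * E t) + deriv (deriv V) (of_real t) * E t) / (c * c)) = ?a t"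
        using c(1) by (simp add: field_simps)
      finally show "(?A has_vector_derivative ?a t) (at t within {-pi..pi})" .
    qed (use c in \<open>auto intro!: continuous_intros c0 c2 cE\<close>)
    then have I: "(LINT t|circ. ?a t) = ?A pi - ?A (- pi)" by (simp add: integral_restrict_space)
    have i1: "integrable circ (\<lambda>t. V (of_real t) * E t)" and i2: "integrable circ (\<lambda>t. deriv (deriv V) (of_real t) * E t)"
      by (intro circ_continuous_integrable continuous_intros c0 c2 cE)+
    have "V (of_real (- pi)) = V (of_real pi)" using rsinc_even[of pi] by (simp only: V_def csinc_of_real)
    then have "?A pi - ?A (- pi) = (deriv V (of_real (- pi)) - deriv V (of_real pi)) * E pi / (c * c)"
      using Epi by (simp add: field_simps diff_divide_distrib)
    with I have "(LINT t|circ. V (of_real t) * E t) = (deriv V (of_real (- pi)) - deriv V (of_real pi)) * E pi / (c * c)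
        + (LINT t|circ. deriv (deriv V) (of_real t) * E t) / (c * c)"
      using i1 i2 by (simp add: algebra_simps)
    also have "\<dots> = - ((deriv V (of_real (- pi)) - deriv V (of_real pi)) * E pi + (LINT t|circ. deriv (deriv V) (of_real t) * E t)) / of_real ((real k)\<^sup>2)"
      unfolding c(2) by (simp add: add_divide_distrib diff_divide_distrib)
    also have "cmod \<dots> \<le> C / (real k)\<^sup>2"
    proof -
      have "cmod (LINT t|circ. deriv (deriv V) (of_real t) * E t) \<le> (LINT t|circ. cmod (deriv (deriv V) (of_real t)))"
        using integral_norm_bound[of circ "\<lambda>t. deriv (deriv V) (of_real t) * E t"] by (simp add: norm_mult E1)
      moreover have "cmod ((deriv V (of_real (- pi)) - deriv V (of_real pi)) * E pi)
          \<le> cmod (deriv V (of_real pi)) + cmod (deriv V (of_real (-pi)))"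
        using norm_triangle_ineq4[of "deriv V (of_real (- pi))" "deriv V (of_real pi)"] by (simp add: norm_mult E1)
      ultimately have "cmod ((deriv V (of_real (- pi)) - deriv V (of_real pi)) * E pi + (LINT t|circ. deriv (deriv V) (of_real t) * E t)) \<le> C"
        unfolding C_def by (intro order_trans[OF norm_triangle_ineq]) linarith
      then show ?thesis
        unfolding norm_divide norm_minus_cancel norm_of_real by (simp add: divide_right_mono)
    qed
    finally have "cmod (LINT t|circ. V (of_real t) * E t) \<le> C / (real k)\<^sup>2" .
    moreover have "Re (LINT t|circ. V (of_real t) * E t) = (LINT t|circ. ln (rsinc t) * cos (real k * t))"
    proof -
      have "Re (LINT t|circ. V (of_real t) * E t) = (LINT t|circ. Re (V (of_real t) * E t))"
        by (rule integral_Re[OF i1, symmetric])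
      also have "\<dots> = (LINT t|circ. ln (rsinc t) * cos (real k * t))"
        by (rule Bochner_Integration.integral_cong) (use Vr in \<open>auto simp: E_def c_def Re_exp\<close>)
      finally show ?thesis .
    qed
    ultimately show ?thesis using abs_Re_le_cmod order_trans by metis
  qed
  then show ?thesis by blast
qed

lemma ln_rsinc_continuous: "continuous_on {-pi..pi} (\<lambda>t. ln (rsinc t))"
proof -
  have "continuous_on UNIV (\<lambda>t. Re (csinc (of_real t)))"
    by (intro continuous_intros continuous_on_compose2[OF holomorphic_on_imp_continuous_on[OF csinc_holomorphic]]) auto
  then have "continuous_on {-pi..pi} rsinc"
    by (rule continuous_on_subset[THEN continuous_on_eq]) (auto simp: csinc_of_real)
  then show ?thesis by (rule continuous_on_ln) (use rsinc_pos in force)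
qed

text \<open>Polynomials in \<open>cos t\<close> approximate an even continuous function uniformly, and their integrals against \<open>D\<close>
  vanish, so that \<open>D\<close> is orthogonal to itself.\<close>

lemma even_fourier_unique:
  fixes D :: "real \<Rightarrow> real"
  assumes D: "continuous_on {-pi..pi} D" and ev: "\<And>t. D (- t) = D t"
    and zero: "\<And>j::nat. (LINT t|circ. D t * cos (real j * t)) = 0"
  shows "AE t in circ. D t = 0"
proof -
  have int: "integrable circ (\<lambda>t. D t * g t)" if "continuous_on {-pi..pi} g" for g
    by (intro circ_continuous_integrable continuous_intros D that)
  have zi: "(LINT t|circ. D t * cos (of_int j * t)) = 0" for j :: int
  proof (cases "j \<ge> 0")
    case True then show ?thesis using zero[of "nat j"] by simp
  next
    case False
    have "cos (of_int j * t) = cos (real (nat (- j)) * t)" for t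
      using False cos_minus[of "of_int j * t"] by simp
    then show ?thesis using zero by simp
  qed
  have pw: "(LINT t|circ. D t * (cos t ^ i * cos (of_int j * t))) = 0" for i and j :: int
  proof (induction i arbitrary: j)
    case 0 show ?case using zi by simp
  next
    case (Suc i)
    have eq: "D t * (cos t ^ Suc i * cos (of_int j * t)) =
        1/2 * (D t * (cos t ^ i * cos (of_int (j + 1) * t))) + 1/2 * (D t * (cos t ^ i * cos (of_int (j - 1) * t)))" for t
    proof -
      have "cos t * cos (of_int j * t) = (cos (of_int (j + 1) * t) + cos (of_int (j - 1) * t)) / 2"
        using cos_times_cos[of "of_int j * t" t] by (simp add: algebra_simps)
      then have "D t * (cos t ^ i * (cos t * cos (of_int j * t)))
          = D t * (cos t ^ i * ((cos (of_int (j + 1) * t) + cos (of_int (j - 1) * t)) / 2))" by (simp only:)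
      then show ?thesis by (simp only: power_Suc2 mult.assoc ring_distribs times_divide_eq_right add_divide_distrib mult_1_left times_divide_eq_left)
    qed
    show ?case unfolding eq
      by (subst Bochner_Integration.integral_add)
         (auto simp only: integral_mult_right_zero Suc.IH intro!: integrable_mult_right int continuous_intros)
  qed
  have poly: "(LINT t|circ. D t * p (cos t)) = 0" if "real_polynomial_function p" for p
  proof -
    from that obtain a m where p: "p = (\<lambda>x. \<Sum>i\<le>m. a i * x ^ i)" unfolding real_polynomial_function_iff_sum by blast
    have "(LINT t|circ. D t * p (cos t)) = (LINT t|circ. (\<Sum>i\<le>m. a i * (D t * (cos t ^ i * cos (of_int 0 * t)))))"
      unfolding p by (intro Bochner_Integration.integral_cong refl) (simp add: sum_distrib_left mult_ac)
    also have "\<dots> = (\<Sum>i\<le>m. LINT t|circ. a i * (D t * (cos t ^ i * cos (of_int 0 * t))))"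
      by (rule Bochner_Integration.integral_sum) (intro integrable_mult_right int continuous_intros)
    also have "\<dots> = 0" by (simp only: integral_mult_right_zero pw) simp
    finally show ?thesis .
  qed
  have Dcos: "D t = D (arccos (cos t))" if "t \<in> {-pi..pi}" for t
  proof (cases "t \<ge> 0")
    case True then show ?thesis using that by (simp add: arccos_cos)
  next
    case False then show ?thesis using that ev[of t] arccos_cos[of "- t"] by simp
  qed
  have cE: "continuous_on {-1..1} (\<lambda>x. D (arccos x))"
    by (rule continuous_on_compose2[OF D continuous_on_arccos'])
       (use arccos_lbound arccos_ubound order_trans[of "-pi" 0] in \<open>auto intro: order_trans[of _ 0]\<close>)
  define B where "B = (LINT t|circ. \<bar>D t\<bar>)"
  have le: "(LINT t|circ. (D t)\<^sup>2) \<le> e * B" if e: "e > 0" for e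
  proof -
    obtain p where p: "real_polynomial_function p" "\<And>x. x \<in> {-1..1} \<Longrightarrow> \<bar>D (arccos x) - p x\<bar> < e"
      using Stone_Weierstrass_real_polynomial_function[OF compact_Icc cE e] by blast
    have cp: "continuous_on {-pi..pi} (\<lambda>t. p (cos t))"
      by (rule continuous_on_compose2[OF continuous_on_polymonial_function[of p UNIV]])
         (use p(1) in \<open>auto simp: real_polynomial_function_eq intro!: continuous_intros\<close>)
    have "(LINT t|circ. (D t)\<^sup>2) = (LINT t|circ. D t * (D t - p (cos t)))"
    proof -
      have "(LINT t|circ. D t * (D t - p (cos t))) = (LINT t|circ. (D t)\<^sup>2 - D t * p (cos t))"
        by (simp add: algebra_simps power2_eq_square)
      also have "\<dots> = (LINT t|circ. (D t)\<^sup>2) - 0"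
        unfolding poly[OF p(1), symmetric]
        by (rule Bochner_Integration.integral_diff) (auto simp: power2_eq_square intro!: int D cp)
      finally show ?thesis by simp
    qed
    also have "\<dots> \<le> (LINT t|circ. e * \<bar>D t\<bar>)"
    proof (rule integral_mono)
      fix t assume "t \<in> space circ"
      then have "\<bar>D t - p (cos t)\<bar> < e" using p(2)[of "cos t"] Dcos[of t] by simp
      then have "\<bar>D t\<bar> * \<bar>D t - p (cos t)\<bar> \<le> \<bar>D t\<bar> * e" by (intro mult_left_mono) auto
      then show "D t * (D t - p (cos t)) \<le> e * \<bar>D t\<bar>"
        using abs_ge_self[of "D t * (D t - p (cos t))"] by (simp add: abs_mult mult.commute)
    qed (auto intro!: int continuous_intros D cp integrable_mult_right circ_continuous_integrable)
    finally show ?thesis by (simp add: B_def)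
  qed
  have B0: "B \<ge> 0" by (simp add: B_def)
  have "(LINT t|circ. (D t)\<^sup>2) \<le> 0"
  proof (rule field_le_epsilon)
    fix e :: real assume "e > 0"
    have "(LINT t|circ. (D t)\<^sup>2) \<le> e / (B + 1) * B" by (rule le) (use \<open>e > 0\<close> B0 in simp)
    also have "\<dots> \<le> e" using \<open>e > 0\<close> B0 by (simp add: field_simps)
    finally show "(LINT t|circ. (D t)\<^sup>2) \<le> 0 + e" by simp
  qed
  then have "(LINT t|circ. (D t)\<^sup>2) = 0" by (intro antisym) auto
  then have "AE t in circ. (D t)\<^sup>2 = 0"
    by (subst (asm) integral_nonneg_eq_0_iff_AE) (auto simp: power2_eq_square intro!: int D)
  then show ?thesis by simp
qed

text \<open>The cosine series converges absolutely by the decay of its coefficients and, its coefficients being real, is the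
  real part of a power series on the circle. The analytic function \<open>exp U\<close> therefore has modulus
  \<open>|1 - cis t| / |t|\<close> there.\<close>

lemma ln_rsinc_fourier:
  obtains U u where "wiener U u" "\<And>k. u k \<in> \<real>" "AE t in circ. ln (rsinc t) = Re (U (cis t))"
proof -
  define c where "c k = (LINT t|circ. ln (rsinc t) * cos (real k * t)) / (2 * pi)" for k
  define u where "u k = complex_of_real (if k = 0 then c 0 else 2 * c k)" for k
  obtain C where C: "\<And>k. k \<ge> 1 \<Longrightarrow> \<bar>LINT t|circ. ln (rsinc t) * cos (real k * t)\<bar> \<le> C / (real k)\<^sup>2"
    using ln_rsinc_coeff_bound by blast
  have "summable (\<lambda>k. cmod (u k))"
  proof (rule summable_comparison_test)
    show "\<exists>N. \<forall>k\<ge>N. norm (cmod (u k)) \<le> C / pi * inverse ((real k)\<^sup>2)"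
    proof (intro exI allI impI)
      fix k :: nat assume "1 \<le> k"
      then have "norm (cmod (u k)) = \<bar>LINT t|circ. ln (rsinc t) * cos (real k * t)\<bar> / pi"
        by (simp add: u_def c_def norm_divide)
      also have "\<dots> \<le> C / (real k)\<^sup>2 / pi" using C[OF \<open>1 \<le> k\<close>] by (intro divide_right_mono) auto
      finally show "norm (cmod (u k)) \<le> C / pi * inverse ((real k)\<^sup>2)" by (simp add: field_simps)
    qed
    show "summable (\<lambda>k. C / pi * inverse ((real k)\<^sup>2))"
      by (intro summable_mult inverse_power_summable) simp
  qed
  then have U: "wiener (\<lambda>z. \<Sum>k. u k * z ^ k) u" by (simp add: wiener_def)
  define U where "U z = (\<Sum>k. u k * z ^ k)" for z
  have U: "wiener U u" using U by (simp add: U_def[abs_def])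
  have cnjU: "U (cnj z) = cnj (U z)" if "norm z \<le> 1" for z
  proof -
    have "(\<lambda>k. cnj (u k * z ^ k)) sums cnj (U z)" using wiener_sums[OF U that] by (simp only: sums_cnj)
    then show ?thesis by (simp add: U_def u_def sums_iff)
  qed
  define D where "D t = ln (rsinc t) - Re (U (cis t))" for t
  have cU: "continuous_on {-pi..pi} (\<lambda>t. Re (U (cis t)))"
    by (intro continuous_intros wiener_circle_continuous(1)[OF U])
  have "AE t in circ. D t = 0"
  proof (rule even_fourier_unique)
    show "continuous_on {-pi..pi} D" unfolding D_def by (intro continuous_intros ln_rsinc_continuous cU)
    show "D (- t) = D t" for t
      using cnjU[of "cis t"] by (simp add: D_def rsinc_even cis_cnj)
    fix j :: nat
    have "(LINT t|circ. Re (U (cis t)) * cos (real j * t)) = Re (LINT t|circ. of_real (Re (U (cis t))) * cis t ^ j)"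
      by (subst integral_Re[symmetric])
         (auto simp: Complex.DeMoivre intro!: circ_continuous_integrable continuous_intros cU)
    also have "(LINT t|circ. of_real (Re (U (cis t))) * cis t ^ j)
       = (LINT t|circ. 1/2 * (cis t ^ j * U (cis t)) + 1/2 * (cis t ^ j * U (cis (- t))))"
    proof (intro Bochner_Integration.integral_cong refl)
      fix t
      have eq: "of_real (Re (U (cis t))) = (U (cis t) + U (cis (- t))) / 2"
        using cnjU[of "cis t"] complex_add_cnj[of "U (cis t)"] by (simp add: cis_cnj)
      then show "of_real (Re (U (cis t))) * cis t ^ j = 1/2 * (cis t ^ j * U (cis t)) + 1/2 * (cis t ^ j * U (cis (- t)))"
        unfolding eq by (simp add: field_simps)
    qed
    also have "\<dots> = 1/2 * (LINT t|circ. cis t ^ j * U (cis t)) + 1/2 * (LINT t|circ. cis t ^ j * U (cis (- t)))"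
      by (subst Bochner_Integration.integral_add)
         (auto simp only: integral_mult_right_zero intro!: integrable_mult_right circ_continuous_integrable continuous_intros wiener_circle_continuous[OF U])
    also have "(LINT t|circ. cis t ^ j * U (cis t)) = complex_of_real (2 * pi) * (0 ^ j * U 0)"
      using wiener_mean[OF wiener_mult[OF wiener_monomial[of j] U]] by simp
    also have "(LINT t|circ. cis t ^ j * U (cis (- t))) = complex_of_real (2 * pi) * u j"
      by (rule wiener_coeff_integral[OF U])
    also have "1/2 * (complex_of_real (2 * pi) * (0 ^ j * U 0)) + 1/2 * (complex_of_real (2 * pi) * u j) = complex_of_real (2 * pi * c j)"
      using wiener_at_0[OF U] by (cases "j = 0") (auto simp: u_def)
    finally have "(LINT t|circ. Re (U (cis t)) * cos (real j * t)) = 2 * pi * c j" by simp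
    moreover have "2 * pi * c j = (LINT t|circ. ln (rsinc t) * cos (real j * t))" by (simp add: c_def)
    moreover have "(LINT t|circ. D t * cos (real j * t)) = (LINT t|circ. ln (rsinc t) * cos (real j * t)) - (LINT t|circ. Re (U (cis t)) * cos (real j * t))"
      unfolding D_def left_diff_distrib
      by (rule Bochner_Integration.integral_diff) (intro circ_continuous_integrable continuous_intros ln_rsinc_continuous cU)+
    ultimately show "(LINT t|circ. D t * cos (real j * t)) = 0" by simp
  qed
  then have "AE t in circ. ln (rsinc t) = Re (U (cis t))" by (simp add: D_def)
  moreover have "u k \<in> \<real>" for k by (simp add: u_def)
  ultimately show thesis using that U by blast
qed

section \<open>The outer function of the increment kernel\<close>

lemma integrable_Fatou:
  fixes g :: "nat \<Rightarrow> 'a \<Rightarrow> real"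
  assumes g: "\<And>j. integrable M (g j)" "\<And>j. AE x in M. g j x \<ge> 0" "\<And>j. (LINT x|M. g j x) \<le> C"
    and h: "h \<in> borel_measurable M" "AE x in M. (\<lambda>j. g j x) \<longlonglongrightarrow> h x"
  shows "integrable M h"
proof (rule integrableI_bounded)
  have nn: "AE x in M. h x \<ge> 0"
  proof -
    have "AE x in M. \<forall>j. g j x \<ge> 0" using g(2) by (simp add: AE_all_countable)
    then show ?thesis using h(2) by eventually_elim (auto intro: LIMSEQ_le_const)
  qed
  have "(\<integral>\<^sup>+x. ennreal (norm (h x)) \<partial>M) = (\<integral>\<^sup>+x. liminf (\<lambda>j. ennreal (g j x)) \<partial>M)"
  proof (rule nn_integral_cong_AE)
    show "AE x in M. ennreal (norm (h x)) = liminf (\<lambda>j. ennreal (g j x))"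
      using nn h(2)
    proof eventually_elim
      fix x assume "h x \<ge> 0" "(\<lambda>j. g j x) \<longlonglongrightarrow> h x"
      then have "(\<lambda>j. ennreal (g j x)) \<longlonglongrightarrow> ennreal (norm (h x))" by (intro tendsto_ennrealI) simp
      then show "ennreal (norm (h x)) = liminf (\<lambda>j. ennreal (g j x))" by (simp add: lim_imp_Liminf)
    qed
  qed
  also have "\<dots> \<le> liminf (\<lambda>j. \<integral>\<^sup>+x. ennreal (g j x) \<partial>M)"
    by (rule nn_integral_liminf) (use g(1) in auto)
  also have "\<dots> \<le> liminf (\<lambda>j::nat. ennreal C)"
  proof (rule Liminf_mono, rule always_eventually, rule allI)
    fix j show "(\<integral>\<^sup>+x. ennreal (g j x) \<partial>M) \<le> ennreal C"
      using nn_integral_eq_integral[OF g(1,2), of j] g(3)[of j] by (simp add: ennreal_leI)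
  qed
  finally show "(\<integral>\<^sup>+x. ennreal (norm (h x)) \<partial>M) < \<infinity>"
    by (simp add: Liminf_const order_le_less_trans)
qed (rule h(1))

text \<open>A sequence of radii that approaches the unit circle from inside.\<close>

definition rad :: "nat \<Rightarrow> real" where "rad j = real (j + 1) / real (j + 2)"

lemma rad: "0 < rad j" "rad j < 1" by (simp_all add: rad_def)

lemma rad_tendsto: "rad \<longlonglongrightarrow> 1"
proof -
  have "(\<lambda>j. 1 - inverse (real (Suc (Suc j)))) \<longlonglongrightarrow> 1 - 0"
    by (intro tendsto_intros LIMSEQ_Suc[OF LIMSEQ_inverse_real_of_nat])
  moreover have "1 - inverse (real (Suc (Suc j))) = rad j" for j by (simp add: rad_def field_simps)
  ultimately show ?thesis by simp
qed

context
  fixes z :: complex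
  assumes z: "norm z < 1"
begin

definition schwarz_kernel :: "real \<Rightarrow> complex" where
  "schwarz_kernel t = (cis t + z) / (cis t - z)"

lemma cis_minus_z: "cis t - z \<noteq> 0"
  using z by (metis eq_iff_diff_eq_0 norm_cis less_irrefl)

lemma schwarz_kernel_continuous: "continuous_on S schwarz_kernel"
  unfolding schwarz_kernel_def[abs_def] using cis_minus_z by (intro continuous_intros) auto

lemma schwarz_kernel_bound: "cmod (schwarz_kernel t) \<le> 2 / (1 - norm z)"
proof -
  have "cmod (cis t + z) \<le> 2" using norm_triangle_ineq[of "cis t" z] z by simp
  moreover have "cmod (cis t - z) \<ge> 1 - norm z" using norm_triangle_ineq2[of "cis t" z] by simp
  ultimately show ?thesis unfolding schwarz_kernel_def norm_divide using z by (intro frac_le) auto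
qed

lemma schwarz_kernel_series:
  obtains K where "wiener K (\<lambda>k. 2 * z ^ k - (if k = 0 then 1 else 0))" "\<And>t. schwarz_kernel t = K (cis (- t))"
proof -
  have "wiener (\<lambda>\<zeta>. 1 / (1 - z * \<zeta>)) (\<lambda>k. z ^ k)"
  proof -
    have "norm (z * \<zeta>) < 1" if "norm \<zeta> \<le> 1" for \<zeta>
      using z that mult_left_le[of "norm \<zeta>" "norm z"] by (simp add: norm_mult)
    then have "1 / (1 - z * \<zeta>) = (\<Sum>k. z ^ k * \<zeta> ^ k)" if "norm \<zeta> \<le> 1" for \<zeta>
      unfolding power_mult_distrib[symmetric] using that by (intro suminf_geometric[symmetric])
    then show ?thesis
      using z by (auto simp: wiener_def norm_power summable_geometric)
  qed
  from wiener_diff[OF wiener_cmult[OF this, of 2] wiener_const[of 1]]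
  have "wiener (\<lambda>\<zeta>. 2 * (1 / (1 - z * \<zeta>)) - 1) (\<lambda>k. 2 * z ^ k - (if k = 0 then 1 else 0))" .
  moreover have "schwarz_kernel t = 2 * (1 / (1 - z * cis (- t))) - 1" for t
  proof -
    have c: "cis t * cis (- t) = 1" by (simp add: cis_mult)
    have n: "cis t - z \<noteq> 0" by (rule cis_minus_z)
    have e: "cis t * (1 - z * cis (- t)) = cis t - z" using c by (simp add: algebra_simps)
    then have "1 - z * cis (- t) \<noteq> 0" using n by auto
    moreover have "cis t * (1 + z * cis (- t)) = cis t + z" using c by (simp add: algebra_simps)
    then have "schwarz_kernel t = (1 + z * cis (- t)) / (1 - z * cis (- t))"
      unfolding schwarz_kernel_def e[symmetric] by (metis cis_neq_zero mult_divide_mult_cancel_left)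
    ultimately show ?thesis by (simp add: field_simps)
  qed
  ultimately show thesis using that by blast
qed

lemma schwarz_kernel_integrable:
  fixes g :: "real \<Rightarrow> real"
  assumes "integrable circ g" shows "integrable circ (\<lambda>t. schwarz_kernel t * of_real (g t))"
proof (rule Bochner_Integration.integrable_bound[where f = "\<lambda>t. 2 / (1 - norm z) * norm (g t)"])
  show "integrable circ (\<lambda>t. 2 / (1 - norm z) * norm (g t))" using assms by simp
  have "schwarz_kernel \<in> borel_measurable circ"
    by (rule borel_measurable_integrable[OF circ_continuous_integrable[OF schwarz_kernel_continuous]])
  moreover have "(\<lambda>t. complex_of_real (g t)) \<in> borel_measurable circ"
    by (rule measurable_compose[OF borel_measurable_integrable[OF assms] borel_measurable_of_real])
  ultimately show "(\<lambda>t. schwarz_kernel t * of_real (g t)) \<in> borel_measurable circ"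
    by (rule borel_measurable_times)
  show "AE t in circ. norm (schwarz_kernel t * of_real (g t)) \<le> norm (2 / (1 - norm z) * norm (g t))"
  proof (rule AE_I2)
    fix t
    have "cmod (schwarz_kernel t) * \<bar>g t\<bar> \<le> 2 / (1 - norm z) * \<bar>g t\<bar>"
      by (intro mult_right_mono schwarz_kernel_bound) simp
    then show "norm (schwarz_kernel t * of_real (g t)) \<le> norm (2 / (1 - norm z) * norm (g t))"
      using z by (simp add: norm_mult abs_mult)
  qed
qed

text \<open>The Schwarz integral recovers an analytic function from its real part on the circle, up to an imaginary constant,
  which \<open>G 0 \<in> \<real>\<close> excludes. The real part is half the sum of \<open>G\<close> and its conjugate, and the kernel is itself a
  power series in \<open>cis (- t)\<close>, so that only products of two series have to be integrated.\<close>

lemma schwarz_integral_wiener: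
  assumes G: "wiener G g" and real: "G 0 \<in> \<real>"
  shows "(LINT t|circ. schwarz_kernel t * of_real (2 * Re (G (cis t)))) = complex_of_real (4 * pi) * G z"
proof -
  obtain K where K: "wiener K (\<lambda>k. 2 * z ^ k - (if k = 0 then 1 else 0))" "\<And>t. schwarz_kernel t = K (cis (- t))"
    by (rule schwarz_kernel_series, rule that)
  let ?H = "\<lambda>\<zeta>. cnj (G (cnj \<zeta>)) * K \<zeta>"
  note H = wiener_mult[OF wiener_cnj[OF G] K(1)]
  have "(LINT t|circ. schwarz_kernel t * of_real (2 * Re (G (cis t)))) = (LINT t|circ. G (cis t) * K (cis (- t)) + ?H (cis (- t)))"
  proof (intro Bochner_Integration.integral_cong refl)
    fix t
    have e: "of_real (2 * Re (G (cis t))) = G (cis t) + cnj (G (cnj (cis (- t))))"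
      using complex_add_cnj[of "G (cis t)"] by (simp add: cis_cnj)
    show "schwarz_kernel t * of_real (2 * Re (G (cis t))) = G (cis t) * K (cis (- t)) + ?H (cis (- t))"
      unfolding K(2) e by (simp add: algebra_simps)
  qed
  also have "\<dots> = (LINT t|circ. G (cis t) * K (cis (- t))) + (LINT t|circ. ?H (cis (- t)))"
    by (rule Bochner_Integration.integral_add)
       (intro circ_continuous_integrable continuous_on_mult wiener_circle_continuous[OF G] wiener_circle_continuous[OF K(1)] wiener_circle_continuous[OF H])+
  also have "(LINT t|circ. ?H (cis (- t))) = complex_of_real (2 * pi) * ?H 0"
    using wiener_coeff_integral[OF H, of 0] wiener_at_0[OF H] by simp
  also have "?H 0 = G 0"
    using real wiener_at_0[OF K(1)] by (auto simp: Reals_def)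
  also have "(LINT t|circ. G (cis t) * K (cis (- t))) = complex_of_real (2 * pi) * (2 * G z - G 0)"
  proof -
    have "(\<lambda>k. 2 * (g k * z ^ k) - (if k = 0 then g 0 else 0)) sums (2 * G z - g 0)"
      by (intro sums_diff sums_mult wiener_sums[OF G] sums_single) (use z in simp)
    moreover have "(\<lambda>k. g k * (2 * z ^ k - (if k = 0 then 1 else 0))) = (\<lambda>k. 2 * (g k * z ^ k) - (if k = 0 then g 0 else 0))"
      by (auto simp: algebra_simps)
    ultimately have "(LINT t|circ. G (cis t) * K (cis (- t))) / (2 * pi) = 2 * G z - g 0"
      using wiener_pairing[OF G K(1)] by (simp only: sums_unique2)
    then show ?thesis using wiener_at_0[OF G] by (simp add: field_simps)
  qed
  finally show ?thesis by (simp add: algebra_simps)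
qed

end

text \<open>Both \<open>1 - r\<close> and the distance to \<open>1\<close> are controlled by the distance of the radial point to \<open>1\<close>. This gives the
  integrable minorant for the logarithms below.\<close>

lemma one_minus_radial_lower:
  assumes "norm (\<zeta>::complex) = 1" "0 \<le> r" "r \<le> 1" shows "norm (1 - \<zeta>) \<le> 2 * norm (1 - of_real r * \<zeta>)"
proof -
  have "1 - \<zeta> = (1 - of_real r * \<zeta>) - of_real (1 - r) * \<zeta>" by (simp add: algebra_simps)
  then have "norm (1 - \<zeta>) \<le> norm (1 - of_real r * \<zeta>) + norm (of_real (1 - r) * \<zeta>)"
    by (metis norm_triangle_ineq4)
  moreover have "norm (of_real (1 - r) * \<zeta>) = 1 - r" using assms by (simp add: norm_mult del: of_real_diff)
  moreover have "1 - r \<le> norm (1 - of_real r * \<zeta>)"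
    using norm_triangle_ineq2[of 1 "of_real r * \<zeta>"] assms by (simp add: norm_mult)
  ultimately show ?thesis by linarith
qed

lemma countable_cis_eq_1: assumes "\<mu> > 0" shows "countable {t. cis (t * real \<mu>) = 1}"
proof (rule countable_subset)
  show "{t. cis (t * real \<mu>) = 1} \<subseteq> range (\<lambda>k::int. of_int k * 2 * pi / real \<mu>)"
  proof
    fix t assume "t \<in> {t. cis (t * real \<mu>) = 1}"
    then have "cos (t * real \<mu>) = 1" by (metis (mono_tags) cis.sel(1) mem_Collect_eq one_complex.sel(1))
    then obtain k :: int where "t * real \<mu> = of_int k * 2 * pi" using cos_one_2pi_int by blast
    then show "t \<in> range (\<lambda>k::int. of_int k * 2 * pi / real \<mu>)"
      using assms by (auto simp: field_simps intro!: image_eqI[of _ _ k])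
  qed
qed simp

text \<open>The functions \<open>Ln (1 - (r z) ^ \<mu>)\<close> with \<open>r < 1\<close> are analytic on a disk of radius larger than \<open>1\<close>
  and approximate \<open>Ln (1 - z ^ \<mu>)\<close>.\<close>

definition log_approx :: "nat \<Rightarrow> nat \<Rightarrow> complex \<Rightarrow> complex" where
  "log_approx \<mu> j z = Ln (1 - (of_real (rad j) * z) ^ \<mu>)"

lemma log_approx_wiener: assumes "\<mu> > 0" obtains g where "wiener (log_approx \<mu> j) g"
proof -
  have "log_approx \<mu> j holomorphic_on ball 0 (1 / rad j)"
    unfolding log_approx_def[abs_def]
  proof (intro holomorphic_intros)
    fix z assume "z \<in> ball (0::complex) (1 / rad j)"
    then have "norm (of_real (rad j) * z) < 1" using rad[of j] by (simp add: norm_mult field_simps)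
    then have "norm ((of_real (rad j) * z) ^ \<mu>) < 1" using assms by (simp add: norm_power power_less_one_iff)
    then have "Re (1 - (of_real (rad j) * z) ^ \<mu>) > 0"
      using complex_Re_le_cmod[of "(of_real (rad j) * z) ^ \<mu>"] by simp
    then show "1 - (of_real (rad j) * z) ^ \<mu> \<notin> \<real>\<^sub>\<le>\<^sub>0" by (auto simp: complex_nonpos_Reals_iff)
  qed
  then show thesis using wiener_holomorphic[of "log_approx \<mu> j" "1 / rad j"] rad[of j] that by (simp add: field_simps) blast
qed

lemma log_approx_0: "\<mu> > 0 \<Longrightarrow> log_approx \<mu> j 0 = 0"
  by (simp add: log_approx_def power_0_left)

definition circle_log :: "nat \<Rightarrow> real \<Rightarrow> real" where
  "circle_log \<mu> t = ln (cmod (1 - cis (t * real \<mu>)))"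

lemma Re_log_approx:
  assumes "\<mu> > 0" shows "Re (log_approx \<mu> j (cis t)) = ln (cmod (1 - of_real (rad j ^ \<mu>) * cis (t * real \<mu>)))"
proof -
  have "norm (of_real (rad j ^ \<mu>) * cis (t * real \<mu>)) < 1"
    using rad[of j] assms by (simp add: norm_mult power_less_one_iff norm_power)
  then have "1 - of_real (rad j ^ \<mu>) * cis (t * real \<mu>) \<noteq> 0" by (metis eq_iff_diff_eq_0 less_irrefl norm_one)
  moreover have "(of_real (rad j) * cis t) ^ \<mu> = of_real (rad j ^ \<mu>) * cis (t * real \<mu>)"
    by (simp add: power_mult_distrib Complex.DeMoivre mult.commute)
  ultimately show ?thesis by (simp add: log_approx_def Re_Ln)
qed

lemma Re_log_approx_le: assumes "\<mu> > 0" shows "Re (log_approx \<mu> j (cis t)) \<le> ln 2"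
proof -
  have le: "norm (of_real (rad j ^ \<mu>) * cis (t * real \<mu>)) < 1"
    using rad[of j] assms by (simp add: norm_mult power_less_one_iff norm_power)
  then have "1 - of_real (rad j ^ \<mu>) * cis (t * real \<mu>) \<noteq> 0" by (metis eq_iff_diff_eq_0 less_irrefl norm_one)
  moreover have "cmod (1 - of_real (rad j ^ \<mu>) * cis (t * real \<mu>)) \<le> 2"
    using norm_triangle_ineq4[of 1 "of_real (rad j ^ \<mu>) * cis (t * real \<mu>)"] le by simp
  ultimately show ?thesis unfolding Re_log_approx[OF assms] by (intro ln_mono) auto
qed

lemma Re_log_approx_ge:
  assumes "\<mu> > 0" "cis (t * real \<mu>) \<noteq> 1" shows "circle_log \<mu> t - ln 2 \<le> Re (log_approx \<mu> j (cis t))"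
proof -
  have p: "cmod (1 - cis (t * real \<mu>)) > 0" using assms by simp
  have "cmod (1 - cis (t * real \<mu>)) \<le> 2 * cmod (1 - of_real (rad j ^ \<mu>) * cis (t * real \<mu>))"
    using rad[of j] by (intro one_minus_radial_lower) (auto simp: power_le_one)
  then have "cmod (1 - cis (t * real \<mu>)) / 2 \<le> cmod (1 - of_real (rad j ^ \<mu>) * cis (t * real \<mu>))" by simp
  then have "ln (cmod (1 - cis (t * real \<mu>)) / 2) \<le> ln (cmod (1 - of_real (rad j ^ \<mu>) * cis (t * real \<mu>)))"
    using p by (intro ln_mono) auto
  then show ?thesis unfolding Re_log_approx[OF assms(1)] circle_log_def using p by (simp add: ln_div)
qed

lemma Re_log_approx_tendsto:
  assumes "\<mu> > 0" "cis (t * real \<mu>) \<noteq> 1" shows "(\<lambda>j. Re (log_approx \<mu> j (cis t))) \<longlonglongrightarrow> circle_log \<mu> t"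
proof -
  have "(\<lambda>j. ln (cmod (1 - of_real (rad j ^ \<mu>) * cis (t * real \<mu>)))) \<longlonglongrightarrow> ln (cmod (1 - of_real (1 ^ \<mu>) * cis (t * real \<mu>)))"
    by (intro tendsto_intros rad_tendsto) (use assms in auto)
  then show ?thesis by (simp add: Re_log_approx[OF assms(1)] circle_log_def)
qed

lemma circle_log_AE: assumes "\<mu> > 0" shows "AE t in circ. cis (t * real \<mu>) \<noteq> 1"
  by (rule circ_AE_countable[OF countable_cis_eq_1[OF assms]]) auto

lemma log_approx_integrable: assumes "\<mu> > 0"
  shows "integrable circ (\<lambda>t. Re (log_approx \<mu> j (cis t)))" "(LINT t|circ. Re (log_approx \<mu> j (cis t))) = 0"
proof -
  obtain g where g: "wiener (log_approx \<mu> j) g" by (rule log_approx_wiener[OF assms])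
  have i: "integrable circ (\<lambda>t. log_approx \<mu> j (cis t))"
    by (rule circ_continuous_integrable[OF wiener_circle_continuous(1)[OF g]])
  then show "integrable circ (\<lambda>t. Re (log_approx \<mu> j (cis t)))" by (rule integrable_Re)
  show "(LINT t|circ. Re (log_approx \<mu> j (cis t))) = 0"
    using integral_Re[OF i] wiener_mean[OF g] log_approx_0[OF assms] by simp
qed

lemma circle_log_measurable: "circle_log \<mu> \<in> borel_measurable circ"
proof -
  have "(\<lambda>t. cmod (1 - cis (t * real \<mu>))) \<in> borel_measurable borel"
    by (intro borel_measurable_continuous_onI continuous_intros)
  then have "circle_log \<mu> \<in> borel_measurable borel"
    unfolding circle_log_def[abs_def] by (rule borel_measurable_ln)
  then show ?thesis by (simp add: measurable_restrict_space1)
qed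

text \<open>The functions \<open>ln 2 - Re (log_approx \<mu> j (cis t))\<close> are nonnegative and all have the integral \<open>2 * pi * ln 2\<close>, because
  \<open>log_approx\<close> is analytic and vanishes at \<open>0\<close>; Fatou's lemma passes to the limit.\<close>

lemma circle_log_integrable: assumes "\<mu> > 0" shows "integrable circ (circle_log \<mu>)"
proof -
  have "integrable circ (\<lambda>t. ln 2 - circle_log \<mu> t)"
  proof (rule integrable_Fatou[where g = "\<lambda>j t. ln 2 - Re (log_approx \<mu> j (cis t))" and C = "2 * pi * ln 2"])
    show "AE t in circ. (\<lambda>j. ln 2 - Re (log_approx \<mu> j (cis t))) \<longlonglongrightarrow> ln 2 - circle_log \<mu> t"
      using circle_log_AE[OF assms]
      by eventually_elim (intro tendsto_intros Re_log_approx_tendsto assms)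
  qed (use log_approx_integrable[OF assms] Re_log_approx_le[OF assms] circle_log_measurable in auto)
  from Bochner_Integration.integrable_diff[OF _ this, of "\<lambda>t. ln 2"] show ?thesis by simp
qed

text \<open>The boundary function is unbounded at the zeros of \<open>1 - z ^ \<mu>\<close>, so the formula is obtained from the radial
  approximations by dominated convergence.\<close>

lemma schwarz_integral_circle_log:
  assumes "\<mu> > 0" and z: "norm z < 1"
  shows "(LINT t|circ. schwarz_kernel z t * of_real (2 * circle_log \<mu> t)) = complex_of_real (4 * pi) * Ln (1 - z ^ \<mu>)"
proof (rule LIMSEQ_unique)
  have aux: "\<bar>2 * R\<bar> \<le> 2 * (2 * L + \<bar>c\<bar>)" if "R \<le> L" "c - L \<le> R" "0 \<le> L" for R L c :: real
    using that by (simp add: abs_if split: if_splits)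
  let ?w = "\<lambda>t. 2 / (1 - norm z) * (2 * (2 * ln 2 + \<bar>circle_log \<mu> t\<bar>))"
  have km: "schwarz_kernel z \<in> borel_measurable circ"
    by (rule borel_measurable_integrable[OF circ_continuous_integrable[OF schwarz_kernel_continuous[OF z]]])
  show "(\<lambda>j. LINT t|circ. schwarz_kernel z t * of_real (2 * Re (log_approx \<mu> j (cis t))))
      \<longlonglongrightarrow> (LINT t|circ. schwarz_kernel z t * of_real (2 * circle_log \<mu> t))"
  proof (rule integral_dominated_convergence[where w = ?w])
    show "integrable circ ?w" using circle_log_integrable[OF assms(1)] by simp
    show "AE t in circ. (\<lambda>j. schwarz_kernel z t * of_real (2 * Re (log_approx \<mu> j (cis t)))) \<longlonglongrightarrow> schwarz_kernel z t * of_real (2 * circle_log \<mu> t)"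
      using circle_log_AE[OF assms(1)]
      by eventually_elim (intro tendsto_intros Re_log_approx_tendsto assms)
    show "AE t in circ. norm (schwarz_kernel z t * of_real (2 * Re (log_approx \<mu> j (cis t)))) \<le> ?w t" for j
      using circle_log_AE[OF assms(1)]
    proof eventually_elim
      case (elim t)
      have ln2: "0 \<le> ln (2::real)" by simp
      have "\<bar>2 * Re (log_approx \<mu> j (cis t))\<bar> \<le> 2 * (2 * ln 2 + \<bar>circle_log \<mu> t\<bar>)"
        by (rule aux[OF Re_log_approx_le[OF assms(1)] Re_log_approx_ge[OF assms(1) elim] ln2])
      then show ?case unfolding norm_mult norm_of_real
        by (intro mult_mono schwarz_kernel_bound[OF z]) (use z in auto)
    qed
    show "(\<lambda>t. schwarz_kernel z t * of_real (2 * circle_log \<mu> t)) \<in> borel_measurable circ"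
      by (intro borel_measurable_times km measurable_compose[OF _ borel_measurable_of_real] borel_measurable_const circle_log_measurable)
    show "(\<lambda>t. schwarz_kernel z t * of_real (2 * Re (log_approx \<mu> j (cis t)))) \<in> borel_measurable circ" for j
      by (intro borel_measurable_times km measurable_compose[OF _ borel_measurable_of_real] borel_measurable_const
          borel_measurable_integrable[OF log_approx_integrable(1)[OF assms(1)]])
  qed
  have "(LINT t|circ. schwarz_kernel z t * of_real (2 * Re (log_approx \<mu> j (cis t)))) = complex_of_real (4 * pi) * log_approx \<mu> j z" for j
  proof -
    obtain g where g: "wiener (log_approx \<mu> j) g" by (rule log_approx_wiener[OF assms(1)])
    show ?thesis by (rule schwarz_integral_wiener[OF z g]) (simp add: log_approx_0[OF assms(1)])
  qed
  moreover have "(\<lambda>j. complex_of_real (4 * pi) * log_approx \<mu> j z) \<longlonglongrightarrow> complex_of_real (4 * pi) * Ln (1 - z ^ \<mu>)"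
  proof -
    have "norm (z ^ \<mu>) < 1" using z assms by (simp add: norm_power power_less_one_iff)
    then have "Re (1 - z ^ \<mu>) > 0" using complex_Re_le_cmod[of "z ^ \<mu>"] by simp
    then have "1 - z ^ \<mu> \<notin> \<real>\<^sub>\<le>\<^sub>0" by (auto simp: complex_nonpos_Reals_iff)
    then have "(\<lambda>j. log_approx \<mu> j z) \<longlonglongrightarrow> Ln (1 - (of_real 1 * z) ^ \<mu>)"
      unfolding log_approx_def by (intro tendsto_intros rad_tendsto) simp
    then show ?thesis by (intro tendsto_intros) simp
  qed
  ultimately show "(\<lambda>j. LINT t|circ. schwarz_kernel z t * of_real (2 * Re (log_approx \<mu> j (cis t)))) \<longlonglongrightarrow> complex_of_real (4 * pi) * Ln (1 - z ^ \<mu>)"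
    by simp
qed

text \<open>The zeros of \<open>s z = (\<Sum>j<\<mu>. z ^ j)\<close> lie on the circle. Moving the point inwards changes \<open>s\<close> by at most a
  multiple of \<open>1 - r\<close>, while \<open>(1 - r z) * s (r z) = 1 - (r z) ^ \<mu>\<close> shows that \<open>1 - r\<close> is itself at most
  \<open>2 * |s (r z)|\<close>.\<close>

lemma geometric_ratio:
  assumes "norm z \<le> 1" "0 < r" "r < 1" "\<mu> > 0"
  shows "cmod (\<Sum>j<\<mu>. z ^ j) \<le> (1 + 2 * (real \<mu>)\<^sup>2) * cmod (\<Sum>j<\<mu>. (of_real r * z) ^ j)"
proof -
  let ?s = "\<lambda>z::complex. \<Sum>j<\<mu>. z ^ j" let ?rz = "of_real r * z"
  have rz: "norm ?rz < 1"
  proof -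
    have "norm ?rz \<le> r" using assms by (simp add: norm_mult mult_left_le)
    then show ?thesis using assms by simp
  qed
  have rzm: "cmod (?rz ^ \<mu>) \<le> r"
  proof -
    have "cmod (?rz ^ \<mu>) = r ^ \<mu> * norm z ^ \<mu>" using assms by (simp add: norm_mult norm_power power_mult_distrib)
    also have "\<dots> \<le> r ^ \<mu> * 1" using assms by (intro mult_left_mono power_le_one) auto
    also have "\<dots> \<le> r ^ 1" using assms by (simp only: mult_1_right) (rule power_decreasing, auto)
    finally show ?thesis by simp
  qed
  have "cmod (?s z - ?s ?rz) \<le> (\<Sum>j<\<mu>. real \<mu> * (1 - r))"
  proof -
    have "?s z - ?s ?rz = (\<Sum>j<\<mu>. of_real (1 - r ^ j) * z ^ j)"
      by (simp add: sum_subtractf[symmetric] power_mult_distrib algebra_simps)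
    also have "cmod \<dots> \<le> (\<Sum>j<\<mu>. real \<mu> * (1 - r))"
    proof (rule order_trans[OF norm_sum], rule sum_mono)
      fix j assume j: "j \<in> {..<\<mu>}"
      have "1 + real j * (r - 1) \<le> (1 + (r - 1)) ^ j" using assms by (intro Bernoulli_inequality) auto
      then have "1 - r ^ j \<le> real j * (1 - r)" by (simp add: algebra_simps)
      also have "\<dots> \<le> real \<mu> * (1 - r)" using j assms by (intro mult_right_mono) auto
      finally have "1 - r ^ j \<le> real \<mu> * (1 - r)" .
      moreover have "r ^ j \<le> 1" using assms by (simp add: power_le_one)
      moreover have "norm z ^ j \<le> 1" using assms by (simp add: power_le_one)
      moreover have "cmod (of_real (1 - r ^ j) * z ^ j) = \<bar>1 - r ^ j\<bar> * norm z ^ j"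
        by (simp only: norm_mult norm_of_real norm_power)
      ultimately have "cmod (of_real (1 - r ^ j) * z ^ j) \<le> (1 - r ^ j) * 1"
        by (simp only: abs_of_nonneg diff_ge_0_iff_ge) (rule mult_left_mono, auto)
      with \<open>1 - r ^ j \<le> real \<mu> * (1 - r)\<close> show "cmod (of_real (1 - r ^ j) * z ^ j) \<le> real \<mu> * (1 - r)" by simp
    qed
    finally show ?thesis .
  qed
  also have "\<dots> = (real \<mu>)\<^sup>2 * (1 - r)" by (simp add: power2_eq_square)
  finally have 1: "cmod (?s z - ?s ?rz) \<le> (real \<mu>)\<^sup>2 * (1 - r)" .
  have "1 - r \<le> cmod (1 - ?rz ^ \<mu>)"
    using norm_triangle_ineq2[of 1 "?rz ^ \<mu>"] rzm by simp
  also have "\<dots> = cmod (1 - ?rz) * cmod (?s ?rz)"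
    by (simp only: one_diff_power_eq norm_mult)
  also have "\<dots> \<le> 2 * cmod (?s ?rz)"
    using norm_triangle_ineq4[of 1 ?rz] rz by (intro mult_right_mono) auto
  finally have "1 - r \<le> 2 * cmod (?s ?rz)" .
  then have "(real \<mu>)\<^sup>2 * (1 - r) \<le> (real \<mu>)\<^sup>2 * (2 * cmod (?s ?rz))" by (intro mult_left_mono) auto
  with 1 have "cmod (?s z - ?s ?rz) \<le> 2 * (real \<mu>)\<^sup>2 * cmod (?s ?rz)" by simp
  moreover have "cmod (?s z) \<le> cmod (?s z - ?s ?rz) + cmod (?s ?rz)"
    using norm_triangle_ineq[of "?s z - ?s ?rz" "?s ?rz"] by simp
  ultimately show ?thesis by (simp add: algebra_simps)
qed

text \<open>The outer function \<open>w\<close> as the sum of its Taylor series, which also represents it on the circle.\<close>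

definition W_fun :: "nat \<Rightarrow> nat \<Rightarrow> complex \<Rightarrow> complex" where
  "W_fun n \<mu> z = (\<Sum>k. w_coeff n \<mu> k * z ^ k)"

text \<open>For \<open>0 < |t| \<le> \<pi>\<close> the modulus of the kernel is \<open>(|s (cis t)| * rsinc t) ^ n\<close> with the polynomial \<open>s z = (\<Sum>j<\<mu>. z ^ j)\<close>. The
  Schwarz integrals of the logarithms of the factors are known, and they add up to \<open>w = (s * exp U) ^ n\<close>, where
  \<open>Re (U (cis t)) = ln (rsinc t)\<close>. All properties are read off from this product; the last two serve to divide by \<open>w\<close>, which
  has zeros on the circle when \<open>\<mu> > 1\<close>.\<close>

lemma W_fun_properties:
  assumes \<mu>: "\<mu> > 0"
  shows W_fun_wiener: "wiener (W_fun n \<mu>) (w_coeff n \<mu>)"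
    and W_fun_boundary: "AE t in circ. cmod (W_fun n \<mu> (cis (- t))) = cmod (incr_kernel n (int \<mu>) t)"
    and W_fun_inverse: "\<And>r. 0 < r \<Longrightarrow> r < 1 \<Longrightarrow> \<exists>G g. wiener G g \<and> (\<forall>z. norm z \<le> 1 \<longrightarrow> G z * W_fun n \<mu> (of_real r * z) = 1)"
    and W_fun_radial: "\<exists>C. \<forall>z r. norm z \<le> 1 \<longrightarrow> 0 < r \<longrightarrow> r < 1 \<longrightarrow> cmod (W_fun n \<mu> z) \<le> C * cmod (W_fun n \<mu> (of_real r * z))"
proof -
  obtain U u where U: "wiener U u" "\<And>k. u k \<in> \<real>" "AE t in circ. ln (rsinc t) = Re (U (cis t))"
    by (rule ln_rsinc_fourier, rule that)
  define s where "s z = (\<Sum>j<\<mu>. z ^ j)" for z :: complex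
  define E where "E z = s z * exp (U z)" for z
  have s_eq: "(1 - z) * s z = 1 - z ^ \<mu>" for z by (simp add: s_def one_diff_power_eq)
  have cnjU: "U (cnj z) = cnj (U z)" if "norm z \<le> 1" for z
  proof -
    have "wiener (\<lambda>z. cnj (U (cnj z))) u" using wiener_cnj[OF U(1)] U(2) by (simp add: Reals_cnj_iff)
    then have "cnj (U (cnj z)) = U z" using U(1) that unfolding wiener_def by metis
    then show ?thesis by (metis complex_cnj_cnj)
  qed
  have U0: "U 0 \<in> \<real>" using wiener_at_0[OF U(1)] U(2) by simp
  have AE0: "AE t in circ. t \<in> {-pi..pi} \<and> t \<noteq> 0"
    by (rule circ_AE_countable[of "{0}"]) auto
  have w_eq: "w_fun n \<mu> z = E z ^ n" if z: "norm z < 1" for z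
  proof -
    have i: "integrable circ (\<lambda>t. schwarz_kernel z t * of_real (2 * circle_log m t))" if "m > 0" for m
      by (intro schwarz_kernel_integrable[OF z] integrable_mult_right circle_log_integrable that)
    have iU: "integrable circ (\<lambda>t. schwarz_kernel z t * of_real (2 * Re (U (cis t))))"
      by (intro schwarz_kernel_integrable[OF z] circ_continuous_integrable continuous_intros wiener_circle_continuous[OF U(1)])
    have "AE t in circ. ln (cmod (1 - cis (- (t * real \<mu>))) ^ (2 * n) / t ^ (2 * n))
        = real n * (2 * circle_log \<mu> t - 2 * circle_log 1 t + 2 * Re (U (cis t)))"
      using U(3) circle_log_AE[OF \<mu>] circle_log_AE[of 1, OF zero_less_one] AE0
    proof eventually_elim
      case (elim t)
      then have t: "t \<in> {-pi..pi}" "t \<noteq> 0" by auto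
      have c: "cmod (1 - cis (- x)) = cmod (1 - cis x)" for x by (simp add: cmod_one_minus_cis)
      have p1: "cmod (1 - cis (t * real \<mu>)) > 0" and p2: "cmod (1 - cis t) > 0" using elim by auto
      have A: "ln (rsinc t) = ln (cmod (1 - cis t)) - ln \<bar>t\<bar>"
        unfolding cmod_one_minus_cis_rsinc[OF t, symmetric] c using p2 t(2) by (simp add: ln_div)
      have B: "ln (cmod (1 - cis (- (t * real \<mu>))) ^ (2 * n) / t ^ (2 * n)) = real (2 * n) * (ln (cmod (1 - cis (t * real \<mu>))) - ln \<bar>t\<bar>)"
      proof -
        have "t ^ (2 * n) = \<bar>t\<bar> ^ (2 * n)" by (simp add: power_mult)
        then show ?thesis using p1 t unfolding c by (simp add: ln_div ln_realpow algebra_simps)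
      qed
      show ?case unfolding B circle_log_def elim(1)[symmetric] A by (simp add: algebra_simps)
    qed
    then have "AE t in circ. (cis t + z) / (cis t - z) * complex_of_real (ln (cmod (1 - cis (- (t * real \<mu>))) ^ (2 * n) / t ^ (2 * n)))
       = of_nat n * (schwarz_kernel z t * of_real (2 * circle_log \<mu> t) - schwarz_kernel z t * of_real (2 * circle_log 1 t)
           + schwarz_kernel z t * of_real (2 * Re (U (cis t))))"
    proof eventually_elim
      case (elim t)
      show ?case unfolding elim schwarz_kernel_def[OF z, symmetric] by (simp add: algebra_simps)
    qed
    then have "(LINT t|circ. (cis t + z) / (cis t - z) * complex_of_real (ln (cmod (1 - cis (- (t * real \<mu>))) ^ (2 * n) / t ^ (2 * n))))
       = (LINT t|circ. of_nat n * (schwarz_kernel z t * of_real (2 * circle_log \<mu> t) - schwarz_kernel z t * of_real (2 * circle_log 1 t)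
           + schwarz_kernel z t * of_real (2 * Re (U (cis t)))))"
    proof (rule integral_cong_AE[rotated 2])
      have 1: "(\<lambda>t. complex_of_real (ln (cmod (1 - cis (- (t * real \<mu>))) ^ (2 * n) / t ^ (2 * n)))) \<in> borel_measurable circ"
      proof (rule measurable_restrict_space1)
        have [measurable]: "(\<lambda>t. cmod (1 - cis (- (t * real \<mu>)))) \<in> borel_measurable borel"
          by (intro borel_measurable_continuous_onI continuous_intros)
        show "(\<lambda>t. complex_of_real (ln (cmod (1 - cis (- (t * real \<mu>))) ^ (2 * n) / t ^ (2 * n)))) \<in> borel_measurable lborel"
          by measurable
      qed
      have 2: "(\<lambda>t. (cis t + z) / (cis t - z)) \<in> borel_measurable circ"
        using borel_measurable_integrable[OF circ_continuous_integrable[OF schwarz_kernel_continuous[OF z]]]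
        unfolding schwarz_kernel_def[OF z, abs_def] .
      show "(\<lambda>t. (cis t + z) / (cis t - z) * complex_of_real (ln (cmod (1 - cis (- (t * real \<mu>))) ^ (2 * n) / t ^ (2 * n)))) \<in> borel_measurable circ"
        by (rule borel_measurable_times[OF 2 1])
      show "(\<lambda>t. of_nat n * (schwarz_kernel z t * of_real (2 * circle_log \<mu> t) - schwarz_kernel z t * of_real (2 * circle_log 1 t)
           + schwarz_kernel z t * of_real (2 * Re (U (cis t))))) \<in> borel_measurable circ"
        by (rule borel_measurable_integrable)
           (intro integrable_mult_right Bochner_Integration.integrable_add Bochner_Integration.integrable_diff i iU \<mu> zero_less_one)
    qed
    also have "\<dots> = of_nat n * ((LINT t|circ. schwarz_kernel z t * of_real (2 * circle_log \<mu> t)) - (LINT t|circ. schwarz_kernel z t * of_real (2 * circle_log 1 t))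
           + (LINT t|circ. schwarz_kernel z t * of_real (2 * Re (U (cis t)))))"
    proof -
      show ?thesis
        by (simp only: integral_mult_right_zero Bochner_Integration.integral_add[OF Bochner_Integration.integrable_diff[OF i[OF \<mu>] i[OF zero_less_one]] iU]
             Bochner_Integration.integral_diff[OF i[OF \<mu>] i[OF zero_less_one]])
    qed
    also have "\<dots> = complex_of_real (4 * pi) * (of_nat n * (Ln (1 - z ^ \<mu>) - Ln (1 - z) + U z))"
      using schwarz_integral_circle_log[OF \<mu> z] schwarz_integral_circle_log[of 1, OF zero_less_one z] schwarz_integral_wiener[OF z U(1) U0]
      by (simp only: power_one_right ring_distribs mult_ac)
    finally have I: "(LINT t|circ. (cis t + z) / (cis t - z) * complex_of_real (ln (cmod (1 - cis (- (t * real \<mu>))) ^ (2 * n) / t ^ (2 * n))))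
       = complex_of_real (4 * pi) * (of_nat n * (Ln (1 - z ^ \<mu>) - Ln (1 - z) + U z))" .
    have cancel: "complex_of_real (1 / (4 * pi)) * (complex_of_real (4 * pi) * x) = x" for x
      by simp
    have "w_fun n \<mu> z = exp (of_nat n * (Ln (1 - z ^ \<mu>) - Ln (1 - z) + U z))"
      unfolding w_fun_def circ_integral I cancel ..
    also have "\<dots> = exp (Ln (1 - z ^ \<mu>) - Ln (1 - z) + U z) ^ n" by (simp add: exp_of_nat_mult)
    also have "exp (Ln (1 - z ^ \<mu>) - Ln (1 - z) + U z) = E z"
    proof -
      have "norm (z ^ \<mu>) < 1" using z \<mu> by (simp add: norm_power power_less_one_iff)
      then have "1 - z ^ \<mu> \<noteq> 0" by (metis eq_iff_diff_eq_0 less_irrefl norm_one)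
      moreover have "1 - z \<noteq> 0" using z by (metis eq_iff_diff_eq_0 less_irrefl norm_one)
      moreover from this have "s z = (1 - z ^ \<mu>) / (1 - z)"
        using s_eq[of z] by (simp add: eq_divide_eq mult.commute)
      ultimately show ?thesis by (simp add: E_def exp_add exp_diff)
    qed
    finally show ?thesis .
  qed
  have s_wiener: "\<exists>x. wiener s x"
    unfolding s_def[abs_def] by (rule exI, rule wiener_sum[OF finite_lessThan wiener_monomial])
  from s_wiener obtain s' where s': "wiener s s'" by (elim exE)
  from wiener_exp[OF U(1)] obtain e' where e': "wiener (\<lambda>z. exp (U z)) e'" by (elim exE)
  have E': "wiener E (\<lambda>k. \<Sum>i\<le>k. s' i * e' (k - i))"
    unfolding E_def[abs_def] by (rule wiener_mult[OF s' e'])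
  from wiener_power[OF E', of n] obtain y where y: "wiener (\<lambda>z. E z ^ n) y" by (elim exE conjE)
  have "w_fun n \<mu> has_fps_expansion Abs_fps y"
    unfolding has_fps_expansion_def
  proof
    have "conv_radius y \<ge> 1"
    proof (rule conv_radius_geI_ex)
      fix r :: real assume "0 < r" "ereal r < 1"
      then show "\<exists>z. norm z = r \<and> summable (\<lambda>k. y k * z ^ k)"
        using wiener_sums[OF y, of "of_real r"] by (intro exI[of _ "of_real r"]) (auto simp: sums_iff)
    qed
    then show "fps_conv_radius (Abs_fps y) > 0" by (simp add: fps_conv_radius_def less_le_trans[OF _ \<open>conv_radius y \<ge> 1\<close>])
    have "\<forall>\<^sub>F z in nhds 0. z \<in> ball (0::complex) 1" by (intro eventually_nhds_in_open) auto
    then show "\<forall>\<^sub>F z in nhds 0. eval_fps (Abs_fps y) z = w_fun n \<mu> z"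
    proof eventually_elim
      case (elim z)
      then show ?case using w_eq[of z] y by (simp add: eval_fps_def wiener_def)
    qed
  qed
  then have "w_coeff n \<mu> = y" by (intro ext) (simp add: w_coeff_def fps_expansion_eqI)
  with y have W: "wiener (\<lambda>z. E z ^ n) (w_coeff n \<mu>)" by simp
  have WE: "W_fun n \<mu> z = E z ^ n" if "norm z \<le> 1" for z
    using W that by (simp add: wiener_def W_fun_def)
  show "wiener (W_fun n \<mu>) (w_coeff n \<mu>)" by (rule wiener_cong[OF W WE])
  show "AE t in circ. cmod (W_fun n \<mu> (cis (- t))) = cmod (incr_kernel n (int \<mu>) t)"
    using U(3) circle_log_AE[of 1, OF zero_less_one] AE0
  proof eventually_elim
    case (elim t)
    then have t: "t \<in> {-pi..pi}" "t \<noteq> 0" by auto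
    have p: "1 - cis (- t) \<noteq> 0"
      using elim cmod_one_minus_cis[of t] cmod_one_minus_cis[of "- t"] by auto
    have eU: "exp (Re (U (cis t))) = rsinc t" using elim rsinc_pos[OF t(1)] by (metis exp_ln)
    have "cis (- t) ^ \<mu> = cis (- (real \<mu> * t))" by (simp add: Complex.DeMoivre)
    then have "s (cis (- t)) = (1 - cis (- (real \<mu> * t))) / (1 - cis (- t))"
      using s_eq[of "cis (- t)"] p by (simp add: field_simps)
    moreover have "cmod (exp (U (cis (- t)))) = cmod (1 - cis (- t)) / \<bar>t\<bar>"
      using cnjU[of "cis t"] eU cmod_one_minus_cis_rsinc[OF t] by (simp add: cis_cnj)
    ultimately have "cmod (E (cis (- t))) = cmod (1 - cis (- (real \<mu> * t))) / \<bar>t\<bar>"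
      using p by (simp add: E_def norm_mult norm_divide)
    then show ?case using WE[of "cis (- t)"]
      by (simp add: incr_kernel_def norm_power norm_divide norm_mult power_divide power_mult_distrib)
  qed
  obtain eU where eU: "wiener (\<lambda>z. exp (- U z)) eU"
    using wiener_exp[OF wiener_cmult[OF U(1), of "-1"]] by (auto simp only: mult_minus1)
  show "\<exists>G g. wiener G g \<and> (\<forall>z. norm z \<le> 1 \<longrightarrow> G z * W_fun n \<mu> (of_real r * z) = 1)" if r: "0 < r" "r < 1" for r
  proof -
    have ne: "1 - (of_real r * z) ^ \<mu> \<noteq> 0" if "norm z < 1 / r" for z :: complex
    proof -
      have "norm (of_real r * z) < 1" using that r by (simp add: norm_mult field_simps)
      then have "norm ((of_real r * z) ^ \<mu>) < 1" using \<mu> by (simp add: norm_power power_less_one_iff)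
      then show ?thesis by (metis eq_iff_diff_eq_0 less_irrefl norm_one)
    qed
    let ?H = "\<lambda>z. (1 - of_real r * z) / (1 - (of_real r * z) ^ \<mu>)"
    have "?H holomorphic_on ball 0 (1 / r)"
      by (intro holomorphic_intros) (use ne in auto)
    then obtain h where h: "wiener ?H h"
      using wiener_holomorphic[of ?H "1 / r"] r by (simp add: field_simps) blast
    have e: "wiener (\<lambda>z. exp (- U (of_real r * z))) (\<lambda>k. eU k * of_real r ^ k)"
      by (rule wiener_scale[OF eU]) (use r in simp)
    from wiener_power[OF wiener_mult[OF h e], of n]
    obtain g where g: "wiener (\<lambda>z. (?H z * exp (- U (of_real r * z))) ^ n) g" by (elim exE conjE)
    moreover have "(?H z * exp (- U (of_real r * z))) ^ n * W_fun n \<mu> (of_real r * z) = 1" if z: "norm z \<le> 1" for z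
    proof -
      have "1 < 1 / r" using r by simp
      then have nz: "norm z < 1 / r" using z by simp
      have rz: "norm (of_real r * z) \<le> 1" using z r mult_le_one[of r "norm z"] by (simp add: norm_mult)
      have "?H z * exp (- U (of_real r * z)) * E (of_real r * z)
          = (1 - of_real r * z) * s (of_real r * z) / (1 - (of_real r * z) ^ \<mu>) * (exp (- U (of_real r * z)) * exp (U (of_real r * z)))"
        by (simp add: E_def)
      also have "exp (- U (of_real r * z)) * exp (U (of_real r * z)) = 1" by (simp add: exp_minus)
      also have "(1 - of_real r * z) * s (of_real r * z) / (1 - (of_real r * z) ^ \<mu>) = 1"
        unfolding s_eq using ne[OF nz] by simp
      finally have "?H z * exp (- U (of_real r * z)) * E (of_real r * z) = 1" by simp
      then show ?thesis unfolding WE[OF rz] power_mult_distrib[symmetric] by simp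
    qed
    ultimately show ?thesis by blast
  qed
  show "\<exists>C. \<forall>z r. norm z \<le> 1 \<longrightarrow> 0 < r \<longrightarrow> r < 1 \<longrightarrow> cmod (W_fun n \<mu> z) \<le> C * cmod (W_fun n \<mu> (of_real r * z))"
  proof (intro exI allI impI)
    fix z :: complex and r :: real assume z: "norm z \<le> 1" and r: "0 < r" "r < 1"
    let ?B = "\<Sum>k. norm (u k)"
    have rz: "norm (of_real r * z) \<le> 1" using z r mult_le_one[of r "norm z"] by (simp add: norm_mult)
    have "cmod (exp (U z)) \<le> exp (2 * ?B) * cmod (exp (U (of_real r * z)))"
      using abs_Re_le_cmod[of "U z"] abs_Re_le_cmod[of "U (of_real r * z)"] wiener_bound[OF U(1) z] wiener_bound[OF U(1) rz]
      by (simp add: exp_add[symmetric])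
    moreover have "cmod (s z) \<le> (1 + 2 * (real \<mu>)\<^sup>2) * cmod (s (of_real r * z))"
      unfolding s_def by (rule geometric_ratio[OF z r \<mu>])
    ultimately have "cmod (E z) \<le> ((1 + 2 * (real \<mu>)\<^sup>2) * cmod (s (of_real r * z))) * (exp (2 * ?B) * cmod (exp (U (of_real r * z))))"
      unfolding E_def norm_mult by (intro mult_mono) auto
    also have "\<dots> = ((1 + 2 * (real \<mu>)\<^sup>2) * exp (2 * ?B)) * cmod (E (of_real r * z))"
      by (simp add: E_def norm_mult)
    finally have "cmod (E z) ^ n \<le> (((1 + 2 * (real \<mu>)\<^sup>2) * exp (2 * ?B)) * cmod (E (of_real r * z))) ^ n"
      by (intro power_mono) auto
    then show "cmod (W_fun n \<mu> z) \<le> ((1 + 2 * (real \<mu>)\<^sup>2) * exp (2 * ?B)) ^ n * cmod (W_fun n \<mu> (of_real r * z))"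
      unfolding WE[OF z] WE[OF rz] norm_power power_mult_distrib .
  qed
qed

section \<open>Hankel operators and factorizations\<close>

lemma suminf_shift_zero:
  fixes g :: "nat \<Rightarrow> complex"
  assumes "\<And>i. i < m \<Longrightarrow> g i = 0" "summable g" shows "(\<Sum>i. g i) = (\<Sum>i. g (i + m))"
  using suminf_split_initial_segment[OF assms(2), of m] assms(1) by simp

lemma suminf_triangle_split:
  fixes f :: "nat \<Rightarrow> nat \<Rightarrow> complex"
  assumes f: "\<And>i. summable (\<lambda>j. norm (f i j))" "summable (\<lambda>i. \<Sum>j. norm (f i j))"
  shows "(\<Sum>i. \<Sum>j. f i j) = (\<Sum>k. \<Sum>j. f (j + k) j) + (\<Sum>k. \<Sum>i. f i (i + Suc k))"
    and "summable (\<lambda>k. norm (\<Sum>j. f (j + k) j))"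
    and "summable (\<lambda>k. norm (\<Sum>i. f i (i + Suc k)))"
proof -
  define g where "g i j = (if j \<le> i then f i j else 0)" for i j
  define h where "h i k = f i (i + Suc k)" for i k
  have gs: "summable (\<lambda>j. norm (g i j))" for i
    by (rule summable_comparison_test[OF _ f(1)[of i]]) (auto simp: g_def)
  have g2: "summable (\<lambda>i. \<Sum>j. norm (g i j))"
  proof (rule summable_comparison_test[OF _ f(2)], intro exI allI impI)
    fix i
    have "(\<Sum>j. norm (g i j)) \<le> (\<Sum>j. norm (f i j))"
      by (rule suminf_le[OF _ gs f(1)]) (simp add: g_def)
    then show "norm (\<Sum>j. norm (g i j)) \<le> (\<Sum>j. norm (f i j))" by (simp add: suminf_nonneg[OF gs])
  qed
  have hs: "summable (\<lambda>k. norm (h i k))" for i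
    using summable_ignore_initial_segment[OF f(1)[of i], of "Suc i"] by (simp add: h_def add.commute)
  have h2: "summable (\<lambda>i. \<Sum>k. norm (h i k))"
  proof (rule summable_comparison_test[OF _ f(2)], intro exI allI impI)
    fix i
    have "(\<Sum>k. norm (h i k)) = (\<Sum>k. norm (f i (k + Suc i)))" by (simp add: h_def add.commute)
    also have "\<dots> \<le> (\<Sum>j. norm (f i j))"
      using suminf_split_initial_segment[OF f(1)[of i], of "Suc i"] by (simp add: sum_nonneg)
    finally show "norm (\<Sum>k. norm (h i k)) \<le> (\<Sum>j. norm (f i j))" by (simp add: suminf_nonneg[OF hs])
  qed
  have row: "(\<Sum>j. f i j) = (\<Sum>j. g i j) + (\<Sum>k. h i k)" for i
  proof -
    have "(\<Sum>j. g i j) = (\<Sum>j<Suc i. f i j)"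
      by (subst suminf_finite[of "{..<Suc i}"]) (auto simp: g_def)
    moreover have "(\<Sum>k. h i k) = (\<Sum>k. f i (k + Suc i))" by (simp add: h_def add.commute)
    ultimately show ?thesis
      using suminf_split_initial_segment[OF summable_norm_cancel[OF f(1)[of i]], of "Suc i"] by simp
  qed
  have col: "(\<Sum>i. g i j) = (\<Sum>k. f (j + k) j)" for j
    using suminf_shift_zero[of j "\<lambda>i. g i j"] summable_norm_cancel[OF suminf_exchange(3)[OF gs g2, of j]]
    by (simp add: g_def add.commute)
  define e where "e j k = f (j + k) j" for j k
  have gcol: "summable (\<lambda>i. norm (g i j))" for j by (rule suminf_exchange(3)[OF gs g2])
  have es: "summable (\<lambda>k. norm (e j k))" for j
    using summable_ignore_initial_segment[OF gcol[of j], of j] by (simp add: e_def g_def add.commute)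
  have gn: "summable (\<lambda>j. \<Sum>i. norm (g i j))"
  proof -
    have "summable (\<lambda>j. norm (\<Sum>i. complex_of_real (norm (g i j))))"
      by (rule suminf_exchange(2)) (use gs g2 in simp_all)
    moreover have "(\<Sum>i. complex_of_real (norm (g i j))) = complex_of_real (\<Sum>i. norm (g i j))" for j
      by (rule suminf_of_real[OF gcol, symmetric])
    ultimately show ?thesis by (simp add: suminf_nonneg[OF gcol])
  qed
  have e2: "summable (\<lambda>j. \<Sum>k. norm (e j k))"
  proof (rule summable_comparison_test[OF _ gn], intro exI allI impI)
    fix j
    have "(\<Sum>k. norm (e j k)) = (\<Sum>k. norm (g (k + j) j))" by (simp add: e_def g_def add.commute)
    also have "\<dots> \<le> (\<Sum>i. norm (g i j))"
      using suminf_split_initial_segment[OF gcol[of j], of j] by (simp add: sum_nonneg)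
    finally show "norm (\<Sum>k. norm (e j k)) \<le> (\<Sum>i. norm (g i j))" by (simp add: suminf_nonneg[OF es])
  qed
  have "(\<Sum>i. \<Sum>j. f i j) = (\<Sum>i. \<Sum>j. g i j) + (\<Sum>i. \<Sum>k. h i k)"
    unfolding row
    by (rule suminf_add[symmetric]) (rule summable_norm_cancel, rule suminf_exchange(4)[OF gs g2] suminf_exchange(4)[OF hs h2])+
  also have "(\<Sum>i. \<Sum>j. g i j) = (\<Sum>j. \<Sum>i. g i j)" by (rule suminf_exchange(1)[OF gs g2, symmetric])
  also have "\<dots> = (\<Sum>j. \<Sum>k. e j k)" by (simp add: col e_def)
  also have "\<dots> = (\<Sum>k. \<Sum>j. e j k)" by (rule suminf_exchange(1)[OF es e2, symmetric])
  also have "(\<Sum>i. \<Sum>k. h i k) = (\<Sum>k. \<Sum>i. h i k)" by (rule suminf_exchange(1)[OF hs h2, symmetric])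
  finally show "(\<Sum>i. \<Sum>j. f i j) = (\<Sum>k. \<Sum>j. f (j + k) j) + (\<Sum>k. \<Sum>i. f i (i + Suc k))"
    by (simp add: e_def h_def)
  show "summable (\<lambda>k. norm (\<Sum>j. f (j + k) j))" using suminf_exchange(2)[OF es e2] by (simp add: e_def)
  show "summable (\<lambda>k. norm (\<Sum>i. f i (i + Suc k)))" using suminf_exchange(2)[OF hs h2] by (simp add: h_def)
qed

text \<open>The part of the product with nonnegative frequencies has as coefficients the image of \<open>x\<close> under the Hankel
  matrix of \<open>b\<close>; the double series is regrouped along its diagonals.\<close>

lemma wiener_hankel_split:
  assumes B: "wiener B b" and X: "wiener X x"
  obtains R N where "wiener R (\<lambda>k. \<Sum>j. b (k + j) * x j)"
    "wiener N (\<lambda>k. if k = 0 then 0 else \<Sum>i. b i * x (i + k))" "N 0 = 0"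
    "\<And>t. B (cis t) * X (cis (- t)) = R (cis t) + N (cis (- t))"
proof -
  have bs: "summable (\<lambda>k. norm (b k))" and xs: "summable (\<lambda>k. norm (x k))"
    using B X wiener_summable_norm by auto
  have s1: "summable (\<lambda>j. norm (b i * u i * (x j * v j)))" and s1e: "(\<Sum>j. norm (b i * u i * (x j * v j))) = norm (b i) * (\<Sum>j. norm (x j))"
    if "\<And>k. norm (u k) = 1" "\<And>k. norm (v k) = 1" for i and u v :: "nat \<Rightarrow> complex"
    using xs by (simp_all add: norm_mult that summable_mult suminf_mult)
  have s2: "summable (\<lambda>i. \<Sum>j. norm (b i * u i * (x j * v j)))"
    if "\<And>k. norm (u k) = 1" "\<And>k. norm (v k) = 1" for u v :: "nat \<Rightarrow> complex"
  proof -
    have "(\<lambda>i. \<Sum>j. norm (b i * u i * (x j * v j))) = (\<lambda>i. norm (b i) * (\<Sum>j. norm (x j)))"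
      by (rule ext, rule s1e[OF that])
    then show ?thesis using summable_mult2[OF bs] by simp
  qed
  define rr where "rr k = (\<Sum>j. b (k + j) * x j)" for k
  define nn where "nn k = (if k = 0 then 0 else \<Sum>i. b i * x (i + k))" for k
  define R where "R z = (\<Sum>k. rr k * z ^ k)" for z
  define N where "N z = (\<Sum>k. nn k * z ^ k)" for z
  note T1 = suminf_triangle_split[OF s1[where u = "\<lambda>_. 1" and v = "\<lambda>_. 1"] s2[where u = "\<lambda>_. 1" and v = "\<lambda>_. 1"], simplified]
  have R: "wiener R rr"
    using T1(2) by (simp add: wiener_def R_def[abs_def] rr_def[abs_def] add.commute)
  have "summable (\<lambda>k. norm (nn (Suc k)))" using T1(3) by (simp add: nn_def)
  then have "summable (\<lambda>k. norm (nn k))" using summable_Suc_iff[of "\<lambda>k. norm (nn k)"] by simp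
  then have N: "wiener N nn" by (simp add: wiener_def N_def[abs_def])
  have N0: "N 0 = 0" using wiener_at_0[OF N] by (simp add: nn_def)
  have "B (cis t) * X (cis (- t)) = R (cis t) + N (cis (- t))" for t
  proof -
    let ?c = "cis t" let ?d = "cis (- t)"
    let ?f = "\<lambda>i j. b i * ?c ^ i * (x j * ?d ^ j)"
    have un: "norm (?c ^ k) = 1" "norm (?d ^ k) = 1" for k by (simp_all add: norm_power)
    note T = suminf_triangle_split[OF s1[where u = "\<lambda>k. ?c ^ k" and v = "\<lambda>k. ?d ^ k", OF un]
        s2[where u = "\<lambda>k. ?c ^ k" and v = "\<lambda>k. ?d ^ k", OF un]]
    have cd: "?c ^ m * ?d ^ m = 1" for m
      by (simp add: power_mult_distrib[symmetric] cis_mult)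
    have "B ?c * X ?d = (\<Sum>i. b i * ?c ^ i * X ?d)"
      using sums_mult2[OF wiener_sums[OF B, of ?c], of "X ?d"] by (simp add: sums_iff)
    also have "\<dots> = (\<Sum>i. \<Sum>j. ?f i j)"
      using sums_mult[OF wiener_sums[OF X, of ?d]] by (simp add: sums_iff)
    also have "\<dots> = (\<Sum>k. \<Sum>j. ?f (j + k) j) + (\<Sum>k. \<Sum>i. ?f i (i + Suc k))" by (rule T(1))
    also have "(\<Sum>k. \<Sum>j. ?f (j + k) j) = R ?c"
      unfolding R_def
    proof (rule suminf_cong)
      fix k
      have e: "?f (j + k) j = b (k + j) * x j * ?c ^ k" for j
        using cd[of j] by (simp add: power_add mult_ac add.commute)
      have s: "summable (\<lambda>j. b (k + j) * x j)"
      proof (rule summable_norm_cancel)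
        obtain M where M: "\<And>k. norm (b k) \<le> M" using summable_imp_Bseq[OF bs] unfolding Bseq_def by auto
        show "summable (\<lambda>j. norm (b (k + j) * x j))"
          by (rule summable_comparison_test[OF _ summable_mult[OF xs, of M]])
             (auto simp: norm_mult intro!: mult_right_mono M)
      qed
      show "(\<Sum>j. ?f (j + k) j) = rr k * ?c ^ k"
        unfolding e rr_def by (rule suminf_mult2[OF s, symmetric])
    qed
    also have "(\<Sum>k. \<Sum>i. ?f i (i + Suc k)) = (\<Sum>k. nn (Suc k) * ?d ^ Suc k)"
    proof (rule suminf_cong)
      fix k
      have e: "?f i (i + Suc k) = b i * x (i + Suc k) * ?d ^ Suc k" for i
        using cd[of i] by (simp add: power_add mult_ac)
      have s: "summable (\<lambda>i. b i * x (i + Suc k))"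
      proof (rule summable_norm_cancel)
        obtain M where M: "\<And>k. norm (x k) \<le> M" using summable_imp_Bseq[OF xs] unfolding Bseq_def by auto
        show "summable (\<lambda>i. norm (b i * x (i + Suc k)))"
          by (rule summable_comparison_test[OF _ summable_mult2[OF bs, of M]])
             (auto simp: norm_mult intro!: mult_left_mono M)
      qed
      have n: "nn (Suc k) = (\<Sum>i. b i * x (i + Suc k))" by (simp add: nn_def)
      show "(\<Sum>i. ?f i (i + Suc k)) = nn (Suc k) * ?d ^ Suc k"
        unfolding e n by (rule suminf_mult2[OF s, symmetric])
    qed
    also have "\<dots> = N ?d"
      using suminf_split_head[OF summable_norm_cancel[OF wiener_summable_norm'[OF N, of ?d]]] by (simp add: N_def nn_def)
    finally show ?thesis .
  qed
  then show thesis using that[OF R[unfolded rr_def[abs_def]] N[unfolded nn_def[abs_def]] N0] by blast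
qed

text \<open>The integrand is the real part of a power series in \<open>cis (- t)\<close> without constant term.\<close>

lemma wiener_orthogonal_integral:
  assumes R: "wiener R r" and Y: "wiener Y y" and Y0: "Y 0 = 0"
  shows "(LINT t|circ. Re (cnj (R (cis t)) * Y (cis (- t)))) = 0"
proof -
  note H = wiener_mult[OF wiener_cnj[OF R] Y]
  have "(LINT t|circ. cnj (R (cis t)) * Y (cis (- t))) = 0"
    using wiener_coeff_integral[OF H, of 0] wiener_at_0[OF H] Y0 by (simp add: cis_cnj)
  moreover have i: "integrable circ (\<lambda>t. cnj (R (cis t)) * Y (cis (- t)))"
    using circ_continuous_integrable[OF wiener_circle_continuous(2)[OF H]] by (simp add: cis_cnj)
  ultimately show ?thesis by (simp only: integral_Re[OF i] zero_complex.sel)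
qed

lemma wiener_orthogonal_norm:
  assumes R: "wiener R r" and Y: "wiener Y y" and Y0: "Y 0 = 0"
  shows "(LINT t|circ. (cmod (R (cis t) + Y (cis (- t))))\<^sup>2)
       = (LINT t|circ. (cmod (R (cis t)))\<^sup>2) + (LINT t|circ. (cmod (Y (cis (- t))))\<^sup>2)"
proof -
  note cR = wiener_circle_continuous(1)[OF R] and cY = wiener_circle_continuous(2)[OF Y]
  have eq: "(cmod (a + b))\<^sup>2 = (cmod a)\<^sup>2 + (cmod b)\<^sup>2 + 2 * Re (cnj a * b)" for a b
    unfolding cmod_power2 by (simp add: power2_eq_square algebra_simps)
  have i: "integrable circ (\<lambda>t. (cmod (R (cis t)))\<^sup>2)" "integrable circ (\<lambda>t. (cmod (Y (cis (- t))))\<^sup>2)"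
    "integrable circ (\<lambda>t. 2 * Re (cnj (R (cis t)) * Y (cis (- t))))"
    by (intro circ_continuous_integrable continuous_intros cR cY)+
  show ?thesis
    unfolding eq Bochner_Integration.integral_add[OF Bochner_Integration.integrable_add[OF i(1,2)] i(3)]
      Bochner_Integration.integral_add[OF i(1,2)] integral_mult_right_zero wiener_orthogonal_integral[OF assms] by simp
qed

text \<open>The zeros in a slightly larger closed disk form a compact set, whose point of least modulus lies outside the
  closed unit disk.\<close>

lemma conv_radius_inverse_holomorphic:
  assumes rad: "conv_radius \<phi> > 1" and nz: "\<And>z. cmod z \<le> 1 \<Longrightarrow> (\<Sum>k. \<phi> k * z ^ k) \<noteq> 0"
  obtains R where "R > 1" "(\<lambda>z. 1 / (\<Sum>k. \<phi> k * z ^ k)) holomorphic_on ball 0 R"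
proof -
  obtain \<rho> where \<rho>: "1 < \<rho>" "ereal \<rho> < conv_radius \<phi>"
    using ereal_dense2[OF rad] by (auto simp: one_ereal_def)
  define \<Phi> where "\<Phi> z = (\<Sum>k. \<phi> k * z ^ k)" for z :: complex
  have hol: "\<Phi> holomorphic_on ball 0 \<rho>"
  proof (rule power_series_holomorphic)
    fix z :: complex assume "z \<in> ball 0 \<rho>"
    then have "ereal (norm z) < conv_radius \<phi>" using \<rho> by (metis dual_order.strict_trans dist_0_norm ereal_less_eq(3) less_ereal.simps(1) mem_ball)
    then show "(\<lambda>k. \<phi> k * (z - 0) ^ k) sums \<Phi> z"
      unfolding \<Phi>_def by (simp add: summable_sums summable_in_conv_radius)
  qed
  have "\<exists>R>1. R \<le> \<rho> \<and> (\<forall>z\<in>ball 0 R. \<Phi> z \<noteq> 0)"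
  proof -
    define \<rho>' where "\<rho>' = (1 + \<rho>) / 2"
    have \<rho>': "1 < \<rho>'" "\<rho>' < \<rho>" using \<rho> by (auto simp: \<rho>'_def)
    let ?S = "{z \<in> cball 0 \<rho>'. \<Phi> z = 0}"
    have cont: "continuous_on (cball 0 \<rho>') \<Phi>"
      by (rule continuous_on_subset[OF holomorphic_on_imp_continuous_on[OF hol]]) (use \<rho>' in auto)
    have "compact ?S"
    proof -
      have "closed ?S" using continuous_closed_preimage_constant[OF cont, of 0] by simp
      then show ?thesis unfolding compact_eq_bounded_closed by (auto intro: bounded_subset[OF bounded_cball[of 0 \<rho>']])
    qed
    show ?thesis
    proof (cases "?S = {}")
      case True
      then show ?thesis using \<rho>' by (intro exI[of _ \<rho>']) auto
    next
      case False
      obtain z0 where z0: "z0 \<in> ?S" "\<And>z. z \<in> ?S \<Longrightarrow> norm z0 \<le> norm z"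
        using continuous_attains_inf[OF \<open>compact ?S\<close> False, of norm] by (auto intro: continuous_intros)
      then have "norm z0 > 1" using nz[of z0] by (force simp: \<Phi>_def not_less[symmetric])
      moreover have "\<Phi> z \<noteq> 0" if "norm z < norm z0" for z
        using z0(2)[of z] that z0(1) by force
      ultimately show ?thesis using z0(1) \<rho>' by (intro exI[of _ "norm z0"]) auto
    qed
  qed
  then obtain R where R: "R > 1" "R \<le> \<rho>" "\<And>z. z \<in> ball 0 R \<Longrightarrow> \<Phi> z \<noteq> 0" by blast
  have "(\<lambda>z. 1 / \<Phi> z) holomorphic_on ball 0 R"
    by (intro holomorphic_intros holomorphic_on_subset[OF hol]) (use R in auto)
  then show thesis using that[OF R(1)] by (simp add: \<Phi>_def)
qed

text \<open>The entries of \<open>D\<close> depend on the difference of the indices and those of \<open>A\<close> on the sum, so a shift of the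
  summation index by \<open>j\<close> turns the entry \<open>(k, j)\<close> of \<open>D A\<close> into the coordinate \<open>k + j\<close> of \<open>D a\<close>.\<close>

lemma DA_app_hankel:
  assumes "coeff_condition n \<mu> a"
  shows "DA_app n \<mu> a x k = (\<Sum>j. b_seq n \<mu> a (k + j) * x j)"
proof -
  have "mat_mult (D_mat n \<mu>) (A_mat a) k j = b_seq n \<mu> a (k + j)" for j
  proof -
    have s: "summable (\<lambda>i. D_mat n \<mu> (k + j) i * a i)" using assms by (simp add: coeff_condition_def)
    have "b_seq n \<mu> a (k + j) = (\<Sum>i. D_mat n \<mu> (k + j) (i + j) * a (i + j))"
      unfolding b_seq_def mat_app_def by (rule suminf_shift_zero[OF _ s]) (simp add: D_mat_def)
    also have "\<dots> = mat_mult (D_mat n \<mu>) (A_mat a) k j"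
      unfolding mat_mult_def A_mat_def by (simp add: D_mat_def add.commute cong: if_cong)
    finally show ?thesis by simp
  qed
  then show ?thesis by (simp add: DA_app_def mat_app_def)
qed

lemma W_mat_wiener:
  assumes "\<mu> > 0" and \<Phi>: "wiener \<Phi> \<phi>"
  shows "wiener (\<lambda>z. \<Phi> z * W_fun n \<mu> z) (mat_app (W_mat n \<mu>) \<phi>)"
proof -
  have "mat_app (W_mat n \<mu>) \<phi> = (\<lambda>k. \<Sum>i\<le>k. \<phi> i * w_coeff n \<mu> (k - i))"
    unfolding mat_app_def by (rule ext, subst suminf_finite[of "{..k}" for k]) (auto simp: W_mat_def mult.commute)
  then show ?thesis using wiener_mult[OF \<Phi> W_fun_wiener[OF assms(1), of n]] by (simp only:)
qed

section \<open>Square integrable functions\<close>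

definition square_integrable :: "'a measure \<Rightarrow> ('a \<Rightarrow> complex) \<Rightarrow> bool" where
  "square_integrable M g \<longleftrightarrow> g \<in> borel_measurable M \<and> integrable M (\<lambda>x. (cmod (g x))\<^sup>2)"

definition norm2 :: "'a measure \<Rightarrow> ('a \<Rightarrow> complex) \<Rightarrow> real" where
  "norm2 M g = sqrt (LINT x|M. (cmod (g x))\<^sup>2)"

lemma square_integrable_measurable [measurable_dest]: "square_integrable M g \<Longrightarrow> g \<in> borel_measurable M"
  by (simp add: square_integrable_def)

lemma square_integrable_integrable: "square_integrable M g \<Longrightarrow> integrable M (\<lambda>x. (cmod (g x))\<^sup>2)"
  by (simp add: square_integrable_def)

lemma norm2_nonneg [simp]: "norm2 M g \<ge> 0"
  by (simp add: norm2_def)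

lemma norm2_power2: "(norm2 M g)\<^sup>2 = (LINT x|M. (cmod (g x))\<^sup>2)"
  by (simp add: norm2_def)

lemma norm2_cong_AE:
  assumes "AE x in M. g x = h x" "g \<in> borel_measurable M" "h \<in> borel_measurable M"
  shows "norm2 M g = norm2 M h"
  unfolding norm2_def by (intro arg_cong[of _ _ sqrt] integral_cong_AE) (use assms in auto)

text \<open>Young's inequality, from which a suitable \<open>\<delta>\<close> yields the triangle inequality of \<open>norm2\<close>.\<close>

lemma cmod_add_power2_le:
  assumes "\<delta> > 0"
  shows "(cmod (a + b))\<^sup>2 \<le> (1 + \<delta>) * (cmod a)\<^sup>2 + (1 + 1 / \<delta>) * (cmod b)\<^sup>2"
proof -
  have "0 \<le> (sqrt \<delta> * cmod a - cmod b / sqrt \<delta>)\<^sup>2" by simp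
  also have "\<dots> = \<delta> * (cmod a)\<^sup>2 + (cmod b)\<^sup>2 / \<delta> - 2 * cmod a * cmod b"
    using assms by (simp add: power2_diff power_mult_distrib power_divide)
  finally have "2 * cmod a * cmod b \<le> \<delta> * (cmod a)\<^sup>2 + (cmod b)\<^sup>2 / \<delta>" by simp
  moreover have "(cmod (a + b))\<^sup>2 \<le> (cmod a + cmod b)\<^sup>2"
    by (intro power_mono norm_triangle_ineq norm_ge_zero)
  ultimately show ?thesis by (simp add: power2_sum algebra_simps)
qed

lemma square_integrable_add:
  assumes g: "square_integrable M g" and h: "square_integrable M h"
  shows "square_integrable M (\<lambda>x. g x + h x)"
proof -
  have [measurable]: "g \<in> borel_measurable M" "h \<in> borel_measurable M"
    using g h by (auto simp: square_integrable_def)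
  have "integrable M (\<lambda>x. (cmod (g x + h x))\<^sup>2)"
    by (rule Bochner_Integration.integrable_bound[where f = "\<lambda>x. 2 * (cmod (g x))\<^sup>2 + 2 * (cmod (h x))\<^sup>2"])
       (use g h cmod_add_power2_le[of 1] in \<open>auto simp: square_integrable_def\<close>)
  then show ?thesis by (simp add: square_integrable_def)
qed

lemma square_integrable_cmult: "square_integrable M g \<Longrightarrow> square_integrable M (\<lambda>x. c * g x)"
  by (auto simp: square_integrable_def norm_mult power_mult_distrib)

lemma square_integrable_diff: "square_integrable M g \<Longrightarrow> square_integrable M h \<Longrightarrow> square_integrable M (\<lambda>x. g x - h x)"
  using square_integrable_add[of M g "\<lambda>x. -1 * h x"] square_integrable_cmult[of M h "-1"] by simp

lemma square_integrable_zero [simp]: "square_integrable M (\<lambda>x. 0)"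
  by (simp add: square_integrable_def)

lemma square_integrable_sum:
  "(\<And>i. i \<in> A \<Longrightarrow> square_integrable M (g i)) \<Longrightarrow> square_integrable M (\<lambda>x. \<Sum>i\<in>A. g i x)"
  by (induction A rule: infinite_finite_induct) (auto intro: square_integrable_add)

lemma norm2_cmult: "norm2 M (\<lambda>x. c * g x) = cmod c * norm2 M g"
  by (simp add: norm2_def norm_mult power_mult_distrib real_sqrt_mult)

lemma norm2_triangle:
  assumes g: "square_integrable M g" and h: "square_integrable M h"
  shows "norm2 M (\<lambda>x. g x + h x) \<le> norm2 M g + norm2 M h"
proof (rule field_le_epsilon)
  fix e :: real assume e: "e > 0"
  define A B where "A = norm2 M g + e / 2" and "B = norm2 M h + e / 2"
  have AB: "A > 0" "B > 0" using e by (auto simp: A_def B_def add_nonneg_pos)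
  have "(norm2 M (\<lambda>x. g x + h x))\<^sup>2 \<le> (LINT x|M. (1 + B / A) * (cmod (g x))\<^sup>2 + (1 + 1 / (B / A)) * (cmod (h x))\<^sup>2)"
    unfolding norm2_power2
    by (intro integral_mono cmod_add_power2_le)
       (use g h AB square_integrable_add[OF g h] in \<open>auto simp: square_integrable_def\<close>)
  also have "\<dots> = (1 + B / A) * (norm2 M g)\<^sup>2 + (1 + A / B) * (norm2 M h)\<^sup>2"
    using g h by (simp add: square_integrable_def norm2_power2)
  also have "\<dots> \<le> (1 + B / A) * A\<^sup>2 + (1 + A / B) * B\<^sup>2"
    using AB e by (intro add_mono mult_left_mono power_mono) (auto simp: A_def B_def)
  also have "\<dots> = (A + B)\<^sup>2"
    using AB by (simp add: field_simps power2_eq_square)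
  finally have "norm2 M (\<lambda>x. g x + h x) \<le> A + B"
    by (rule power2_le_imp_le) (use AB in simp)
  then show "norm2 M (\<lambda>x. g x + h x) \<le> norm2 M g + norm2 M h + e"
    by (simp add: A_def B_def)
qed

lemma norm2_minus_commute: "norm2 M (\<lambda>x. g x - h x) = norm2 M (\<lambda>x. h x - g x)"
  by (simp add: norm2_def norm_minus_commute)

lemma norm2_triangle_diff:
  assumes "square_integrable M g" "square_integrable M h" "square_integrable M k"
  shows "norm2 M (\<lambda>x. g x - k x) \<le> norm2 M (\<lambda>x. g x - h x) + norm2 M (\<lambda>x. h x - k x)"
  using norm2_triangle[OF square_integrable_diff[OF assms(1,2)] square_integrable_diff[OF assms(2,3)]] by simp

lemma norm2_reverse_triangle:
  assumes g: "square_integrable M g" and h: "square_integrable M h"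
  shows "\<bar>norm2 M g - norm2 M h\<bar> \<le> norm2 M (\<lambda>x. g x - h x)"
  using norm2_triangle_diff[OF g h square_integrable_zero] norm2_triangle_diff[OF h g square_integrable_zero]
  by (simp add: norm2_minus_commute[of M g h])

lemma norm2_tendsto:
  assumes "\<And>j. square_integrable M (g j)" "square_integrable M h"
    "(\<lambda>j. norm2 M (\<lambda>x. h x - g j x)) \<longlonglongrightarrow> 0"
  shows "(\<lambda>j. norm2 M (g j)) \<longlonglongrightarrow> norm2 M h"
proof (rule LIM_zero_cancel, rule Lim_null_comparison[OF _ assms(3)])
  show "\<forall>\<^sub>F j in sequentially. norm (norm2 M (g j) - norm2 M h) \<le> norm2 M (\<lambda>x. h x - g j x)"
    using norm2_reverse_triangle[OF assms(1,2)] by (simp add: norm2_minus_commute[of M h])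
qed

text \<open>A positive bound takes the place of the norm itself in order to divide by it.\<close>

lemma (in finite_measure) integral_norm_le_norm2:
  assumes g: "square_integrable M g" and c: "norm2 M g \<le> c" "c > 0"
  shows "integrable M g" "(LINT x|M. norm (g x)) \<le> c * (measure M (space M) + 1)"
proof -
  have [measurable]: "g \<in> borel_measurable M" using g by (auto simp: square_integrable_def)
  have le: "norm (g x) \<le> c + (cmod (g x))\<^sup>2 / c" for x
  proof (cases "norm (g x) \<le> c")
    case False
    then have "norm (g x) * c \<le> (norm (g x))\<^sup>2" using c by (simp add: power2_eq_square mult_left_mono)
    then have "norm (g x) \<le> (norm (g x))\<^sup>2 / c" using c by (simp add: field_simps)
    then show ?thesis using c by simp
  qed (use c in \<open>simp add: add_increasing2\<close>)
  have i: "integrable M (\<lambda>x. c + (cmod (g x))\<^sup>2 / c)"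
    using g by (auto simp: square_integrable_def)
  show int: "integrable M g"
    by (rule Bochner_Integration.integrable_bound[OF i]) (use le in \<open>auto intro: order_trans[OF _ abs_ge_self]\<close>)
  have "(LINT x|M. norm (g x)) \<le> (LINT x|M. c + (cmod (g x))\<^sup>2 / c)"
    by (rule integral_mono) (use int i le in auto)
  also have "\<dots> = c * measure M (space M) + (norm2 M g)\<^sup>2 / c"
    using g by (simp add: square_integrable_def norm2_power2)
  also have "(norm2 M g)\<^sup>2 / c \<le> c"
    using power_mono[OF c(1), of 2] c by (simp add: field_simps power2_eq_square)
  finally show "(LINT x|M. norm (g x)) \<le> c * (measure M (space M) + 1)"
    by (simp add: algebra_simps)
qed

lemma AE_summable_norm:
  fixes f :: "nat \<Rightarrow> 'a \<Rightarrow> complex"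
  assumes f: "\<And>i. integrable M (f i)" and s: "summable (\<lambda>i. LINT x|M. norm (f i x))"
  shows "AE x in M. summable (\<lambda>i. norm (f i x))"
proof -
  have [measurable]: "f i \<in> borel_measurable M" for i using f by auto
  have "(\<integral>\<^sup>+x. (\<Sum>i. ennreal (norm (f i x))) \<partial>M) = (\<Sum>i. \<integral>\<^sup>+x. ennreal (norm (f i x)) \<partial>M)"
    by (rule nn_integral_suminf) simp
  also have "\<dots> = (\<Sum>i. ennreal (LINT x|M. norm (f i x)))"
    by (intro suminf_cong nn_integral_eq_integral integrable_norm f) auto
  also have "\<dots> \<noteq> \<infinity>" using s by (simp add: ennreal_suminf_neq_top)
  finally have "AE x in M. (\<Sum>i. ennreal (norm (f i x))) \<noteq> \<infinity>"
    by (intro nn_integral_PInf_AE) auto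
  then show ?thesis
    by eventually_elim (auto intro: summable_suminf_not_top)
qed

text \<open>Fatou's lemma turns almost sure convergence of a Cauchy sequence into convergence in mean square.\<close>

lemma norm2_Fatou:
  assumes Y: "\<And>N. square_integrable M (Y N)" and X: "X \<in> borel_measurable M"
    and lim: "AE x in M. (\<lambda>N. Y N x) \<longlonglongrightarrow> X x"
    and C: "\<And>e. e > 0 \<Longrightarrow> \<exists>N0. \<forall>m\<ge>N0. \<forall>n\<ge>N0. norm2 M (\<lambda>x. Y m x - Y n x) \<le> e"
  shows "square_integrable M X" "(\<lambda>N. norm2 M (\<lambda>x. X x - Y N x)) \<longlonglongrightarrow> 0"
proof -
  have [measurable]: "Y N \<in> borel_measurable M" for N using Y by (auto simp: square_integrable_def)
  note X [measurable]
  have key: "square_integrable M (\<lambda>x. X x - Y n x) \<and> norm2 M (\<lambda>x. X x - Y n x) \<le> e"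
    if N: "\<forall>m\<ge>N0. \<forall>n\<ge>N0. norm2 M (\<lambda>x. Y m x - Y n x) \<le> e" and n: "n \<ge> N0" and e: "e \<ge> 0" for n N0 e
  proof -
    have "AE x in M. (\<lambda>m. ennreal ((cmod (Y m x - Y n x))\<^sup>2)) \<longlonglongrightarrow> ennreal ((cmod (X x - Y n x))\<^sup>2)"
      using lim by eventually_elim (intro tendsto_ennrealI tendsto_intros)
    then have eq: "AE x in M. liminf (\<lambda>m. ennreal ((cmod (Y m x - Y n x))\<^sup>2)) = ennreal ((cmod (X x - Y n x))\<^sup>2)"
      by eventually_elim (simp add: lim_imp_Liminf)
    have "(\<integral>\<^sup>+x. ennreal ((cmod (X x - Y n x))\<^sup>2) \<partial>M) = (\<integral>\<^sup>+x. liminf (\<lambda>m. ennreal ((cmod (Y m x - Y n x))\<^sup>2)) \<partial>M)"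
      by (rule nn_integral_cong_AE) (use eq in \<open>auto elim: eventually_mono\<close>)
    also have "\<dots> \<le> liminf (\<lambda>m. \<integral>\<^sup>+x. ennreal ((cmod (Y m x - Y n x))\<^sup>2) \<partial>M)"
      by (rule nn_integral_liminf) simp
    also have "\<dots> \<le> liminf (\<lambda>m. ennreal (e\<^sup>2))"
    proof (rule Liminf_mono, rule eventually_sequentiallyI[of N0])
      fix m assume "m \<ge> N0"
      have "(\<integral>\<^sup>+x. ennreal ((cmod (Y m x - Y n x))\<^sup>2) \<partial>M) = ennreal ((norm2 M (\<lambda>x. Y m x - Y n x))\<^sup>2)"
        unfolding norm2_power2
        by (rule nn_integral_eq_integral) (use square_integrable_diff[OF Y Y] in \<open>auto simp: square_integrable_def\<close>)
      also have "\<dots> \<le> ennreal (e\<^sup>2)"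
        using N n \<open>m \<ge> N0\<close> by (intro ennreal_leI power_mono) auto
      finally show "(\<integral>\<^sup>+x. ennreal ((cmod (Y m x - Y n x))\<^sup>2) \<partial>M) \<le> ennreal (e\<^sup>2)" .
    qed
    finally have le: "(\<integral>\<^sup>+x. ennreal ((cmod (X x - Y n x))\<^sup>2) \<partial>M) \<le> ennreal (e\<^sup>2)"
      by (simp add: Liminf_const)
    have int: "integrable M (\<lambda>x. (cmod (X x - Y n x))\<^sup>2)"
      by (rule integrableI_bounded) (use le in \<open>auto simp: order_le_less_trans\<close>)
    have "ennreal ((norm2 M (\<lambda>x. X x - Y n x))\<^sup>2) \<le> ennreal (e\<^sup>2)"
      unfolding norm2_power2 using le by (subst nn_integral_eq_integral[symmetric]) (use int in auto)
    then have "(norm2 M (\<lambda>x. X x - Y n x))\<^sup>2 \<le> e\<^sup>2" by (simp add: ennreal_le_iff)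
    then have "norm2 M (\<lambda>x. X x - Y n x) \<le> e" using e by (rule power2_le_imp_le)
    with int show ?thesis by (simp add: square_integrable_def)
  qed
  obtain N0 where "\<forall>m\<ge>N0. \<forall>n\<ge>N0. norm2 M (\<lambda>x. Y m x - Y n x) \<le> 1" using C[of 1] by auto
  from key[OF this, of N0] have "square_integrable M (\<lambda>x. X x - Y N0 x)" by simp
  from square_integrable_add[OF this Y[of N0]] show "square_integrable M X" by simp
  show "(\<lambda>N. norm2 M (\<lambda>x. X x - Y N x)) \<longlonglongrightarrow> 0"
  proof (rule LIMSEQ_I)
    fix r :: real assume "r > 0"
    then obtain N0 where N: "\<forall>m\<ge>N0. \<forall>n\<ge>N0. norm2 M (\<lambda>x. Y m x - Y n x) \<le> r / 2" using C[of "r / 2"] by auto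
    have "norm2 M (\<lambda>x. X x - Y n x) \<le> r / 2" if "n \<ge> N0" for n
      using key[OF N that] \<open>r > 0\<close> by auto
    then show "\<exists>no. \<forall>n\<ge>no. norm (norm2 M (\<lambda>x. X x - Y n x) - 0) < r"
      using \<open>r > 0\<close> by (intro exI[of _ N0]) (force intro: le_less_trans)
  qed
qed

text \<open>A subsequence with geometrically small increments converges almost everywhere, and \<open>norm2_Fatou\<close> applies.\<close>

lemma (in finite_measure) norm2_complete:
  assumes Y: "\<And>N. square_integrable M (Y N)"
    and C: "\<And>e. e > 0 \<Longrightarrow> \<exists>N0. \<forall>m\<ge>N0. \<forall>n\<ge>N0. norm2 M (\<lambda>x. Y m x - Y n x) \<le> e"
  shows "\<exists>X. square_integrable M X \<and> (\<lambda>N. norm2 M (\<lambda>x. X x - Y N x)) \<longlonglongrightarrow> 0"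
proof -
  have [measurable]: "Y N \<in> borel_measurable M" for N using Y by (auto simp: square_integrable_def)
  have "\<exists>N0. \<forall>m\<ge>N0. \<forall>n\<ge>N0. norm2 M (\<lambda>x. Y m x - Y n x) \<le> (1 / 2) ^ k" for k :: nat
    using C[of "(1 / 2) ^ k"] by simp
  then obtain N0 where N0: "\<And>k m n. m \<ge> N0 k \<Longrightarrow> n \<ge> N0 k \<Longrightarrow> norm2 M (\<lambda>x. Y m x - Y n x) \<le> (1 / 2) ^ k"
    by metis
  define r where "r k = (\<Sum>i\<le>k. N0 i) + k" for k
  have rN: "N0 k \<le> r k" "N0 k \<le> r (Suc k)" "k \<le> r k" for k
    unfolding r_def using member_le_sum[of k "{..k}" N0] member_le_sum[of k "{..Suc k}" N0] by auto
  define D where "D k x = Y (r (Suc k)) x - Y (r k) x" for k x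
  have D: "square_integrable M (D k)" for k
    unfolding D_def by (intro square_integrable_diff Y)
  have Dn: "norm2 M (D k) \<le> (1 / 2) ^ k" for k
    unfolding D_def by (rule N0[OF rN(2,1)])
  note DL = integral_norm_le_norm2[OF D Dn]
  have "summable (\<lambda>k. LINT x|M. norm (D k x))"
    by (rule summable_comparison_test[of _ "\<lambda>k. (1 / 2) ^ k * (measure M (space M) + 1)"])
       (use DL(2) in \<open>auto intro!: summable_mult2 simp: summable_geometric\<close>)
  from AE_summable_norm[OF DL(1) this] have sD: "AE x in M. summable (\<lambda>k. norm (D k x))" by simp
  define X where "X x = lim (\<lambda>k. Y (r k) x)" for x
  have X: "X \<in> borel_measurable M" unfolding X_def by measurable
  have lim: "AE x in M. (\<lambda>k. Y (r k) x) \<longlonglongrightarrow> X x"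
    using sD
  proof eventually_elim
    fix x assume "summable (\<lambda>k. norm (D k x))"
    then have "summable (\<lambda>k. D k x)" by (rule summable_norm_cancel)
    then have "convergent (\<lambda>n. \<Sum>k<n. D k x)" by (simp add: summable_iff_convergent)
    then have "convergent (\<lambda>n. Y (r n) x - Y (r 0) x)"
      unfolding D_def by (simp add: sum_lessThan_telescope[of "\<lambda>n. Y (r n) x"])
    then have "convergent (\<lambda>n. Y (r n) x - Y (r 0) x + Y (r 0) x)" by (intro convergent_add convergent_const)
    then show "(\<lambda>k. Y (r k) x) \<longlonglongrightarrow> X x" by (simp add: X_def convergent_LIMSEQ_iff)
  qed
  have Cr: "\<exists>K. \<forall>m\<ge>K. \<forall>n\<ge>K. norm2 M (\<lambda>x. Y (r m) x - Y (r n) x) \<le> e" if "e > 0" for e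
  proof -
    from C[OF that] obtain K where "\<forall>m\<ge>K. \<forall>n\<ge>K. norm2 M (\<lambda>x. Y m x - Y n x) \<le> e" by blast
    then show ?thesis using rN(3) by (meson order_trans)
  qed
  note F = norm2_Fatou[OF Y X lim Cr]
  have "(\<lambda>N. norm2 M (\<lambda>x. X x - Y N x)) \<longlonglongrightarrow> 0"
  proof (rule LIMSEQ_I)
    fix e :: real assume e: "e > 0"
    then obtain K where K: "\<forall>m\<ge>K. \<forall>n\<ge>K. norm2 M (\<lambda>x. Y m x - Y n x) \<le> e / 4" using C[of "e / 4"] by auto
    obtain K' where K': "\<And>k. k \<ge> K' \<Longrightarrow> norm2 M (\<lambda>x. X x - Y (r k) x) < e / 4"
      using LIMSEQ_D[OF F(2), of "e / 4"] e by auto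
    have "norm2 M (\<lambda>x. X x - Y n x) < e" if n: "n \<ge> K" for n
    proof -
      let ?k = "max K K'"
      have "norm2 M (\<lambda>x. X x - Y n x) \<le> norm2 M (\<lambda>x. X x - Y (r ?k) x) + norm2 M (\<lambda>x. Y (r ?k) x - Y n x)"
        by (rule norm2_triangle_diff[OF F(1) Y Y])
      also have "norm2 M (\<lambda>x. Y (r ?k) x - Y n x) \<le> e / 4"
        using K n rN(3)[of ?k] by auto
      also have "norm2 M (\<lambda>x. X x - Y (r ?k) x) < e / 4" by (rule K') simp
      finally show ?thesis using e by simp
    qed
    then show "\<exists>no. \<forall>n\<ge>no. norm (norm2 M (\<lambda>x. X x - Y n x) - 0) < e" by auto
  qed
  with F(1) show ?thesis by blast
qed

lemma square_integrable_mult_cnj: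
  assumes g: "square_integrable M g" and h: "square_integrable M h"
  shows "integrable M (\<lambda>x. g x * cnj (h x))"
proof -
  have [measurable]: "g \<in> borel_measurable M" "h \<in> borel_measurable M"
    using g h by (auto simp: square_integrable_def)
  have le: "a * b \<le> a\<^sup>2 + b\<^sup>2" if "0 \<le> a * b" for a b :: real
    using sum_squares_bound[of a b] that by simp
  have "cmod (g x) * cmod (h x) \<le> (cmod (g x))\<^sup>2 + (cmod (h x))\<^sup>2" for x
    by (rule le) simp
  then have "AE x in M. norm (g x * cnj (h x)) \<le> norm ((cmod (g x))\<^sup>2 + (cmod (h x))\<^sup>2)"
    by (intro AE_I2) (simp add: norm_mult)
  moreover have "integrable M (\<lambda>x. (cmod (g x))\<^sup>2 + (cmod (h x))\<^sup>2)"
    using g h by (simp add: square_integrable_def)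
  moreover have "(\<lambda>x. g x * cnj (h x)) \<in> borel_measurable M"
    by (intro borel_measurable_times measurable_compose[OF _ borel_measurable_continuous_onI[of cnj]] continuous_intros) fact+
  ultimately show ?thesis by (rule Bochner_Integration.integrable_bound[rotated 2])
qed

section \<open>The spectral measure of a density\<close>

definition spectral_measure :: "(real \<Rightarrow> real) \<Rightarrow> real measure" where
  "spectral_measure f = density circ (\<lambda>t. ennreal (f t / (2 * pi)))"

lemma density_measurable: "is_density f \<Longrightarrow> f \<in> borel_measurable circ"
  by (auto simp: is_density_def circ_integrable)

lemma density_AE_nonneg: "is_density f \<Longrightarrow> AE t in circ. 0 \<le> f t / (2 * pi)"
  by (intro circ_AE_countable[of "{}"]) (auto simp: is_density_def)

lemma space_spectral_measure [simp]: "space (spectral_measure f) = {-pi..pi}"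
  by (simp add: spectral_measure_def)

lemma spectral_measure_measurable [simp]:
  "g \<in> borel_measurable (spectral_measure f) \<longleftrightarrow> g \<in> borel_measurable circ"
  by (simp add: spectral_measure_def)

lemma spectral_measure_AE: "is_density f \<Longrightarrow> AE t in circ. Q t \<Longrightarrow> AE t in spectral_measure f. Q t"
  unfolding spectral_measure_def using density_measurable[of f]
  by (subst AE_density) (auto elim: eventually_mono)

lemma spectral_measure_integrable:
  fixes g :: "real \<Rightarrow> real"
  assumes "is_density f" "g \<in> borel_measurable circ"
  shows "integrable (spectral_measure f) g \<longleftrightarrow> integrable circ (\<lambda>t. g t * f t)"
proof -
  have "integrable (spectral_measure f) g \<longleftrightarrow> integrable circ (\<lambda>t. (f t / (2 * pi)) *\<^sub>R g t)"
    unfolding spectral_measure_def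
    by (rule integrable_density) (use assms density_measurable density_AE_nonneg in auto)
  also have "(\<lambda>t. (f t / (2 * pi)) *\<^sub>R g t) = (\<lambda>t. 1 / (2 * pi) * (g t * f t))" by (auto simp: mult.commute)
  finally show ?thesis using pi_gt_zero by (simp only: integrable_mult_left_iff) simp
qed

lemma spectral_measure_integral:
  fixes g :: "real \<Rightarrow> real"
  assumes "is_density f" "g \<in> borel_measurable circ"
  shows "(LINT t|spectral_measure f. g t) = 1 / (2 * pi) * (LINT t|circ. g t * f t)"
proof -
  have "(LINT t|spectral_measure f. g t) = (LINT t|circ. (f t / (2 * pi)) *\<^sub>R g t)"
    unfolding spectral_measure_def
    by (rule integral_density) (use assms density_measurable density_AE_nonneg in auto)
  also have "(\<lambda>t. (f t / (2 * pi)) *\<^sub>R g t) = (\<lambda>t. 1 / (2 * pi) * (g t * f t))" by (auto simp: mult.commute)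
  finally show ?thesis by (simp only: integral_mult_right_zero)
qed

lemma L2_iff: assumes "is_density f" shows "g \<in> L2 f \<longleftrightarrow> square_integrable (spectral_measure f) g"
proof (cases "g \<in> borel_measurable circ")
  case True
  then show ?thesis
    by (simp add: L2_def square_integrable_def circ_measurable circ_integrable spectral_measure_integrable[OF assms])
qed (simp add: L2_def square_integrable_def circ_measurable)

lemma L2_dist2_eq:
  assumes "is_density f" "g \<in> borel_measurable circ" "h \<in> borel_measurable circ"
  shows "L2_dist2 f g h = (norm2 (spectral_measure f) (\<lambda>t. g t - h t))\<^sup>2"
  unfolding L2_dist2_def norm2_power2 circ_integral
  using assms by (subst spectral_measure_integral) auto

lemma finite_spectral_measure: assumes "is_density f" shows "finite_measure (spectral_measure f)"
proof -
  have "integrable (spectral_measure f) (\<lambda>t. 1::real)"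
    using assms by (subst spectral_measure_integrable) (auto simp: is_density_def circ_integrable)
  then have "emeasure (spectral_measure f) (space (spectral_measure f)) < \<infinity>"
    unfolding integrable_iff_bounded by simp
  then show ?thesis by (intro finite_measureI) simp
qed

lemma spectral_measure_set:
  assumes f: "is_density f" and S: "S \<in> sets borel" "S \<subseteq> {-pi..pi}"
  shows "S \<in> sets (spectral_measure f)"
    "measure (spectral_measure f) S = 1 / (2 * pi) * (LINT t:S|lborel. f t)"
proof -
  interpret finite_measure "spectral_measure f" by (rule finite_spectral_measure[OF f])
  have "S \<inter> {-pi..pi} \<in> sets circ" using S by (auto simp: sets_restrict_space)
  then have Sc: "S \<in> sets circ" using S by (simp add: Int_absorb2)
  then show Sm: "S \<in> sets (spectral_measure f)" by (simp add: spectral_measure_def)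
  have "measure (spectral_measure f) S = (LINT t|spectral_measure f. indicator S t)"
    using Sm S by (simp add: Int_absorb2)
  also have "\<dots> = 1 / (2 * pi) * (LINT t|circ. indicator S t * f t)"
    by (rule spectral_measure_integral[OF f]) (use Sc in simp)
  also have "(LINT t|circ. indicator S t * f t) = (LINT t|lborel. indicator {-pi..pi} t *\<^sub>R (indicator S t * f t))"
    by (simp add: integral_restrict_space)
  also have "\<dots> = (LINT t:S|lborel. f t)"
    unfolding set_lebesgue_integral_def
    by (intro Bochner_Integration.integral_cong) (use S in \<open>auto split: split_indicator\<close>)
  finally show "measure (spectral_measure f) S = 1 / (2 * pi) * (LINT t:S|lborel. f t)" .
qed

lemma simple_functions_dense:
  assumes f: "is_density f" and g: "square_integrable (spectral_measure f) g"
  shows "\<exists>s. (\<forall>j. simple_function borel (s j)) \<and> (\<lambda>j. norm2 (spectral_measure f) (\<lambda>t. g t - s j t)) \<longlonglongrightarrow> 0"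
proof -
  let ?M = "spectral_measure f" let ?g = "\<lambda>t. indicator {-pi..pi} t *\<^sub>R g t"
  have gm: "g \<in> borel_measurable circ" using g by (simp add: square_integrable_def)
  then have "?g \<in> borel_measurable borel"
    by (simp add: borel_measurable_restrict_space_iff)
  from borel_measurable_implies_sequence_metric[OF this, of 0]
  obtain s where s: "\<And>j. simple_function borel (s j)" "\<And>t. (\<lambda>j. s j t) \<longlonglongrightarrow> ?g t"
    "\<And>j t. dist (s j t) 0 \<le> 2 * dist (?g t) 0" by auto
  have sm: "s j \<in> borel_measurable circ" for j
    using borel_measurable_simple_function[OF s(1)[of j]] by (simp add: measurable_restrict_space1)
  have le: "(cmod (g t - s j t))\<^sup>2 \<le> 9 * (cmod (g t))\<^sup>2" if "t \<in> {-pi..pi}" for j t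
  proof -
    have "cmod (g t - s j t) \<le> 3 * cmod (g t)"
      using norm_triangle_ineq4[of "g t" "s j t"] s(3)[of j t] that by (simp add: dist_norm)
    then have "(cmod (g t - s j t))\<^sup>2 \<le> (3 * cmod (g t))\<^sup>2" by (intro power_mono) auto
    then show ?thesis by (simp add: power_mult_distrib)
  qed
  have "(\<lambda>j. LINT t|?M. (cmod (g t - s j t))\<^sup>2) \<longlonglongrightarrow> (LINT t|?M. 0)"
  proof (rule integral_dominated_convergence[where w = "\<lambda>t. 9 * (cmod (g t))\<^sup>2"])
    show "integrable ?M (\<lambda>t. 9 * (cmod (g t))\<^sup>2)" using g by (simp add: square_integrable_def)
    show "AE t in ?M. (\<lambda>j. (cmod (g t - s j t))\<^sup>2) \<longlonglongrightarrow> 0"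
    proof (rule AE_I2)
      fix t assume "t \<in> space ?M"
      then have "(\<lambda>j. s j t) \<longlonglongrightarrow> g t" using s(2)[of t] by simp
      then have "(\<lambda>j. (cmod (g t - s j t))\<^sup>2) \<longlonglongrightarrow> (cmod (g t - g t))\<^sup>2" by (intro tendsto_intros)
      then show "(\<lambda>j. (cmod (g t - s j t))\<^sup>2) \<longlonglongrightarrow> 0" by simp
    qed
    show "AE t in ?M. norm ((cmod (g t - s j t))\<^sup>2) \<le> 9 * (cmod (g t))\<^sup>2" for j
      by (rule AE_I2) (use le in auto)
  qed (use gm sm in auto)
  then have "(\<lambda>j. norm2 ?M (\<lambda>t. g t - s j t)) \<longlonglongrightarrow> 0"
    unfolding norm2_def using tendsto_real_sqrt[of _ 0] by fastforce
  with s(1) show ?thesis by blast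
qed

lemma simple_square_integrable:
  assumes f: "is_density f" and s: "simple_function borel s" shows "square_integrable (spectral_measure f) s"
proof -
  interpret finite_measure "spectral_measure f" by (rule finite_spectral_measure[OF f])
  have sm: "s \<in> borel_measurable circ"
    using borel_measurable_simple_function[OF s] by (simp add: measurable_restrict_space1)
  have "finite (range s)" using simple_functionD(1)[OF s] by simp
  then obtain B where B: "\<And>t. norm (s t) \<le> B"
    using finite_imp_bounded[of "range s"] by (auto simp: bounded_iff)
  have "integrable (spectral_measure f) (\<lambda>t. (cmod (s t))\<^sup>2)"
    by (rule integrable_const_bound[where B = "B\<^sup>2"]) (use B sm in \<open>auto intro!: power_mono\<close>)
  with sm show ?thesis by (simp add: square_integrable_def)
qed

section \<open>Stochastic integrals\<close>

text \<open>The measure \<open>Z\<close> is additive only up to null sets, which depend on the sets, so that all identities between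
  integrals hold almost surely.\<close>

locale stochastic_measure = prob_space P for P :: "'w measure" +
  fixes f :: "real \<Rightarrow> real" and Z :: "real set \<Rightarrow> 'w \<Rightarrow> complex"
  assumes density: "is_density f" and orth: "orthogonal_measure P f Z"
begin

abbreviation "F \<equiv> spectral_measure f"

definition bset :: "real set \<Rightarrow> bool" where "bset S \<longleftrightarrow> S \<in> sets borel \<and> S \<subseteq> {-pi..pi}"

lemma Z_square_integrable: "bset S \<Longrightarrow> square_integrable P (Z S)"
  using orth by (auto simp: orthogonal_measure_def bset_def square_integrable_def)

lemma Z_variance: "bset S \<Longrightarrow> (LINT \<omega>|P. (cmod (Z S \<omega>))\<^sup>2) = measure F S"
  using orth spectral_measure_set(2)[OF density] by (auto simp: orthogonal_measure_def bset_def)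

lemma Z_orthogonal: "bset S \<Longrightarrow> bset T \<Longrightarrow> S \<inter> T = {} \<Longrightarrow> (LINT \<omega>|P. Z S \<omega> * cnj (Z T \<omega>)) = 0"
  using orth by (auto simp: orthogonal_measure_def bset_def)

lemma Z_add: "bset S \<Longrightarrow> bset T \<Longrightarrow> S \<inter> T = {} \<Longrightarrow> AE \<omega> in P. Z (S \<union> T) \<omega> = Z S \<omega> + Z T \<omega>"
  using orth by (auto simp: orthogonal_measure_def bset_def)

lemma Z_empty: "AE \<omega> in P. Z {} \<omega> = 0"
  using Z_add[of "{}" "{}"] by (simp add: bset_def)

lemma Z_finite_Union:
  assumes "finite J" "\<And>j. j \<in> J \<Longrightarrow> bset (A j)" "disjoint_family_on A J"
  shows "AE \<omega> in P. Z (\<Union>j\<in>J. A j) \<omega> = (\<Sum>j\<in>J. Z (A j) \<omega>)"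
  using assms
proof (induction J rule: finite_induct)
  case empty then show ?case using Z_empty by simp
next
  case (insert i J)
  have "bset (\<Union>j\<in>J. A j)" using insert.hyps insert.prems(1) by (auto simp: bset_def)
  moreover have "A i \<inter> (\<Union>j\<in>J. A j) = {}"
    using insert.hyps insert.prems(2) by (auto simp: disjoint_family_on_def)
  ultimately have "AE \<omega> in P. Z (A i \<union> (\<Union>j\<in>J. A j)) \<omega> = Z (A i) \<omega> + Z (\<Union>j\<in>J. A j) \<omega>"
    using insert.prems(1) by (intro Z_add) auto
  moreover have "AE \<omega> in P. Z (\<Union>j\<in>J. A j) \<omega> = (\<Sum>j\<in>J. Z (A j) \<omega>)"
    using insert.prems by (intro insert.IH) (auto simp: disjoint_family_on_def)
  ultimately show ?case by eventually_elim (use insert.hyps in simp)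
qed

text \<open>A simple function may be integrated over any partition on which it is constant. Writing two simple functions over
  a common partition, the level sets of \<open>q\<close>, makes the integral linear.\<close>

lemma simple_integral_refine:
  assumes q: "finite (q ` {-pi..pi})" "\<And>j. {-pi..pi} \<inter> q -` {j} \<in> sets borel"
    and s: "\<And>t. t \<in> {-pi..pi} \<Longrightarrow> s t = h (q t)"
  shows "AE \<omega> in P. simple_integral_Z Z s \<omega> = (\<Sum>j\<in>q ` {-pi..pi}. h j * Z ({-pi..pi} \<inter> q -` {j}) \<omega>)"
proof -
  let ?I = "{-pi..pi}" let ?J = "q ` ?I" let ?A = "\<lambda>j. ?I \<inter> q -` {j}"
  have im: "s ` ?I = h ` ?J" using s by (force simp: image_iff)
  have A: "bset (?A j)" for j using q(2) by (simp add: bset_def)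
  have "AE \<omega> in P. Z (?I \<inter> s -` {c}) \<omega> = (\<Sum>j\<in>{j\<in>?J. h j = c}. Z (?A j) \<omega>)" for c
  proof -
    have "?I \<inter> s -` {c} = (\<Union>j\<in>{j\<in>?J. h j = c}. ?A j)" using s by auto
    moreover have "AE \<omega> in P. Z (\<Union>j\<in>{j\<in>?J. h j = c}. ?A j) \<omega> = (\<Sum>j\<in>{j\<in>?J. h j = c}. Z (?A j) \<omega>)"
      by (rule Z_finite_Union) (use q A in \<open>auto simp: disjoint_family_on_def\<close>)
    ultimately show ?thesis by simp
  qed
  then have "AE \<omega> in P. \<forall>c\<in>h ` ?J. Z (?I \<inter> s -` {c}) \<omega> = (\<Sum>j\<in>{j\<in>?J. h j = c}. Z (?A j) \<omega>)"
    using q(1) by (intro AE_finite_allI) auto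
  then show ?thesis
  proof eventually_elim
    case (elim \<omega>)
    have "simple_integral_Z Z s \<omega> = (\<Sum>c\<in>h ` ?J. \<Sum>j\<in>{j\<in>?J. h j = c}. h j * Z (?A j) \<omega>)"
      unfolding simple_integral_Z_def im
    proof (intro sum.cong refl)
      fix c assume "c \<in> h ` ?J"
      with elim have "Z (?I \<inter> s -` {c}) \<omega> = (\<Sum>j\<in>{j\<in>?J. h j = c}. Z (?A j) \<omega>)" by (rule bspec)
      then show "c * Z (?I \<inter> s -` {c}) \<omega> = (\<Sum>j\<in>{j\<in>?J. h j = c}. h j * Z (?A j) \<omega>)"
        by (simp only: sum_distrib_left) (intro sum.cong refl, simp)
    qed
    also have "\<dots> = (\<Sum>j\<in>?J. h j * Z (?A j) \<omega>)"
      by (rule sum.group) (use q in auto)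
    finally show ?case .
  qed
qed

lemma simple_level_sets:
  assumes "simple_function borel s"
  shows "finite (s ` {-pi..pi})" "bset ({-pi..pi} \<inter> s -` {c})"
proof -
  show "finite (s ` {-pi..pi})"
    using simple_functionD(1)[OF assms] by (rule finite_subset[rotated]) auto
  have "s -` {c} \<in> sets borel" using simple_functionD(2)[OF assms, of "{c}"] by simp
  then show "bset ({-pi..pi} \<inter> s -` {c})" by (simp add: bset_def)
qed

lemma simple_integral_linear:
  assumes s: "simple_function borel s" "simple_function borel s'"
  shows "AE \<omega> in P. simple_integral_Z Z (\<lambda>t. \<alpha> * s t + \<beta> * s' t) \<omega>
           = \<alpha> * simple_integral_Z Z s \<omega> + \<beta> * simple_integral_Z Z s' \<omega>"
proof -
  let ?I = "{-pi..pi}" let ?q = "\<lambda>t. (s t, s' t)"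
  have "?q ` ?I \<subseteq> s ` ?I \<times> s' ` ?I" by auto
  then have fin: "finite (?q ` ?I)"
    by (rule finite_subset) (use simple_level_sets(1)[OF s(1)] simple_level_sets(1)[OF s(2)] in simp)
  have m: "?I \<inter> ?q -` {j} \<in> sets borel" for j
  proof -
    have "?I \<inter> ?q -` {j} = (?I \<inter> s -` {fst j}) \<inter> (?I \<inter> s' -` {snd j})" by (auto simp: prod_eq_iff)
    then show ?thesis using simple_level_sets(2)[OF s(1)] simple_level_sets(2)[OF s(2)]
      by (simp add: bset_def)
  qed
  show ?thesis
    using simple_integral_refine[OF fin m, of "\<lambda>t. \<alpha> * s t + \<beta> * s' t" "\<lambda>j. \<alpha> * fst j + \<beta> * snd j", simplified]
      simple_integral_refine[OF fin m, of s fst, simplified] simple_integral_refine[OF fin m, of s' snd, simplified]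
    by eventually_elim (simp add: sum_distrib_left sum.distrib ring_distribs mult.assoc)
qed

lemma simple_integral_square_integrable:
  assumes "simple_function borel s" shows "square_integrable P (simple_integral_Z Z s)"
proof -
  have "square_integrable P (Z ({-pi..pi} \<inter> s -` {c}))" for c
    by (rule Z_square_integrable[OF simple_level_sets(2)[OF assms]])
  then have "square_integrable P (\<lambda>\<omega>. \<Sum>c\<in>s ` {-pi..pi}. c * Z ({-pi..pi} \<inter> s -` {c}) \<omega>)"
    by (intro square_integrable_sum square_integrable_cmult)
  then show ?thesis unfolding simple_integral_Z_def[abs_def] .
qed

text \<open>Orthogonality of \<open>Z\<close> on disjoint sets removes the mixed terms.\<close>

lemma simple_integral_isometry:
  assumes s: "simple_function borel s" shows "norm2 P (simple_integral_Z Z s) = norm2 F s"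
proof -
  let ?I = "{-pi..pi}" let ?A = "\<lambda>c. ?I \<inter> s -` {c}" let ?J = "s ` ?I"
  note fin = simple_level_sets(1)[OF s] note A = simple_level_sets(2)[OF s]
  have Ffin: "emeasure F A < \<infinity>" for A
    using finite_measure.emeasure_finite[OF finite_spectral_measure[OF density], of A] by (simp add: less_top[symmetric])
  have AF: "?A c \<in> sets F" for c
    by (rule spectral_measure_set(1)[OF density]) (use A[of c] in \<open>auto simp: bset_def\<close>)
  have int: "integrable P (\<lambda>\<omega>. (c * cnj d) * (Z (?A c) \<omega> * cnj (Z (?A d) \<omega>)))" for c d
    by (rule integrable_mult_right, rule square_integrable_mult_cnj) (rule Z_square_integrable[OF A])+
  have "complex_of_real ((norm2 P (simple_integral_Z Z s))\<^sup>2)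
      = (LINT \<omega>|P. complex_of_real ((cmod (simple_integral_Z Z s \<omega>))\<^sup>2))"
    unfolding norm2_power2
    by (rule integral_of_real[OF square_integrable_integrable[OF simple_integral_square_integrable[OF s]], symmetric])
  also have "\<dots> = (LINT \<omega>|P. (\<Sum>c\<in>?J. \<Sum>d\<in>?J. (c * cnj d) * (Z (?A c) \<omega> * cnj (Z (?A d) \<omega>))))"
    unfolding complex_norm_square simple_integral_Z_def
    by (intro Bochner_Integration.integral_cong refl) (simp only: cnj_sum complex_cnj_mult sum_product mult_ac)
  also have "\<dots> = (\<Sum>c\<in>?J. \<Sum>d\<in>?J. LINT \<omega>|P. (c * cnj d) * (Z (?A c) \<omega> * cnj (Z (?A d) \<omega>)))"
    by (subst Bochner_Integration.integral_sum, rule Bochner_Integration.integrable_sum, rule int,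
        subst Bochner_Integration.integral_sum, rule int, rule refl)
  also have "\<dots> = (\<Sum>c\<in>?J. \<Sum>d\<in>?J. (c * cnj d) * (LINT \<omega>|P. (Z (?A c) \<omega> * cnj (Z (?A d) \<omega>))))"
    by (simp only: integral_mult_right_zero)
  also have "\<dots> = (\<Sum>c\<in>?J. \<Sum>d\<in>?J. if d = c then complex_of_real ((cmod c)\<^sup>2 * measure F (?A c)) else 0)"
  proof (intro sum.cong refl)
    fix c d
    show "(c * cnj d) * (LINT \<omega>|P. (Z (?A c) \<omega> * cnj (Z (?A d) \<omega>)))
        = (if d = c then complex_of_real ((cmod c)\<^sup>2 * measure F (?A c)) else 0)"
    proof (cases "d = c")
      case True
      have "(LINT \<omega>|P. (Z (?A c) \<omega> * cnj (Z (?A c) \<omega>))) = complex_of_real (measure F (?A c))"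
        unfolding complex_norm_square[symmetric]
          integral_of_real[OF square_integrable_integrable[OF Z_square_integrable[OF A]]] Z_variance[OF A] ..
      then show ?thesis using True
        by (simp only: if_True simp_thms of_real_mult complex_norm_square[of c])
    next
      case False
      then have "(LINT \<omega>|P. (Z (?A c) \<omega> * cnj (Z (?A d) \<omega>))) = 0"
        by (intro Z_orthogonal A) auto
      then show ?thesis using False by simp
    qed
  qed
  also have "\<dots> = (\<Sum>c\<in>?J. complex_of_real ((cmod c)\<^sup>2 * measure F (?A c)))"
    using fin by simp
  also have "\<dots> = complex_of_real (\<Sum>c\<in>?J. (cmod c)\<^sup>2 * measure F (?A c))" by simp
  also have "(\<Sum>c\<in>?J. (cmod c)\<^sup>2 * measure F (?A c)) = (\<Sum>c\<in>?J. LINT t|F. (cmod c)\<^sup>2 * indicator (?A c) t)"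
  proof (intro sum.cong refl)
    fix c
    have "(LINT t|F. (cmod c)\<^sup>2 * indicator (?A c) t) = (cmod c)\<^sup>2 * measure F (?A c \<inter> space F)"
      by (simp only: integral_mult_right_zero Bochner_Integration.integral_indicator)
    moreover have "?A c \<inter> space F = ?A c" unfolding space_spectral_measure by blast
    ultimately show "(cmod c)\<^sup>2 * measure F (?A c) = (LINT t|F. (cmod c)\<^sup>2 * indicator (?A c) t)" by (simp only:)
  qed
  also have "\<dots> = (LINT t|F. (\<Sum>c\<in>?J. (cmod c)\<^sup>2 * indicator (?A c) t))"
    by (rule Bochner_Integration.integral_sum[symmetric])
       (intro integrable_mult_right integrable_real_indicator AF Ffin)
  also have "\<dots> = (norm2 F s)\<^sup>2"
    unfolding norm2_power2
  proof (rule Bochner_Integration.integral_cong)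
    fix t assume "t \<in> space F"
    then have t: "t \<in> ?I" by simp
    have "(\<Sum>c\<in>?J. (cmod c)\<^sup>2 * indicator (?A c) t) = (\<Sum>c\<in>?J. if c = s t then (cmod (s t))\<^sup>2 else 0)"
      by (intro sum.cong) (use t in \<open>auto split: split_indicator\<close>)
    also have "\<dots> = (cmod (s t))\<^sup>2" using fin t by simp
    finally show "(\<Sum>c\<in>?J. (cmod c)\<^sup>2 * indicator (?A c) t) = (cmod (s t))\<^sup>2" .
  qed simp
  finally have "(norm2 P (simple_integral_Z Z s))\<^sup>2 = (norm2 F s)\<^sup>2" by (simp only: of_real_eq_iff)
  then show ?thesis by (simp add: power2_eq_iff_nonneg)
qed

lemma simple_diff:
  assumes "simple_function borel s" "simple_function borel s'"
  shows "norm2 P (\<lambda>\<omega>. simple_integral_Z Z s \<omega> - simple_integral_Z Z s' \<omega>) = norm2 F (\<lambda>t. s t - s' t)"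
proof -
  have sf: "simple_function borel (\<lambda>t. s t - s' t)" using assms by (intro simple_function_diff)
  have "norm2 P (\<lambda>\<omega>. simple_integral_Z Z s \<omega> - simple_integral_Z Z s' \<omega>) = norm2 P (simple_integral_Z Z (\<lambda>t. s t - s' t))"
    by (rule norm2_cong_AE)
       (use simple_integral_linear[OF assms, of 1 "-1"] simple_integral_square_integrable[OF sf]
         simple_integral_square_integrable[OF assms(1)] simple_integral_square_integrable[OF assms(2)]
        in \<open>auto elim: eventually_mono dest: square_integrable_measurable\<close>)
  then show ?thesis using simple_integral_isometry[OF sf] by simp
qed

text \<open>In terms of \<open>norm2\<close> the triangle inequality becomes available.\<close>

lemma has_stoch_integral_iff:
  "has_stoch_integral P f Z g X \<longleftrightarrow> square_integrable F g \<and> square_integrable P X \<and>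
     (\<exists>s. (\<forall>j. simple_function borel (s j)) \<and> (\<lambda>j. norm2 F (\<lambda>t. g t - s j t)) \<longlonglongrightarrow> 0 \<and>
          (\<lambda>j. norm2 P (\<lambda>\<omega>. X \<omega> - simple_integral_Z Z (s j) \<omega>)) \<longlonglongrightarrow> 0)"
proof -
  have lim: "(\<lambda>j. (u j)\<^sup>2) \<longlonglongrightarrow> 0 \<longleftrightarrow> u \<longlonglongrightarrow> 0" for u :: "nat \<Rightarrow> real"
  proof
    assume "(\<lambda>j. (u j)\<^sup>2) \<longlonglongrightarrow> 0"
    from tendsto_real_sqrt[OF this] have "(\<lambda>j. \<bar>u j\<bar>) \<longlonglongrightarrow> 0" by simp
    then show "u \<longlonglongrightarrow> 0" by (rule tendsto_rabs_zero_cancel)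
  next
    assume "u \<longlonglongrightarrow> 0"
    from tendsto_power[OF this, of 2] show "(\<lambda>j. (u j)\<^sup>2) \<longlonglongrightarrow> 0" by simp
  qed
  have sm: "s \<in> borel_measurable circ" if "simple_function borel s" for s :: "real \<Rightarrow> complex"
    using borel_measurable_simple_function[OF that] by (simp add: measurable_restrict_space1)
  have eq: "(\<lambda>j. L2_dist2 f g (s j)) \<longlonglongrightarrow> 0 \<longleftrightarrow> (\<lambda>j. norm2 F (\<lambda>t. g t - s j t)) \<longlonglongrightarrow> 0"
    if "square_integrable F g" "\<forall>j. simple_function borel (s j)" for s
  proof -
    have "g \<in> borel_measurable circ" using that(1) by (simp add: square_integrable_def)
    then have "L2_dist2 f g (s j) = (norm2 F (\<lambda>t. g t - s j t))\<^sup>2" for j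
      by (rule L2_dist2_eq[OF density _ sm]) (use that(2) in auto)
    then show ?thesis by (simp only: lim)
  qed
  show ?thesis
  proof (cases "square_integrable F g \<and> square_integrable P X")
    case True
    then have g: "g \<in> L2 f" and X: "X \<in> borel_measurable P" "integrable P (\<lambda>\<omega>. (cmod (X \<omega>))\<^sup>2)"
      by (simp_all only: L2_iff[OF density] square_integrable_def)
    have "has_stoch_integral P f Z g X \<longleftrightarrow> (\<exists>s. (\<forall>j. simple_function borel (s j)) \<and> (\<lambda>j. L2_dist2 f g (s j)) \<longlonglongrightarrow> 0 \<and>
          (\<lambda>j. (norm2 P (\<lambda>\<omega>. X \<omega> - simple_integral_Z Z (s j) \<omega>))\<^sup>2) \<longlonglongrightarrow> 0)"
      unfolding has_stoch_integral_def norm2_power2 by (simp only: g X simp_thms)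
    also have "\<dots> \<longleftrightarrow> (\<exists>s. (\<forall>j. simple_function borel (s j)) \<and> (\<lambda>j. norm2 F (\<lambda>t. g t - s j t)) \<longlonglongrightarrow> 0 \<and>
          (\<lambda>j. norm2 P (\<lambda>\<omega>. X \<omega> - simple_integral_Z Z (s j) \<omega>)) \<longlonglongrightarrow> 0)"
      by (rule ex_cong1, rule conj_cong[OF refl], rule conj_cong, rule eq[OF conjunct1[OF True]], assumption, rule lim)
    finally show ?thesis using True by (simp only: simp_thms)
  next
    case False
    then show ?thesis unfolding has_stoch_integral_def L2_iff[OF density] square_integrable_def by blast
  qed
qed

lemma has_stoch_integral_square_integrable:
  "has_stoch_integral P f Z g X \<Longrightarrow> square_integrable F g" "has_stoch_integral P f Z g X \<Longrightarrow> square_integrable P X"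
  by (auto simp: has_stoch_integral_iff)

lemma has_stoch_integral_norm2:
  assumes "has_stoch_integral P f Z g X" shows "norm2 P X = norm2 F g"
proof -
  from assms obtain s where s: "square_integrable F g" "square_integrable P X" "\<And>j. simple_function borel (s j)"
    "(\<lambda>j. norm2 F (\<lambda>t. g t - s j t)) \<longlonglongrightarrow> 0" "(\<lambda>j. norm2 P (\<lambda>\<omega>. X \<omega> - simple_integral_Z Z (s j) \<omega>)) \<longlonglongrightarrow> 0"
    by (auto simp: has_stoch_integral_iff)
  have "(\<lambda>j. norm2 F (s j)) \<longlonglongrightarrow> norm2 F g"
    by (rule norm2_tendsto[OF simple_square_integrable[OF density s(3)] s(1,4)])
  moreover have "(\<lambda>j. norm2 P (simple_integral_Z Z (s j))) \<longlonglongrightarrow> norm2 P X"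
    by (rule norm2_tendsto[OF simple_integral_square_integrable[OF s(3)] s(2,5)])
  ultimately show ?thesis using simple_integral_isometry[OF s(3)] by (simp add: LIMSEQ_unique)
qed

lemma has_stoch_integral_linear:
  assumes X: "has_stoch_integral P f Z g X" and Y: "has_stoch_integral P f Z h Y"
  shows "has_stoch_integral P f Z (\<lambda>t. \<alpha> * g t + \<beta> * h t) (\<lambda>\<omega>. \<alpha> * X \<omega> + \<beta> * Y \<omega>)"
proof -
  from X obtain s where s: "square_integrable F g" "square_integrable P X" "\<And>j. simple_function borel (s j)"
    "(\<lambda>j. norm2 F (\<lambda>t. g t - s j t)) \<longlonglongrightarrow> 0" "(\<lambda>j. norm2 P (\<lambda>\<omega>. X \<omega> - simple_integral_Z Z (s j) \<omega>)) \<longlonglongrightarrow> 0"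
    by (auto simp: has_stoch_integral_iff)
  from Y obtain s' where s': "square_integrable F h" "square_integrable P Y" "\<And>j. simple_function borel (s' j)"
    "(\<lambda>j. norm2 F (\<lambda>t. h t - s' j t)) \<longlonglongrightarrow> 0" "(\<lambda>j. norm2 P (\<lambda>\<omega>. Y \<omega> - simple_integral_Z Z (s' j) \<omega>)) \<longlonglongrightarrow> 0"
    by (auto simp: has_stoch_integral_iff)
  define r where "r j t = \<alpha> * s j t + \<beta> * s' j t" for j t
  have r: "simple_function borel (r j)" for j
    unfolding r_def by (intro simple_function_add simple_function_mult simple_function_const s s')
  note SS = simple_square_integrable[OF density] and II = simple_integral_square_integrable
  have comb: "norm2 M (\<lambda>x. (\<alpha> * u x + \<beta> * v x) - (\<alpha> * u' x + \<beta> * v' x))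
      \<le> cmod \<alpha> * norm2 M (\<lambda>x. u x - u' x) + cmod \<beta> * norm2 M (\<lambda>x. v x - v' x)"
    if "square_integrable M u" "square_integrable M u'" "square_integrable M v" "square_integrable M v'" for u v u' v' and M :: "'b measure"
  proof -
    have "(\<lambda>x. (\<alpha> * u x + \<beta> * v x) - (\<alpha> * u' x + \<beta> * v' x)) = (\<lambda>x. \<alpha> * (u x - u' x) + \<beta> * (v x - v' x))"
      by (auto simp: algebra_simps)
    then show ?thesis
      using norm2_triangle[OF square_integrable_cmult[OF square_integrable_diff[OF that(1,2)]]
        square_integrable_cmult[OF square_integrable_diff[OF that(3,4)]], of \<alpha> \<beta>] by (simp only: norm2_cmult)
  qed
  have "(\<lambda>j. norm2 F (\<lambda>t. (\<alpha> * g t + \<beta> * h t) - r j t)) \<longlonglongrightarrow> 0"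
  proof (rule Lim_null_comparison)
    show "\<forall>\<^sub>F j in sequentially. norm (norm2 F (\<lambda>t. (\<alpha> * g t + \<beta> * h t) - r j t))
        \<le> cmod \<alpha> * norm2 F (\<lambda>t. g t - s j t) + cmod \<beta> * norm2 F (\<lambda>t. h t - s' j t)"
      using comb[OF s(1) SS[OF s(3)] s'(1) SS[OF s'(3)]] by (simp add: r_def)
    show "(\<lambda>j. cmod \<alpha> * norm2 F (\<lambda>t. g t - s j t) + cmod \<beta> * norm2 F (\<lambda>t. h t - s' j t)) \<longlonglongrightarrow> 0"
      using tendsto_add[OF tendsto_mult_left[OF s(4), of "cmod \<alpha>"] tendsto_mult_left[OF s'(4), of "cmod \<beta>"]] by simp
  qed
  moreover have "(\<lambda>j. norm2 P (\<lambda>\<omega>. (\<alpha> * X \<omega> + \<beta> * Y \<omega>) - simple_integral_Z Z (r j) \<omega>)) \<longlonglongrightarrow> 0"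
  proof (rule Lim_null_comparison)
    have "norm2 P (\<lambda>\<omega>. (\<alpha> * X \<omega> + \<beta> * Y \<omega>) - simple_integral_Z Z (r j) \<omega>)
      = norm2 P (\<lambda>\<omega>. (\<alpha> * X \<omega> + \<beta> * Y \<omega>) - (\<alpha> * simple_integral_Z Z (s j) \<omega> + \<beta> * simple_integral_Z Z (s' j) \<omega>))" for j
    proof (rule norm2_cong_AE)
      show "AE \<omega> in P. (\<alpha> * X \<omega> + \<beta> * Y \<omega>) - simple_integral_Z Z (r j) \<omega>
          = (\<alpha> * X \<omega> + \<beta> * Y \<omega>) - (\<alpha> * simple_integral_Z Z (s j) \<omega> + \<beta> * simple_integral_Z Z (s' j) \<omega>)"
        using simple_integral_linear[OF s(3) s'(3), of \<alpha> j \<beta> j] unfolding r_def[abs_def]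
        by eventually_elim simp
    qed (rule square_integrable_measurable, intro square_integrable_diff square_integrable_add square_integrable_cmult s s' II r)+
    then show "\<forall>\<^sub>F j in sequentially. norm (norm2 P (\<lambda>\<omega>. (\<alpha> * X \<omega> + \<beta> * Y \<omega>) - simple_integral_Z Z (r j) \<omega>))
        \<le> cmod \<alpha> * norm2 P (\<lambda>\<omega>. X \<omega> - simple_integral_Z Z (s j) \<omega>) + cmod \<beta> * norm2 P (\<lambda>\<omega>. Y \<omega> - simple_integral_Z Z (s' j) \<omega>)"
      using comb[OF s(2) II[OF s(3)] s'(2) II[OF s'(3)]] by simp
    show "(\<lambda>j. cmod \<alpha> * norm2 P (\<lambda>\<omega>. X \<omega> - simple_integral_Z Z (s j) \<omega>) + cmod \<beta> * norm2 P (\<lambda>\<omega>. Y \<omega> - simple_integral_Z Z (s' j) \<omega>)) \<longlonglongrightarrow> 0"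
      using tendsto_add[OF tendsto_mult_left[OF s(5), of "cmod \<alpha>"] tendsto_mult_left[OF s'(5), of "cmod \<beta>"]] by simp
  qed
  ultimately show ?thesis
    unfolding has_stoch_integral_iff using r
    by (intro conjI exI[of _ r]) (auto intro!: square_integrable_add square_integrable_cmult s s')
qed

lemma has_stoch_integral_diff_norm2:
  assumes "has_stoch_integral P f Z g X" "has_stoch_integral P f Z h Y"
  shows "norm2 P (\<lambda>\<omega>. X \<omega> - Y \<omega>) = norm2 F (\<lambda>t. g t - h t)"
  using has_stoch_integral_norm2[OF has_stoch_integral_linear[OF assms, of 1 "-1"]] by simp

lemma has_stoch_integral_zero: "has_stoch_integral P f Z (\<lambda>_. 0) (\<lambda>_. 0)"
proof -
  have "simple_integral_Z Z (\<lambda>_. 0) = (\<lambda>_. 0)"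
    by (intro ext, unfold simple_integral_Z_def, rule sum.neutral) auto
  then show ?thesis
    unfolding has_stoch_integral_iff
    by (intro conjI exI[of _ "\<lambda>_ _. 0"]) (simp_all add: norm2_def)
qed

lemma has_stoch_integral_sum:
  "finite A \<Longrightarrow> (\<And>i. i \<in> A \<Longrightarrow> has_stoch_integral P f Z (g i) (X i)) \<Longrightarrow>
    has_stoch_integral P f Z (\<lambda>t. \<Sum>i\<in>A. c i * g i t) (\<lambda>\<omega>. \<Sum>i\<in>A. c i * X i \<omega>)"
proof (induction A rule: finite_induct)
  case empty then show ?case using has_stoch_integral_zero by simp
next
  case (insert i A)
  then show ?case
    using has_stoch_integral_linear[of "g i" "X i" "\<lambda>t. \<Sum>i\<in>A. c i * g i t" "\<lambda>\<omega>. \<Sum>i\<in>A. c i * X i \<omega>" "c i" 1] by simp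
qed

text \<open>Diagonal choice among the approximating simple functions.\<close>

lemma has_stoch_integral_limit:
  assumes X: "\<And>j. has_stoch_integral P f Z (g j) (X j)" and g: "square_integrable F h" "(\<lambda>j. norm2 F (\<lambda>t. h t - g j t)) \<longlonglongrightarrow> 0"
    and Y: "square_integrable P Y" "(\<lambda>j. norm2 P (\<lambda>\<omega>. Y \<omega> - X j \<omega>)) \<longlonglongrightarrow> 0"
  shows "has_stoch_integral P f Z h Y"
proof -
  have ex: "\<forall>j. \<exists>s. simple_function borel s \<and> norm2 F (\<lambda>t. g j t - s t) < 1 / real (Suc j) \<and>
      norm2 P (\<lambda>\<omega>. X j \<omega> - simple_integral_Z Z s \<omega>) < 1 / real (Suc j)"
  proof
    fix j
    from X[of j, unfolded has_stoch_integral_iff] obtain s where s: "\<And>i. simple_function borel (s i)"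
      "(\<lambda>i. norm2 F (\<lambda>t. g j t - s i t)) \<longlonglongrightarrow> 0" "(\<lambda>i. norm2 P (\<lambda>\<omega>. X j \<omega> - simple_integral_Z Z (s i) \<omega>)) \<longlonglongrightarrow> 0"
      by (auto simp: has_stoch_integral_iff)
    have ev: "\<forall>\<^sub>F i in sequentially. norm2 F (\<lambda>t. g j t - s i t) < 1 / real (Suc j) \<and>
      norm2 P (\<lambda>\<omega>. X j \<omega> - simple_integral_Z Z (s i) \<omega>) < 1 / real (Suc j)"
      by (intro eventually_conj order_tendstoD(2)[OF s(2)] order_tendstoD(2)[OF s(3)]) auto
    obtain i where "norm2 F (\<lambda>t. g j t - s i t) < 1 / real (Suc j)"
      "norm2 P (\<lambda>\<omega>. X j \<omega> - simple_integral_Z Z (s i) \<omega>) < 1 / real (Suc j)"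
      using eventually_happens'[OF sequentially_bot ev] by (elim exE conjE)
    then show "\<exists>s. simple_function borel s \<and> norm2 F (\<lambda>t. g j t - s t) < 1 / real (Suc j) \<and>
        norm2 P (\<lambda>\<omega>. X j \<omega> - simple_integral_Z Z s \<omega>) < 1 / real (Suc j)"
      by (intro exI[of _ "s i"] conjI s(1))
  qed
  from choice[OF ex] obtain s where "\<forall>j. simple_function borel (s j) \<and> norm2 F (\<lambda>t. g j t - s j t) < 1 / real (Suc j) \<and>
      norm2 P (\<lambda>\<omega>. X j \<omega> - simple_integral_Z Z (s j) \<omega>) < 1 / real (Suc j)" by (elim exE)
  then have s: "\<And>j. simple_function borel (s j)" "\<And>j. norm2 F (\<lambda>t. g j t - s j t) < 1 / real (Suc j)"
    "\<And>j. norm2 P (\<lambda>\<omega>. X j \<omega> - simple_integral_Z Z (s j) \<omega>) < 1 / real (Suc j)" by simp_all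
  note X' = has_stoch_integral_square_integrable[OF X]
  have lim: "(\<lambda>j. u j + 1 / real (Suc j)) \<longlonglongrightarrow> 0" if "u \<longlonglongrightarrow> 0" for u
    using tendsto_add[OF that LIMSEQ_inverse_real_of_nat] by (simp add: inverse_eq_divide)
  have "(\<lambda>j. norm2 F (\<lambda>t. h t - s j t)) \<longlonglongrightarrow> 0"
  proof (rule Lim_null_comparison[OF _ lim[OF g(2)]], rule always_eventually, rule allI)
    fix j show "norm (norm2 F (\<lambda>t. h t - s j t)) \<le> norm2 F (\<lambda>t. h t - g j t) + 1 / real (Suc j)"
      using norm2_triangle_diff[OF g(1) X'(1) simple_square_integrable[OF density s(1)], of j j] s(2)[of j] by simp
  qed
  moreover have "(\<lambda>j. norm2 P (\<lambda>\<omega>. Y \<omega> - simple_integral_Z Z (s j) \<omega>)) \<longlonglongrightarrow> 0"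
  proof (rule Lim_null_comparison[OF _ lim[OF Y(2)]], rule always_eventually, rule allI)
    fix j show "norm (norm2 P (\<lambda>\<omega>. Y \<omega> - simple_integral_Z Z (s j) \<omega>)) \<le> norm2 P (\<lambda>\<omega>. Y \<omega> - X j \<omega>) + 1 / real (Suc j)"
      using norm2_triangle_diff[OF Y(1) X'(2) simple_integral_square_integrable[OF s(1)], of j j] s(3)[of j] by simp
  qed
  ultimately show ?thesis unfolding has_stoch_integral_iff
    by (intro conjI exI[of _ s] allI s(1) g(1) Y(1))
qed

lemma has_stoch_integral_exists:
  assumes g: "square_integrable F g" shows "\<exists>X. has_stoch_integral P f Z g X"
proof -
  obtain s where s: "\<And>j. simple_function borel (s j)" "(\<lambda>j. norm2 F (\<lambda>t. g t - s j t)) \<longlonglongrightarrow> 0"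
    using simple_functions_dense[OF density g] by blast
  note SS = simple_square_integrable[OF density s(1)]
  have C: "\<exists>N0. \<forall>m\<ge>N0. \<forall>n\<ge>N0. norm2 P (\<lambda>\<omega>. simple_integral_Z Z (s m) \<omega> - simple_integral_Z Z (s n) \<omega>) \<le> e" if e: "e > 0" for e
  proof -
    obtain N0 where N0: "\<And>n. n \<ge> N0 \<Longrightarrow> norm2 F (\<lambda>t. g t - s n t) < e / 2"
      using LIMSEQ_D[OF s(2), of "e / 2"] e by auto
    have "norm2 P (\<lambda>\<omega>. simple_integral_Z Z (s m) \<omega> - simple_integral_Z Z (s n) \<omega>) \<le> e" if "m \<ge> N0" "n \<ge> N0" for m n
      using norm2_triangle_diff[OF SS g SS, of m n] N0[OF that(1)] N0[OF that(2)]
      by (simp add: simple_diff[OF s(1) s(1)] norm2_minus_commute[of F g "s m"])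
    then show ?thesis by blast
  qed
  from norm2_complete[OF simple_integral_square_integrable[OF s(1)] C]
  obtain X where "square_integrable P X" "(\<lambda>N. norm2 P (\<lambda>\<omega>. X \<omega> - simple_integral_Z Z (s N) \<omega>)) \<longlonglongrightarrow> 0" by blast
  then show ?thesis unfolding has_stoch_integral_iff
    by (intro exI[of _ X] conjI exI[of _ s] allI s g)
qed

lemma stoch_integral: "square_integrable F g \<Longrightarrow> has_stoch_integral P f Z g (stoch_integral P f Z g)"
  unfolding stoch_integral_def by (rule someI_ex[OF has_stoch_integral_exists])

end

section \<open>The spectral domain of the past\<close>

lemma cmod_power2_measurable: "g \<in> borel_measurable M \<Longrightarrow> (\<lambda>x. (cmod (g x))\<^sup>2) \<in> borel_measurable M"
  by measurable

lemma norm2_bounded: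
  assumes f: "is_density f" and g: "g \<in> borel_measurable circ" and C: "AE t in circ. cmod (g t) \<le> C" "0 \<le> C"
  shows "square_integrable (spectral_measure f) g"
    and "norm2 (spectral_measure f) g \<le> C * sqrt (measure (spectral_measure f) {-pi..pi})"
proof -
  let ?F = "spectral_measure f"
  note fin = finite_spectral_measure[OF f]
  have gm: "(\<lambda>t. (cmod (g t))\<^sup>2) \<in> borel_measurable ?F"
    using g by (intro cmod_power2_measurable) simp
  have le: "AE t in ?F. (cmod (g t))\<^sup>2 \<le> C\<^sup>2"
    using spectral_measure_AE[OF f C(1)] by eventually_elim (intro power_mono, auto)
  have "AE t in ?F. norm ((cmod (g t))\<^sup>2) \<le> C\<^sup>2" using le by eventually_elim simp
  then have i: "integrable ?F (\<lambda>t. (cmod (g t))\<^sup>2)"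
    by (rule finite_measure.integrable_const_bound[OF fin _ gm])
  then show "square_integrable ?F g" using g by (simp add: square_integrable_def)
  have "(norm2 ?F g)\<^sup>2 \<le> (LINT t|?F. C\<^sup>2)"
    unfolding norm2_power2
    by (rule integral_mono_AE[OF i finite_measure.integrable_const[OF fin] le])
  also have "\<dots> = (C * sqrt (measure ?F {-pi..pi}))\<^sup>2" by (simp add: power_mult_distrib)
  finally show "norm2 ?F g \<le> C * sqrt (measure ?F {-pi..pi})"
    by (rule power2_le_imp_le) (use C in simp)
qed

lemma incr_kernel_measurable: "incr_kernel n m \<in> borel_measurable circ"
proof (rule measurable_restrict_space1)
  have 1: "(\<lambda>t. (1 - cis (- (of_int m * t))) ^ n) \<in> borel_measurable borel"
    "(\<lambda>t. (\<i> * complex_of_real t) ^ n) \<in> borel_measurable borel"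
    by (intro borel_measurable_continuous_onI continuous_intros)+
  from borel_measurable_divide[OF this] show "incr_kernel n m \<in> borel_measurable lborel"
    unfolding incr_kernel_def[abs_def] by simp
qed

lemma incr_kernel_AE_nonzero:
  assumes "\<mu> > 0" shows "AE t in circ. incr_kernel n (int \<mu>) t \<noteq> 0"
proof -
  have "AE t in circ. t \<noteq> 0" by (rule circ_AE_countable[of "{0}"]) auto
  then show ?thesis using circle_log_AE[OF assms]
  proof eventually_elim
    case (elim t)
    have "cmod (1 - cis (- (real \<mu> * t))) = cmod (1 - cis (t * real \<mu>))"
      by (simp add: cmod_one_minus_cis mult.commute)
    then have "1 - cis (- (real \<mu> * t)) \<noteq> 0" using elim by auto
    then show ?case using elim by (simp add: incr_kernel_def)
  qed
qed

lemma incr_kernel_bounded: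
  assumes "\<mu> > 0" obtains C where "C \<ge> 0" "AE t in circ. cmod (incr_kernel n (int \<mu>) t) \<le> C"
proof
  let ?C = "\<Sum>k. norm (w_coeff n \<mu> k)"
  note W = W_fun_wiener[OF assms, of n]
  show "?C \<ge> 0" by (rule suminf_nonneg[OF wiener_summable_norm[OF W]]) simp
  show "AE t in circ. cmod (incr_kernel n (int \<mu>) t) \<le> ?C"
    using W_fun_boundary[OF assms, of n]
  proof eventually_elim
    case (elim t)
    then show ?case using wiener_bound[OF W, of "cis (- t)"] by simp
  qed
qed

lemma wiener_circle_measurable:
  assumes "wiener G y" shows "(\<lambda>t. G (cis t)) \<in> borel_measurable circ" "(\<lambda>t. G (cis (- t))) \<in> borel_measurable circ"
  by (rule borel_measurable_integrable[OF circ_continuous_integrable[OF wiener_circle_continuous(1)[OF assms]]])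
     (rule borel_measurable_integrable[OF circ_continuous_integrable[OF wiener_circle_continuous(2)[OF assms]]])

text \<open>The kernel is essentially bounded, hence square integrable with respect to every spectral measure.\<close>

lemma wiener_times_kernel:
  assumes f: "is_density f" and \<mu>: "\<mu> > 0" and g: "g \<in> borel_measurable circ" "\<And>t. cmod (g t) \<le> B"
  shows "square_integrable (spectral_measure f) (\<lambda>t. g t * incr_kernel n (int \<mu>) t)"
proof -
  obtain C where C: "C \<ge> 0" "AE t in circ. cmod (incr_kernel n (int \<mu>) t) \<le> C"
    by (rule incr_kernel_bounded[OF \<mu>, of n], rule that)
  have B: "B \<ge> 0" using g(2)[of 0] norm_ge_zero order_trans by blast
  show ?thesis
  proof (rule norm2_bounded(1)[OF f])
    show "(\<lambda>t. g t * incr_kernel n (int \<mu>) t) \<in> borel_measurable circ"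
      by (rule borel_measurable_times[OF g(1) incr_kernel_measurable])
    show "AE t in circ. cmod (g t * incr_kernel n (int \<mu>) t) \<le> B * C"
      using C(2) by eventually_elim (unfold norm_mult, intro mult_mono g B norm_ge_zero)
    show "0 \<le> B * C" using B C by simp
  qed
qed

definition past_poly :: "nat \<Rightarrow> nat \<Rightarrow> int set \<Rightarrow> (int \<Rightarrow> complex) \<Rightarrow> real \<Rightarrow> complex" where
  "past_poly n \<mu> K c t = (\<Sum>k\<in>K. c k * (cis (of_int k * t) * incr_kernel n (int \<mu>) t))"

lemma past_poly_factor: "past_poly n \<mu> K c t = (\<Sum>k\<in>K. c k * cis (of_int k * t)) * incr_kernel n (int \<mu>) t"
  by (simp add: past_poly_def sum_distrib_right mult.assoc)

lemma past_poly_square_integrable: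
  assumes f: "is_density f" and \<mu>: "\<mu> > 0"
  shows "square_integrable (spectral_measure f) (past_poly n \<mu> K c)"
  unfolding past_poly_factor[abs_def]
proof (rule wiener_times_kernel[OF f \<mu>])
  have "continuous_on {-pi..pi} (\<lambda>t. \<Sum>k\<in>K. c k * cis (of_int k * t))" by (intro continuous_intros)
  then show "(\<lambda>t. \<Sum>k\<in>K. c k * cis (of_int k * t)) \<in> borel_measurable circ"
    by (rule borel_measurable_integrable[OF circ_continuous_integrable])
  show "cmod (\<Sum>k\<in>K. c k * cis (of_int k * t)) \<le> (\<Sum>k\<in>K. cmod (c k))" for t
    by (rule order_trans[OF norm_sum]) (simp add: norm_mult)
qed

lemma L2_past_iff:
  assumes f: "is_density f" and \<mu>: "\<mu> > 0"
  shows "g \<in> L2_past n \<mu> f \<longleftrightarrow> square_integrable (spectral_measure f) g \<and>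
    (\<forall>\<epsilon>>0. \<exists>K c. finite K \<and> K \<subseteq> {..-1} \<and> norm2 (spectral_measure f) (\<lambda>t. g t - past_poly n \<mu> K c t) < \<epsilon>)"
proof (cases "square_integrable (spectral_measure f) g")
  case True
  have d: "L2_dist2 f g (past_poly n \<mu> K c) = (norm2 (spectral_measure f) (\<lambda>t. g t - past_poly n \<mu> K c t))\<^sup>2" for K c
    using True past_poly_square_integrable[OF f \<mu>, of n K c]
    by (intro L2_dist2_eq[OF f]) (simp_all only: square_integrable_def spectral_measure_measurable)
  have sq: "x\<^sup>2 < \<epsilon> \<longleftrightarrow> x < sqrt \<epsilon>" if "x \<ge> 0" for x \<epsilon> :: real
    using real_sqrt_less_iff[of "x\<^sup>2" \<epsilon>] that by simp
  have "g \<in> L2_past n \<mu> f \<longleftrightarrow> g \<in> L2 f \<and> (\<forall>\<epsilon>>0. \<exists>K c. finite K \<and> K \<subseteq> {..-1} \<and> L2_dist2 f g (past_poly n \<mu> K c) < \<epsilon>)"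
    unfolding L2_past_def past_poly_def[abs_def] by (rule mem_Collect_eq)
  then have "g \<in> L2_past n \<mu> f \<longleftrightarrow> (\<forall>\<epsilon>>0. \<exists>K c. finite K \<and> K \<subseteq> {..-1} \<and> norm2 (spectral_measure f) (\<lambda>t. g t - past_poly n \<mu> K c t) < sqrt \<epsilon>)"
    unfolding d sq[OF norm2_nonneg] L2_iff[OF f] using True by (simp only: simp_thms)
  also have "\<dots> \<longleftrightarrow> (\<forall>\<epsilon>>0. \<exists>K c. finite K \<and> K \<subseteq> {..-1} \<and> norm2 (spectral_measure f) (\<lambda>t. g t - past_poly n \<mu> K c t) < \<epsilon>)"
  proof (intro iffI allI impI)
    fix \<epsilon> :: real assume H: "\<forall>\<epsilon>>0. \<exists>K c. finite K \<and> K \<subseteq> {..-1} \<and> norm2 (spectral_measure f) (\<lambda>t. g t - past_poly n \<mu> K c t) < sqrt \<epsilon>" and "\<epsilon> > 0"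
    from H[rule_format, of "\<epsilon>\<^sup>2"] \<open>\<epsilon> > 0\<close>
    show "\<exists>K c. finite K \<and> K \<subseteq> {..-1} \<and> norm2 (spectral_measure f) (\<lambda>t. g t - past_poly n \<mu> K c t) < \<epsilon>" by simp
  next
    fix \<epsilon> :: real assume H: "\<forall>\<epsilon>>0. \<exists>K c. finite K \<and> K \<subseteq> {..-1} \<and> norm2 (spectral_measure f) (\<lambda>t. g t - past_poly n \<mu> K c t) < \<epsilon>" and "\<epsilon> > 0"
    from H[rule_format, of "sqrt \<epsilon>"] \<open>\<epsilon> > 0\<close>
    show "\<exists>K c. finite K \<and> K \<subseteq> {..-1} \<and> norm2 (spectral_measure f) (\<lambda>t. g t - past_poly n \<mu> K c t) < sqrt \<epsilon>" by simp
  qed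
  finally show ?thesis using True by (simp only: simp_thms)
next
  case False
  then show ?thesis unfolding L2_past_def L2_iff[OF f] by (simp only: mem_Collect_eq simp_thms)
qed

lemma L2_past_closed:
  assumes f: "is_density f" and \<mu>: "\<mu> > 0" and g: "\<And>j::nat. g j \<in> L2_past n \<mu> f"
    and h: "square_integrable (spectral_measure f) h" "(\<lambda>j. norm2 (spectral_measure f) (\<lambda>t. h t - g j t)) \<longlonglongrightarrow> 0"
  shows "h \<in> L2_past n \<mu> f"
  unfolding L2_past_iff[OF f \<mu>]
proof (intro conjI h(1) allI impI)
  fix \<epsilon> :: real assume e: "\<epsilon> > 0"
  obtain j where j: "norm2 (spectral_measure f) (\<lambda>t. h t - g j t) < \<epsilon> / 2"
    using LIMSEQ_D[OF h(2), of "\<epsilon> / 2"] e by auto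
  have "\<epsilon> / 2 > 0" using e by simp
  from g[of j, unfolded L2_past_iff[OF f \<mu>], THEN conjunct2, rule_format, OF this]
  obtain K c where K: "finite K" "K \<subseteq> {..-1}" "norm2 (spectral_measure f) (\<lambda>t. g j t - past_poly n \<mu> K c t) < \<epsilon> / 2"
    by (elim exE conjE)
  have "square_integrable (spectral_measure f) (g j)" using g[of j] L2_past_iff[OF f \<mu>] by simp
  from norm2_triangle_diff[OF h(1) this past_poly_square_integrable[OF f \<mu>, of n K c]]
  have "norm2 (spectral_measure f) (\<lambda>t. h t - past_poly n \<mu> K c t) < \<epsilon>" using j K(3)
    by linarith
  with K(1,2) show "\<exists>K c. finite K \<and> K \<subseteq> {..-1} \<and> norm2 (spectral_measure f) (\<lambda>t. h t - past_poly n \<mu> K c t) < \<epsilon>"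
    by (intro exI[of _ K] exI[of _ c] conjI)
qed

lemma L2_past_cong_AE:
  assumes f: "is_density f" and \<mu>: "\<mu> > 0" and g: "g \<in> L2_past n \<mu> f"
    and h: "h \<in> borel_measurable circ" "AE t in circ. h t = g t"
  shows "h \<in> L2_past n \<mu> f"
proof -
  let ?F = "spectral_measure f"
  have gs: "square_integrable ?F g" using g L2_past_iff[OF f \<mu>] by simp
  then have gm: "g \<in> borel_measurable circ" by (simp add: square_integrable_def)
  have ae: "AE t in ?F. h t = g t" by (rule spectral_measure_AE[OF f h(2)])
  have "integrable ?F (\<lambda>t. (cmod (h t))\<^sup>2) \<longleftrightarrow> integrable ?F (\<lambda>t. (cmod (g t))\<^sup>2)"
  proof (rule integrable_cong_AE)
    show "AE t in ?F. (cmod (h t))\<^sup>2 = (cmod (g t))\<^sup>2" using ae by eventually_elim simp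
    show "(\<lambda>t. (cmod (h t))\<^sup>2) \<in> borel_measurable ?F" "(\<lambda>t. (cmod (g t))\<^sup>2) \<in> borel_measurable ?F"
      unfolding spectral_measure_measurable by (rule cmod_power2_measurable, fact)+
  qed
  then have hs: "square_integrable ?F h"
    using gs h(1) unfolding square_integrable_def spectral_measure_measurable by (simp only: simp_thms)
  have "norm2 ?F (\<lambda>t. h t - g t) = norm2 ?F (\<lambda>t. 0)"
  proof (rule norm2_cong_AE)
    show "AE t in ?F. h t - g t = 0" using ae by eventually_elim simp
    show "(\<lambda>t. h t - g t) \<in> borel_measurable ?F"
      unfolding spectral_measure_measurable by (rule borel_measurable_diff[OF h(1) gm])
    show "(\<lambda>t. 0) \<in> borel_measurable ?F" by (rule borel_measurable_const)
  qed
  then have "norm2 ?F (\<lambda>t. h t - g t) = 0" by (simp add: norm2_def)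
  then have "(\<lambda>j::nat. norm2 ?F (\<lambda>t. h t - g t)) \<longlonglongrightarrow> 0" by simp
  from L2_past_closed[OF f \<mu> g hs this] show ?thesis .
qed

text \<open>The partial sums are finite combinations of past exponentials and converge uniformly.\<close>

lemma L2_past_wiener:
  assumes f: "is_density f" and \<mu>: "\<mu> > 0" and G: "wiener G y" "G 0 = 0"
  shows "(\<lambda>t. G (cis (- t)) * incr_kernel n (int \<mu>) t) \<in> L2_past n \<mu> f"
proof -
  let ?F = "spectral_measure f" and ?K = "incr_kernel n (int \<mu>)"
  obtain C where C: "C \<ge> 0" "AE t in circ. cmod (?K t) \<le> C"
    by (rule incr_kernel_bounded[OF \<mu>, of n], rule that)
  have ys: "summable (\<lambda>k. norm (y k))" by (rule wiener_summable_norm[OF G(1)])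
  have G1: "square_integrable ?F (\<lambda>t. G (cis (- t)) * ?K t)"
    by (rule wiener_times_kernel[OF f \<mu> wiener_circle_measurable(2)[OF G(1)] wiener_bound[OF G(1)]]) simp
  have y0: "y 0 = 0" using wiener_at_0[OF G(1)] G(2) by simp
  define c where "c k = y (nat (- k))" for k :: int
  have part: "(\<Sum>k\<in>{- int m..-1}. c k * cis (of_int k * t)) = (\<Sum>k<Suc m. y k * cis (- t) ^ k)" for m t
  proof -
    have "(\<Sum>k<Suc m. y k * cis (- t) ^ k) = (\<Sum>k\<in>{1..m}. y k * cis (- t) ^ k)"
      by (rule sum.mono_neutral_right) (use y0 in \<open>auto simp: Suc_le_eq\<close>)
    also have "\<dots> = (\<Sum>k\<in>{- int m..-1}. c k * cis (of_int k * t))"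
      by (rule sum.reindex_bij_witness[of _ "\<lambda>k. nat (- k)" "\<lambda>k. - int k"])
         (auto simp: c_def Complex.DeMoivre mult.commute)
    finally show ?thesis by simp
  qed
  have tail: "cmod (G (cis (- t)) - (\<Sum>k<Suc m. y k * cis (- t) ^ k)) \<le> (\<Sum>k. norm (y (k + Suc m)))" for m t
  proof -
    have s: "summable (\<lambda>k. y k * cis (- t) ^ k)" "G (cis (- t)) = (\<Sum>k. y k * cis (- t) ^ k)"
      using wiener_sums[OF G(1), of "cis (- t)"] by (auto simp: sums_iff)
    have "G (cis (- t)) - (\<Sum>k<Suc m. y k * cis (- t) ^ k) = (\<Sum>k. y (k + Suc m) * cis (- t) ^ (k + Suc m))"
      using suminf_split_initial_segment[OF s(1), of "Suc m"] s(2) by simp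
    also have "cmod \<dots> \<le> (\<Sum>k. norm (y (k + Suc m)))"
      by (rule norm_suminf_le[OF _ summable_ignore_initial_segment[OF ys]]) (simp add: norm_mult norm_power)
    finally show ?thesis .
  qed
  have lim: "(\<lambda>m. (\<Sum>k. norm (y (k + Suc m)))) \<longlonglongrightarrow> 0"
    by (rule LIMSEQ_Suc[OF suminf_exist_split2[OF ys]])
  show ?thesis unfolding L2_past_iff[OF f \<mu>]
  proof (intro conjI G1 allI impI)
    fix \<epsilon> :: real assume e: "\<epsilon> > 0"
    have "(\<lambda>m. (\<Sum>k. norm (y (k + Suc m))) * C * sqrt (measure ?F {-pi..pi})) \<longlonglongrightarrow> 0 * C * sqrt (measure ?F {-pi..pi})"
      by (intro tendsto_intros lim)
    then have lim0: "(\<lambda>m. (\<Sum>k. norm (y (k + Suc m))) * C * sqrt (measure ?F {-pi..pi})) \<longlonglongrightarrow> 0" by simp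
    from eventually_happens'[OF sequentially_bot order_tendstoD(2)[OF lim0 e]]
    obtain m where m: "(\<Sum>k. norm (y (k + Suc m))) * C * sqrt (measure ?F {-pi..pi}) < \<epsilon>" by (elim exE)
    have \<sigma>: "0 \<le> (\<Sum>k. norm (y (k + Suc m)))"
      by (rule suminf_nonneg[OF summable_ignore_initial_segment[OF ys]]) simp
    let ?p = "past_poly n \<mu> {- int m..-1} c"
    have "norm2 ?F (\<lambda>t. G (cis (- t)) * ?K t - ?p t) \<le> (\<Sum>k. norm (y (k + Suc m))) * C * sqrt (measure ?F {-pi..pi})"
    proof (rule norm2_bounded(2)[OF f])
      show "(\<lambda>t. G (cis (- t)) * ?K t - ?p t) \<in> borel_measurable circ"
        using square_integrable_diff[OF G1 past_poly_square_integrable[OF f \<mu>]] by (simp add: square_integrable_def)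
      show "AE t in circ. cmod (G (cis (- t)) * ?K t - ?p t) \<le> (\<Sum>k. norm (y (k + Suc m))) * C"
        using C(2)
      proof eventually_elim
        case (elim t)
        have "G (cis (- t)) * ?K t - ?p t = (G (cis (- t)) - (\<Sum>k<Suc m. y k * cis (- t) ^ k)) * ?K t"
          unfolding past_poly_factor part by (simp only: left_diff_distrib)
        then have "cmod (G (cis (- t)) * ?K t - ?p t) = cmod (G (cis (- t)) - (\<Sum>k<Suc m. y k * cis (- t) ^ k)) * cmod (?K t)"
          by (simp only: norm_mult)
        also have "\<dots> \<le> (\<Sum>k. norm (y (k + Suc m))) * C"
          by (rule mult_mono[OF tail elim \<sigma> norm_ge_zero])
        finally show ?case .
      qed
      show "0 \<le> (\<Sum>k. norm (y (k + Suc m))) * C"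
        by (rule mult_nonneg_nonneg[OF \<sigma> C(1)])
    qed
    with m have "norm2 ?F (\<lambda>t. G (cis (- t)) * ?K t - ?p t) < \<epsilon>" by simp
    then show "\<exists>K c. finite K \<and> K \<subseteq> {..-1} \<and> norm2 ?F (\<lambda>t. G (cis (- t)) * ?K t - past_poly n \<mu> K c t) < \<epsilon>"
      by (intro exI[of _ "{- int m..-1}"] exI[of _ c]) auto
  qed
qed

text \<open>Dividing by the outer function keeps a past function in the past although \<open>W\<close> may have zeros on the circle: the
  reciprocals of \<open>z \<mapsto> W (r * z)\<close> are power series, and as \<open>r\<close> tends to \<open>1\<close> the quotients \<open>W z / W (r * z)\<close> stay
  bounded and tend to \<open>1\<close> almost everywhere.\<close>

lemma L2_past_quotient:
  assumes f: "is_density f" and \<mu>: "\<mu> > 0" and X: "wiener X x" "X 0 = 0"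
  shows "(\<lambda>t. X (cis (- t)) / W_fun n \<mu> (cis (- t)) * incr_kernel n (int \<mu>) t) \<in> L2_past n \<mu> f"
proof -
  let ?F = "spectral_measure f" and ?K = "incr_kernel n (int \<mu>)" and ?W = "W_fun n \<mu>"
  note W = W_fun_wiener[OF \<mu>, of n]
  obtain C where C: "\<And>z r. norm z \<le> 1 \<Longrightarrow> 0 < r \<Longrightarrow> r < 1 \<Longrightarrow> cmod (?W z) \<le> C * cmod (?W (of_real r * z))"
    using W_fun_radial[OF \<mu>, of n] by blast
  have "\<forall>j. \<exists>G g. wiener G g \<and> (\<forall>z. norm z \<le> 1 \<longrightarrow> G z * ?W (of_real (rad j) * z) = 1)"
    by (intro allI W_fun_inverse[OF \<mu>] rad)
  from choice[OF this] obtain G where "\<forall>j. \<exists>g. wiener (G j) g \<and> (\<forall>z. norm z \<le> 1 \<longrightarrow> G j z * ?W (of_real (rad j) * z) = 1)"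
    by (elim exE)
  from choice[OF this] obtain g where Gg: "\<forall>j. wiener (G j) (g j) \<and> (\<forall>z. norm z \<le> 1 \<longrightarrow> G j z * ?W (of_real (rad j) * z) = 1)"
    by (elim exE)
  then have G: "\<And>j. wiener (G j) (g j)" "\<And>j z. norm z \<le> 1 \<Longrightarrow> G j z * ?W (of_real (rad j) * z) = 1"
    by simp_all
  let ?h = "\<lambda>t. X (cis (- t)) / ?W (cis (- t)) * ?K t"
  let ?g = "\<lambda>j t. X (cis (- t)) * G j (cis (- t)) * ?K t"
  note XG = wiener_mult[OF X(1) G(1)]
  have past: "?g j \<in> L2_past n \<mu> f" for j
    by (rule L2_past_wiener[OF f \<mu> XG]) (simp add: X)
  have gs: "square_integrable ?F (?g j)" for j using past L2_past_iff[OF f \<mu>] by simp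
  have gm: "?g j \<in> borel_measurable circ" for j using gs[of j] by (simp add: square_integrable_def)
  have hm: "?h \<in> borel_measurable circ"
    by (intro borel_measurable_times borel_measurable_divide wiener_circle_measurable(2)[OF X(1)] wiener_circle_measurable(2)[OF W] incr_kernel_measurable)
  define B where "B = (\<Sum>k. norm (x k))"
  have B: "cmod (X (cis (- t))) \<le> B" for t unfolding B_def by (rule wiener_bound[OF X(1)]) simp
  have B0: "B \<ge> 0" using B[of 0] norm_ge_zero order_trans by blast
  have hs: "square_integrable ?F ?h"
  proof (rule norm2_bounded(1)[OF f hm _ B0])
    show "AE t in circ. cmod (?h t) \<le> B"
      using W_fun_boundary[OF \<mu>, of n] incr_kernel_AE_nonzero[OF \<mu>, of n]
      by eventually_elim (use B in \<open>simp add: norm_mult norm_divide\<close>)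
  qed
  have C0: "C \<ge> 0"
  proof (rule ccontr)
    assume "\<not> C \<ge> 0"
    have "?W (of_real (1/2) * 0) \<noteq> 0" using G(2)[of 0 0] by auto
    then have "C * cmod (?W (of_real (1/2) * 0)) < 0" using \<open>\<not> C \<ge> 0\<close> by (simp add: mult_neg_pos)
    with C[of 0 "1/2"] show False using norm_ge_zero[of "?W 0"] by simp
  qed
  have diff: "AE t in circ. \<forall>j. cmod (?h t - ?g j t) \<le> B * (1 + C)"
    and lim: "AE t in circ. (\<lambda>j. ?h t - ?g j t) \<longlonglongrightarrow> 0"
  proof -
    have "AE t in circ. (\<forall>j. cmod (?h t - ?g j t) \<le> B * (1 + C)) \<and> (\<lambda>j. ?h t - ?g j t) \<longlonglongrightarrow> 0"
      using W_fun_boundary[OF \<mu>, of n] incr_kernel_AE_nonzero[OF \<mu>, of n]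
    proof eventually_elim
      case (elim t)
      define z where "z = cis (- t)"
      have z: "norm z = 1" by (simp add: z_def)
      have Wz: "?W z \<noteq> 0" "cmod (?W z) = cmod (?K t)" using elim by (auto simp: z_def)
      have Wr: "?W (of_real (rad j) * z) \<noteq> 0" for j using G(2)[of z j] z by auto
      have Gz: "G j z = 1 / ?W (of_real (rad j) * z)" for j using G(2)[of z j] z Wr[of j] by (simp add: field_simps)
      have eq: "?h t - ?g j t = X z * (?K t / ?W z) * (1 - ?W z / ?W (of_real (rad j) * z))" for j
        unfolding z_def[symmetric] Gz using Wz(1) Wr[of j] by (simp add: field_simps)
      have u: "cmod (?K t / ?W z) = 1" using Wz elim by (simp add: norm_divide)
      show ?case
      proof
        show "\<forall>j. cmod (?h t - ?g j t) \<le> B * (1 + C)"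
        proof
          fix j
          have "cmod (?W z / ?W (of_real (rad j) * z)) \<le> C"
            using C[of z "rad j"] rad[of j] z Wr[of j] by (simp add: norm_divide field_simps)
          then have "cmod (1 - ?W z / ?W (of_real (rad j) * z)) \<le> 1 + C"
            using norm_triangle_ineq4[of 1 "?W z / ?W (of_real (rad j) * z)"] by simp
          then show "cmod (?h t - ?g j t) \<le> B * (1 + C)"
            unfolding eq norm_mult u using B[of t] B0 by (simp only: mult_1_right z_def) (intro mult_mono, auto)
        qed
        have "(\<lambda>j. ?W (of_real (rad j) * z)) \<longlonglongrightarrow> ?W z"
        proof (rule continuous_on_tendsto_compose[OF wiener_continuous_on[OF W]])
          have "(\<lambda>j. of_real (rad j) * z) \<longlonglongrightarrow> of_real 1 * z" by (intro tendsto_intros rad_tendsto)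
          then show "(\<lambda>j. of_real (rad j) * z) \<longlonglongrightarrow> z" by simp
          show "z \<in> cball 0 1" using z by simp
          show "\<forall>\<^sub>F j in sequentially. of_real (rad j) * z \<in> cball 0 1"
            using z rad by (intro always_eventually allI) (simp add: norm_mult less_imp_le abs_of_pos)
        qed
        then have "(\<lambda>j. X z * (?K t / ?W z) * (1 - ?W z / ?W (of_real (rad j) * z))) \<longlonglongrightarrow> X z * (?K t / ?W z) * (1 - ?W z / ?W z)"
          by (intro tendsto_intros Wz)
        then show "(\<lambda>j. ?h t - ?g j t) \<longlonglongrightarrow> 0" unfolding eq using Wz by simp
      qed
    qed
    then show "AE t in circ. \<forall>j. cmod (?h t - ?g j t) \<le> B * (1 + C)"
      "AE t in circ. (\<lambda>j. ?h t - ?g j t) \<longlonglongrightarrow> 0"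
      by (auto elim: eventually_mono)
  qed
  have "(\<lambda>j. LINT t|?F. (cmod (?h t - ?g j t))\<^sup>2) \<longlonglongrightarrow> (LINT t|?F. 0)"
  proof (rule integral_dominated_convergence[where w = "\<lambda>t. (B * (1 + C))\<^sup>2"])
    show "integrable ?F (\<lambda>t. (B * (1 + C))\<^sup>2)" by (rule finite_measure.integrable_const[OF finite_spectral_measure[OF f]])
    show "AE t in ?F. (\<lambda>j. (cmod (?h t - ?g j t))\<^sup>2) \<longlonglongrightarrow> 0"
      using spectral_measure_AE[OF f lim]
    proof eventually_elim
      case (elim t)
      then have "(\<lambda>j. (cmod (?h t - ?g j t))\<^sup>2) \<longlonglongrightarrow> (cmod 0)\<^sup>2" by (intro tendsto_intros)
      then show ?case by simp
    qed
    show "AE t in ?F. norm ((cmod (?h t - ?g j t))\<^sup>2) \<le> (B * (1 + C))\<^sup>2" for j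
      using spectral_measure_AE[OF f diff] by eventually_elim (simp add: power_mono)
    show "(\<lambda>t. (cmod (?h t - ?g j t))\<^sup>2) \<in> borel_measurable ?F" for j
      using borel_measurable_diff[OF hm gm[of j]] by (intro cmod_power2_measurable) simp
  qed simp
  then have "(\<lambda>j. norm2 ?F (\<lambda>t. ?h t - ?g j t)) \<longlonglongrightarrow> 0"
    unfolding norm2_def using tendsto_real_sqrt[of _ 0] by fastforce
  then show ?thesis by (rule L2_past_closed[OF f \<mu> past hs])
qed

section \<open>The mean square error of the optimal estimate\<close>

lemma past_poly_midpoint:
  assumes "finite K" "finite K'"
  shows "(past_poly n \<mu> K c t + past_poly n \<mu> K' c' t) / 2
    = past_poly n \<mu> (K \<union> K') (\<lambda>k. ((if k \<in> K then c k else 0) + (if k \<in> K' then c' k else 0)) / 2) t"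
proof -
  let ?e = "\<lambda>k. cis (of_int k * t) * incr_kernel n (int \<mu>) t"
  have 1: "past_poly n \<mu> K c t = (\<Sum>k\<in>K \<union> K'. (if k \<in> K then c k else 0) * ?e k)"
    unfolding past_poly_def by (rule sum.mono_neutral_cong_left) (use assms in auto)
  have 2: "past_poly n \<mu> K' c' t = (\<Sum>k\<in>K \<union> K'. (if k \<in> K' then c' k else 0) * ?e k)"
    unfolding past_poly_def by (rule sum.mono_neutral_cong_left) (use assms in auto)
  show ?thesis unfolding 1 2 unfolding past_poly_def sum.distrib[symmetric] sum_divide_distrib
    by (intro sum.cong refl) (simp add: ring_distribs add_divide_distrib)
qed

lemma L2_past_midpoint:
  assumes f: "is_density f" and \<mu>: "\<mu> > 0" and g: "g \<in> L2_past n \<mu> f" and h: "h \<in> L2_past n \<mu> f"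
  shows "(\<lambda>t. (g t + h t) / 2) \<in> L2_past n \<mu> f"
proof -
  let ?F = "spectral_measure f"
  have gs: "square_integrable ?F g" and hs: "square_integrable ?F h" using g h L2_past_iff[OF f \<mu>] by auto
  note pp = past_poly_square_integrable[OF f \<mu>, of n]
  have half: "(\<lambda>t. u t / 2) = (\<lambda>t. (1/2) * u t)" for u :: "real \<Rightarrow> complex" by auto
  show ?thesis unfolding L2_past_iff[OF f \<mu>]
  proof (intro conjI allI impI)
    show "square_integrable ?F (\<lambda>t. (g t + h t) / 2)"
      unfolding half by (intro square_integrable_cmult square_integrable_add gs hs)
    fix \<epsilon> :: real assume e: "\<epsilon> > 0"
    from g[unfolded L2_past_iff[OF f \<mu>], THEN conjunct2, rule_format, OF e]
    obtain K c where K: "finite K" "K \<subseteq> {..-1}" "norm2 ?F (\<lambda>t. g t - past_poly n \<mu> K c t) < \<epsilon>" by (elim exE conjE)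
    from h[unfolded L2_past_iff[OF f \<mu>], THEN conjunct2, rule_format, OF e]
    obtain K' c' where K': "finite K'" "K' \<subseteq> {..-1}" "norm2 ?F (\<lambda>t. h t - past_poly n \<mu> K' c' t) < \<epsilon>" by (elim exE conjE)
    define d where "d k = ((if k \<in> K then c k else 0) + (if k \<in> K' then c' k else 0)) / 2" for k
    have eq: "(\<lambda>t. (g t + h t) / 2 - past_poly n \<mu> (K \<union> K') d t)
        = (\<lambda>t. (1/2) * ((g t - past_poly n \<mu> K c t) + (h t - past_poly n \<mu> K' c' t)))"
      using past_poly_midpoint[OF K(1) K'(1), of n \<mu> c _ c'] unfolding d_def[symmetric, abs_def]
      by (intro ext) (simp add: field_simps)
    have "norm2 ?F (\<lambda>t. (g t + h t) / 2 - past_poly n \<mu> (K \<union> K') d t)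
        \<le> 1/2 * (norm2 ?F (\<lambda>t. g t - past_poly n \<mu> K c t) + norm2 ?F (\<lambda>t. h t - past_poly n \<mu> K' c' t))"
      unfolding eq norm2_cmult
      using norm2_triangle[OF square_integrable_diff[OF gs pp[of K c]] square_integrable_diff[OF hs pp[of K' c']]] by simp
    also have "\<dots> < \<epsilon>" using K(3) K'(3) by simp
    finally show "\<exists>K c. finite K \<and> K \<subseteq> {..-1} \<and> norm2 ?F (\<lambda>t. (g t + h t) / 2 - past_poly n \<mu> K c t) < \<epsilon>"
      using K(1,2) K'(1,2) by (intro exI[of _ "K \<union> K'"] exI[of _ d] conjI finite_UnI Un_least)
  qed
qed

lemma norm2_parallelogram:
  assumes g: "square_integrable M g" and h: "square_integrable M h"
  shows "(norm2 M (\<lambda>x. g x - h x))\<^sup>2 = 2 * (norm2 M g)\<^sup>2 + 2 * (norm2 M h)\<^sup>2 - 4 * (norm2 M (\<lambda>x. (1/2) * (g x + h x)))\<^sup>2"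
proof -
  note i = square_integrable_integrable
  have "(norm2 M (\<lambda>x. g x - h x))\<^sup>2 + (norm2 M (\<lambda>x. g x + h x))\<^sup>2
      = (LINT x|M. (cmod (g x - h x))\<^sup>2 + (cmod (g x + h x))\<^sup>2)"
    unfolding norm2_power2
    by (rule Bochner_Integration.integral_add[symmetric])
       (rule i[OF square_integrable_diff[OF g h]], rule i[OF square_integrable_add[OF g h]])
  also have "\<dots> = (LINT x|M. 2 * (cmod (g x))\<^sup>2 + 2 * (cmod (h x))\<^sup>2)"
    by (intro Bochner_Integration.integral_cong refl) (simp only: cmod_power2, simp add: power2_eq_square algebra_simps)
  also have "\<dots> = 2 * (norm2 M g)\<^sup>2 + 2 * (norm2 M h)\<^sup>2"
    unfolding norm2_power2 using i[OF g] i[OF h] by simp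
  finally show ?thesis unfolding norm2_cmult by (simp add: power_mult_distrib power_divide)
qed

text \<open>The past is closed and contains the midpoints of its elements, so by the parallelogram law every minimizing
  sequence is a Cauchy sequence.\<close>

lemma L2_past_projection:
  assumes f: "is_density f" and \<mu>: "\<mu> > 0" and x: "square_integrable (spectral_measure f) x"
  shows "\<exists>g\<in>L2_past n \<mu> f. \<forall>h\<in>L2_past n \<mu> f.
    norm2 (spectral_measure f) (\<lambda>t. x t - g t) \<le> norm2 (spectral_measure f) (\<lambda>t. x t - h t)"
proof -
  let ?F = "spectral_measure f" and ?L = "L2_past n \<mu> f"
  let ?d = "\<lambda>g. norm2 ?F (\<lambda>t. x t - g t)"
  have Ls: "g \<in> ?L \<Longrightarrow> square_integrable ?F g" for g using L2_past_iff[OF f \<mu>] by simp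
  have "(\<lambda>t. (\<lambda>z. 0) (cis (- t)) * incr_kernel n (int \<mu>) t) \<in> ?L"
    using L2_past_wiener[OF f \<mu> wiener_const[of 0]] by simp
  then have ne: "?L \<noteq> {}" by blast
  define D where "D = (INF g\<in>?L. ?d g)"
  have bdd: "bdd_below (?d ` ?L)" by (rule bdd_belowI[of _ 0]) auto
  have Dle: "D \<le> ?d g" if "g \<in> ?L" for g unfolding D_def by (rule cINF_lower[OF bdd that])
  have D0: "D \<ge> 0" unfolding D_def by (rule cINF_greatest[OF ne]) simp
  have "\<forall>j. \<exists>g. g \<in> ?L \<and> ?d g < D + 1 / real (Suc j)"
  proof
    fix j
    have "D < D + 1 / real (Suc j)" by simp
    then have "\<exists>g\<in>?L. ?d g < D + 1 / real (Suc j)"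
      unfolding D_def by (subst (asm) cINF_less_iff[OF ne bdd])
    then show "\<exists>g. g \<in> ?L \<and> ?d g < D + 1 / real (Suc j)" unfolding Bex_def .
  qed
  from choice[OF this] obtain g where "\<forall>j. g j \<in> ?L \<and> ?d (g j) < D + 1 / real (Suc j)" by (elim exE)
  then have g: "\<And>j. g j \<in> ?L" "\<And>j. ?d (g j) < D + 1 / real (Suc j)" by simp_all
  have near: "(norm2 ?F (\<lambda>t. g i t - g j t))\<^sup>2 \<le> 8 * (2 * D + 1) / real (Suc m)" if "i \<ge> m" "j \<ge> m" for i j m
  proof -
    have b: "(?d (g i))\<^sup>2 \<le> D\<^sup>2 + (2 * D + 1) / real (Suc m)" if "i \<ge> m" for i
    proof -
      have "1 / real (Suc i) \<le> 1 / real (Suc m)" using that by (simp add: frac_le)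
      then have "?d (g i) \<le> D + 1 / real (Suc m)" using g(2)[of i] by simp
      then have "(?d (g i))\<^sup>2 \<le> (D + 1 / real (Suc m))\<^sup>2" by (rule power_mono) simp
      also have "\<dots> = D\<^sup>2 + 2 * D / real (Suc m) + (1 / real (Suc m)) * (1 / real (Suc m))"
        by (simp add: power2_eq_square algebra_simps add_divide_distrib)
      also have "(1 / real (Suc m)) * (1 / real (Suc m)) \<le> (1 / real (Suc m)) * 1"
        by (rule mult_left_mono) auto
      finally show ?thesis by (simp add: add_divide_distrib)
    qed
    have "(norm2 ?F (\<lambda>t. g j t - g i t))\<^sup>2 = (norm2 ?F (\<lambda>t. (x t - g i t) - (x t - g j t)))\<^sup>2" by simp
    also have "\<dots> = 2 * (?d (g i))\<^sup>2 + 2 * (?d (g j))\<^sup>2 - 4 * (norm2 ?F (\<lambda>t. (1/2) * ((x t - g i t) + (x t - g j t))))\<^sup>2"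
      by (rule norm2_parallelogram) (intro square_integrable_diff x Ls g)+
    also have "(\<lambda>t. (1/2) * ((x t - g i t) + (x t - g j t))) = (\<lambda>t. x t - (g i t + g j t) / 2)"
      by (auto simp: field_simps)
    also have "2 * (?d (g i))\<^sup>2 + 2 * (?d (g j))\<^sup>2 - 4 * (norm2 ?F (\<lambda>t. x t - (g i t + g j t) / 2))\<^sup>2
        \<le> 2 * (D\<^sup>2 + (2 * D + 1) / real (Suc m)) + 2 * (D\<^sup>2 + (2 * D + 1) / real (Suc m)) - 4 * D\<^sup>2"
      by (intro diff_mono add_mono mult_left_mono b that power_mono D0 Dle[OF L2_past_midpoint[OF f \<mu> g(1) g(1)]]) auto
    also have "\<dots> = 4 * ((2 * D + 1) / real (Suc m))" by simp
    also have "\<dots> \<le> 8 * (2 * D + 1) / real (Suc m)" using D0 by (simp add: field_simps)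
    finally show ?thesis by (simp add: norm2_minus_commute[of ?F "g i"])
  qed
  have C: "\<exists>N0. \<forall>i\<ge>N0. \<forall>j\<ge>N0. norm2 ?F (\<lambda>t. g i t - g j t) \<le> e" if e: "e > 0" for e
  proof -
    obtain m where m: "8 * (2 * D + 1) / e\<^sup>2 < real m" using reals_Archimedean2 by blast
    have le: "8 * (2 * D + 1) / real (Suc m) \<le> e\<^sup>2"
    proof -
      have "8 * (2 * D + 1) < real m * e\<^sup>2" using m e by (simp add: pos_divide_less_eq)
      also have "\<dots> \<le> e\<^sup>2 * real (Suc m)" by (simp add: algebra_simps)
      finally show ?thesis by (simp add: pos_divide_le_eq)
    qed
    have "norm2 ?F (\<lambda>t. g i t - g j t) \<le> e" if "i \<ge> m" "j \<ge> m" for i j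
      by (rule power2_le_imp_le[OF order_trans[OF near[OF that] le]]) (use e in simp)
    then show ?thesis by (intro exI[of _ m] allI impI)
  qed
  have "\<exists>h. square_integrable ?F h \<and> (\<lambda>N. norm2 ?F (\<lambda>t. h t - g N t)) \<longlonglongrightarrow> 0"
    by (rule finite_measure.norm2_complete[OF finite_spectral_measure[OF f] Ls[OF g(1)]]) (rule C)
  then obtain h where h: "square_integrable ?F h" "(\<lambda>N. norm2 ?F (\<lambda>t. h t - g N t)) \<longlonglongrightarrow> 0" by (elim exE conjE)
  have hL: "h \<in> ?L" by (rule L2_past_closed[OF f \<mu> g(1) h])
  have "?d h \<le> D"
  proof (rule LIMSEQ_le_const)
    have "(\<lambda>N. D + inverse (real (Suc N)) + norm2 ?F (\<lambda>t. h t - g N t)) \<longlonglongrightarrow> D + 0 + 0"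
      by (intro tendsto_intros LIMSEQ_inverse_real_of_nat h(2))
    then show "(\<lambda>N. D + inverse (real (Suc N)) + norm2 ?F (\<lambda>t. h t - g N t)) \<longlonglongrightarrow> D" by simp
    have "?d h \<le> D + inverse (real (Suc N)) + norm2 ?F (\<lambda>t. h t - g N t)" for N
      using norm2_triangle_diff[OF x Ls[OF g(1)] h(1), of N] g(2)[of N]
      by (simp add: norm2_minus_commute[of ?F h] inverse_eq_divide)
    then show "\<exists>N. \<forall>n\<ge>N. ?d h \<le> D + inverse (real (Suc n)) + norm2 ?F (\<lambda>t. h t - g n t)" by (intro exI allI impI)
  qed
  then show ?thesis by (intro bexI[OF _ hL] ballI) (rule order_trans[OF _ Dle])
qed

locale extrapolation =
  fixes n \<mu> :: nat and a :: "nat \<Rightarrow> complex"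
  assumes mu: "\<mu> > 0" and coeff: "coeff_condition n \<mu> a"
begin

abbreviation "K \<equiv> incr_kernel n (int \<mu>)"

definition b_fun :: "complex \<Rightarrow> complex" where "b_fun z = (\<Sum>k. b_seq n \<mu> a k * z ^ k)"

lemma b_fun_wiener: "wiener b_fun (b_seq n \<mu> a)"
  using coeff by (simp add: coeff_condition_def wiener_def b_fun_def[abs_def])

definition target :: "real \<Rightarrow> complex" where "target t = b_fun (cis t) * K t"

lemma target_square_integrable: "is_density f \<Longrightarrow> square_integrable (spectral_measure f) target"
  unfolding target_def[abs_def]
  by (rule wiener_times_kernel[OF _ mu wiener_circle_measurable(1)[OF b_fun_wiener] wiener_bound[OF b_fun_wiener]]) simp_all

text \<open>The functional \<open>B\<xi>\<close> is defined pointwise by a series, which converges almost surely because its terms are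
  absolutely summable in \<open>L\<^sub>1\<close>. It converges to the same limit in mean square, which the isometry transports to the
  spectral domain.\<close>

lemma B_fun_stoch_integral:
  assumes "has_spectral_density n P \<xi> Z f" "stationary_increments n P \<xi>"
  shows "has_stoch_integral P f Z target (B_fun n \<mu> a \<xi>)"
proof -
  have d: "is_density f" and o: "orthogonal_measure P f Z" and ps: "prob_space P"
    using assms by (auto simp: has_spectral_density_def stationary_increments_def)
  interpret S: stochastic_measure P f Z
    using ps d o by (simp add: stochastic_measure_def stochastic_measure_axioms_def)
  let ?F = "spectral_measure f"
  let ?X = "\<lambda>k. incr n \<xi> (int k) (int \<mu>)"
  let ?b = "b_seq n \<mu> a"
  have X: "has_stoch_integral P f Z (\<lambda>t. cis (of_int (int k) * t) * K t) (?X k)" for k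
    by (rule conjunct2[OF conjunct2[OF assms(1)[unfolded has_spectral_density_def]], THEN spec, THEN spec, THEN mp])
      (use mu in simp)
  have bs: "summable (\<lambda>k. norm (?b k))" by (rule wiener_summable_norm[OF b_fun_wiener])
  note Xs = S.has_stoch_integral_square_integrable(2)[OF X]
  have Xn: "norm2 P (?X k) = norm2 ?F K" for k
  proof -
    have "norm2 P (?X k) = norm2 ?F (\<lambda>t. cis (of_int (int k) * t) * K t)" by (rule S.has_stoch_integral_norm2[OF X])
    also have "\<dots> = norm2 ?F K" unfolding norm2_def by (simp add: norm_mult)
    finally show ?thesis .
  qed
  define c where "c = norm2 ?F K + 1"
  have c: "c > 0" "norm2 P (?X k) \<le> c" for k
    unfolding c_def Xn using norm2_nonneg[of ?F K] by (simp_all add: add_nonneg_pos)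
  note XL = S.integral_norm_le_norm2[OF Xs c(2) c(1)]
  let ?Y = "\<lambda>N \<omega>. \<Sum>k<N. ?b k * ?X k \<omega>" and ?g = "\<lambda>N t. \<Sum>k<N. ?b k * (cis (of_int (int k) * t) * K t)"
  have Y: "has_stoch_integral P f Z (?g N) (?Y N)" for N
    by (rule S.has_stoch_integral_sum[OF finite_lessThan X])
  note Ys = S.has_stoch_integral_square_integrable(2)[OF Y]
  have ae: "AE \<omega> in P. summable (\<lambda>k. norm (?b k * ?X k \<omega>))"
  proof (rule AE_summable_norm)
    show "integrable P (\<lambda>\<omega>. ?b k * ?X k \<omega>)" for k by (rule integrable_mult_right) (rule XL(1))
    have "(LINT \<omega>|P. norm (?b k * ?X k \<omega>)) \<le> norm (?b k) * (c * 2)" for k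
      using XL(2)[of k] S.prob_space by (simp add: norm_mult mult_left_mono)
    then show "summable (\<lambda>k. LINT \<omega>|P. norm (?b k * ?X k \<omega>))"
      by (intro summable_comparison_test[OF _ summable_mult2[OF bs, of "c * 2"]]) auto
  qed
  have lim: "AE \<omega> in P. (\<lambda>N. ?Y N \<omega>) \<longlonglongrightarrow> B_fun n \<mu> a \<xi> \<omega>"
    using ae by eventually_elim (unfold B_fun_def, rule summable_LIMSEQ, rule summable_norm_cancel)
  have glim: "(\<lambda>N. norm2 ?F (\<lambda>t. target t - ?g N t)) \<longlonglongrightarrow> 0"
  proof (rule Lim_null_comparison)
    have tail: "(\<lambda>N. (\<Sum>k. norm (?b (k + N)))) \<longlonglongrightarrow> 0" by (rule suminf_exist_split2[OF bs])
    have "(\<lambda>N. (\<Sum>k. norm (?b (k + N))) * norm2 ?F K) \<longlonglongrightarrow> 0 * norm2 ?F K"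
      by (intro tendsto_intros tail)
    then show "(\<lambda>N. (\<Sum>k. norm (?b (k + N))) * norm2 ?F K) \<longlonglongrightarrow> 0" by simp
    have "norm2 ?F (\<lambda>t. target t - ?g N t) \<le> (\<Sum>k. norm (?b (k + N))) * norm2 ?F K" for N
    proof -
      define \<tau> where "\<tau> = (\<Sum>k. norm (?b (k + N)))"
      have \<tau>0: "\<tau> \<ge> 0" unfolding \<tau>_def by (rule suminf_nonneg[OF summable_ignore_initial_segment[OF bs]]) simp
      have le: "cmod (target t - ?g N t) \<le> \<tau> * cmod (K t)" for t
      proof -
        have cs: "cis (of_int (int k) * t) = cis t ^ k" for k by (simp add: Complex.DeMoivre)
        have s: "summable (\<lambda>k. ?b k * cis t ^ k)" "b_fun (cis t) = (\<Sum>k. ?b k * cis t ^ k)"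
          using wiener_sums[OF b_fun_wiener, of "cis t"] by (auto simp: sums_iff)
        have "target t - ?g N t = (b_fun (cis t) - (\<Sum>k<N. ?b k * cis t ^ k)) * K t"
          unfolding target_def cs by (simp only: sum_distrib_right left_diff_distrib mult.assoc)
        also have "b_fun (cis t) - (\<Sum>k<N. ?b k * cis t ^ k) = (\<Sum>k. ?b (k + N) * cis t ^ (k + N))"
          using suminf_split_initial_segment[OF s(1), of N] s(2) by simp
        finally have e: "target t - ?g N t = (\<Sum>k. ?b (k + N) * cis t ^ (k + N)) * K t" .
        have "cmod (\<Sum>k. ?b (k + N) * cis t ^ (k + N)) \<le> \<tau>"
          unfolding \<tau>_def by (rule norm_suminf_le[OF _ summable_ignore_initial_segment[OF bs]]) (simp add: norm_mult norm_power)
        then show ?thesis unfolding e norm_mult by (rule mult_right_mono) simp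
      qed
      have Ks: "square_integrable ?F (\<lambda>t. of_real \<tau> * K t)"
        using square_integrable_cmult[OF wiener_times_kernel[OF d mu, of "\<lambda>_. 1" 1 n]] by simp
      have ts: "square_integrable ?F (\<lambda>t. target t - ?g N t)"
        by (rule square_integrable_diff[OF target_square_integrable[OF d] S.has_stoch_integral_square_integrable(1)[OF Y]])
      have "(norm2 ?F (\<lambda>t. target t - ?g N t))\<^sup>2 \<le> (norm2 ?F (\<lambda>t. of_real \<tau> * K t))\<^sup>2"
        unfolding norm2_power2
        by (rule integral_mono[OF square_integrable_integrable[OF ts] square_integrable_integrable[OF Ks]])
           (use le \<tau>0 in \<open>auto simp: norm_mult intro!: power_mono\<close>)
      then have "norm2 ?F (\<lambda>t. target t - ?g N t) \<le> norm2 ?F (\<lambda>t. of_real \<tau> * K t)"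
        by (rule power2_le_imp_le) simp
      then show ?thesis using \<tau>0 by (simp add: norm2_cmult \<tau>_def)
    qed
    then show "\<forall>\<^sub>F N in sequentially. norm (norm2 ?F (\<lambda>t. target t - ?g N t)) \<le> (\<Sum>k. norm (?b (k + N))) * norm2 ?F K"
      by simp
  qed
  have C: "\<exists>N0. \<forall>i\<ge>N0. \<forall>j\<ge>N0. norm2 P (\<lambda>\<omega>. ?Y i \<omega> - ?Y j \<omega>) \<le> e" if e: "e > 0" for e
  proof -
    obtain N0 where N0: "\<And>i. i \<ge> N0 \<Longrightarrow> norm2 ?F (\<lambda>t. target t - ?g i t) < e / 2"
      using LIMSEQ_D[OF glim, of "e / 2"] e by auto
    note gs = S.has_stoch_integral_square_integrable(1)[OF Y]
    have "norm2 P (\<lambda>\<omega>. ?Y i \<omega> - ?Y j \<omega>) \<le> e" if "i \<ge> N0" "j \<ge> N0" for i j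
      unfolding S.has_stoch_integral_diff_norm2[OF Y Y]
      using norm2_triangle_diff[OF gs target_square_integrable[OF d] gs, of i j] N0[OF that(1)] N0[OF that(2)]
        norm2_minus_commute[of ?F target "?g i"] by linarith
    then show ?thesis by blast
  qed
  have "B_fun n \<mu> a \<xi> \<in> borel_measurable P"
  proof -
    have "(\<lambda>\<omega>. ?b k * ?X k \<omega>) \<in> borel_measurable P" for k
      by (rule borel_measurable_times[OF borel_measurable_const square_integrable_measurable[OF Xs]])
    then show ?thesis unfolding B_fun_def[abs_def] by (rule borel_measurable_suminf)
  qed
  note FT = norm2_Fatou[OF Ys this lim C]
  show ?thesis by (rule S.has_stoch_integral_limit[OF Y target_square_integrable[OF d] glim FT])
qed

text \<open>The finite part \<open>V\<xi>\<close> occurs in the functional and in the estimate and cancels; the rest is a difference of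
  stochastic integrals.\<close>

lemma mse_eq:
  assumes sd: "has_spectral_density n (P f) (\<xi> f) (Z f) f" "stationary_increments n (P f) (\<xi> f)"
    and h: "admissible n \<mu> f h"
  shows "mse n \<mu> a P \<xi> Z h f = (norm2 (spectral_measure f) (\<lambda>t. target t - h t * K t))\<^sup>2"
proof -
  have d: "is_density f" and o: "orthogonal_measure (P f) f (Z f)" and ps: "prob_space (P f)"
    using sd by (auto simp: has_spectral_density_def stationary_increments_def)
  interpret S: stochastic_measure "P f" f "Z f"
    using ps d o by (simp add: stochastic_measure_def stochastic_measure_axioms_def)
  have "square_integrable (spectral_measure f) (\<lambda>t. h t * K t)"
    using h L2_past_iff[OF d mu] by (simp add: admissible_def)
  from S.has_stoch_integral_diff_norm2[OF B_fun_stoch_integral[OF sd] S.stoch_integral[OF this]]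
  show ?thesis
    unfolding mse_def A_fun_def estimate_def norm2_power2[symmetric] by simp
qed

text \<open>The kernel vanishes only on a null set, so every past function comes from a characteristic.\<close>

lemma admissible_of_past:
  assumes d: "is_density f" and g: "g \<in> L2_past n \<mu> f"
  shows "admissible n \<mu> f (\<lambda>t. g t / K t)"
    "norm2 (spectral_measure f) (\<lambda>t. target t - g t / K t * K t) = norm2 (spectral_measure f) (\<lambda>t. target t - g t)"
proof -
  have gm: "g \<in> borel_measurable circ" using g L2_past_iff[OF d mu] by (simp add: square_integrable_def)
  have m: "(\<lambda>t. g t / K t * K t) \<in> borel_measurable circ"
    by (intro borel_measurable_times borel_measurable_divide gm incr_kernel_measurable)
  have ae: "AE t in circ. g t / K t * K t = g t"
    using incr_kernel_AE_nonzero[OF mu, of n] by eventually_elim simp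
  show "admissible n \<mu> f (\<lambda>t. g t / K t)"
    unfolding admissible_def by (rule L2_past_cong_AE[OF d mu g m ae])
  have tm: "target \<in> borel_measurable circ" using target_square_integrable[OF d] by (simp add: square_integrable_def)
  show "norm2 (spectral_measure f) (\<lambda>t. target t - g t / K t * K t) = norm2 (spectral_measure f) (\<lambda>t. target t - g t)"
  proof (rule norm2_cong_AE)
    show "AE t in spectral_measure f. target t - g t / K t * K t = target t - g t"
      using spectral_measure_AE[OF d ae] by eventually_elim simp
  qed (use borel_measurable_diff[OF tm m] borel_measurable_diff[OF tm gm] in simp_all)
qed

text \<open>The optimal characteristic is an arbitrary choice among the minimizers, and it has its defining property because the
  projection of the target provides one.\<close>

lemma optimal_char:
  assumes sd: "has_spectral_density n (P f) (\<xi> f) (Z f) f" "stationary_increments n (P f) (\<xi> f)"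
  shows "admissible n \<mu> f (optimal_char n \<mu> a P \<xi> Z f)"
    "\<And>h. admissible n \<mu> f h \<Longrightarrow> mse n \<mu> a P \<xi> Z (optimal_char n \<mu> a P \<xi> Z f) f \<le> mse n \<mu> a P \<xi> Z h f"
proof -
  have d: "is_density f" using sd by (simp add: has_spectral_density_def)
  obtain g where g: "g \<in> L2_past n \<mu> f"
    "\<And>h. h \<in> L2_past n \<mu> f \<Longrightarrow> norm2 (spectral_measure f) (\<lambda>t. target t - g t) \<le> norm2 (spectral_measure f) (\<lambda>t. target t - h t)"
    using L2_past_projection[OF d mu target_square_integrable[OF d], of n] by blast
  note ad = admissible_of_past[OF d g(1)]
  have "mse n \<mu> a P \<xi> Z (\<lambda>t. g t / K t) f \<le> mse n \<mu> a P \<xi> Z h f" if "admissible n \<mu> f h" for h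
    unfolding mse_eq[where P = P and \<xi> = \<xi> and Z = Z, OF sd ad(1)] mse_eq[where P = P and \<xi> = \<xi> and Z = Z, OF sd that] ad(2)
    by (rule power_mono[OF g(2)]) (use that in \<open>simp_all add: admissible_def\<close>)
  then have "\<exists>h. admissible n \<mu> f h \<and> (\<forall>h'. admissible n \<mu> f h' \<longrightarrow> mse n \<mu> a P \<xi> Z h f \<le> mse n \<mu> a P \<xi> Z h' f)"
    using ad(1) by blast
  from someI_ex[OF this]
  show "admissible n \<mu> f (optimal_char n \<mu> a P \<xi> Z f)"
    "\<And>h. admissible n \<mu> f h \<Longrightarrow> mse n \<mu> a P \<xi> Z (optimal_char n \<mu> a P \<xi> Z f) f \<le> mse n \<mu> a P \<xi> Z h f"
    unfolding optimal_char_def by auto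
qed

end

section \<open>The saddle point of a canonical factorization\<close>

context extrapolation
begin

text \<open>The part of \<open>b(cis t) * (\<Phi> * W)(cis (- t))\<close> with nonnegative frequencies.\<close>

definition r_fun :: "(nat \<Rightarrow> complex) \<Rightarrow> complex \<Rightarrow> complex" where
  "r_fun \<phi> z = (\<Sum>k. DA_app n \<mu> a (mat_app (W_mat n \<mu>) \<phi>) k * z ^ k)"

lemma r_fun_split:
  assumes \<Phi>: "wiener \<Phi> \<phi>"
  obtains N y where "wiener (r_fun \<phi>) (DA_app n \<mu> a (mat_app (W_mat n \<mu>) \<phi>))" "wiener N y" "N 0 = 0"
    "\<And>t. b_fun (cis t) * (\<Phi> (cis (- t)) * W_fun n \<mu> (cis (- t))) = r_fun \<phi> (cis t) + N (cis (- t))"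
proof -
  let ?m = "mat_app (W_mat n \<mu>) \<phi>"
  obtain R N where R: "wiener R (\<lambda>k. \<Sum>j. b_seq n \<mu> a (k + j) * ?m j)"
    and N: "wiener N (\<lambda>k. if k = 0 then 0 else \<Sum>i. b_seq n \<mu> a i * ?m (i + k))" "N 0 = 0"
    and eq: "\<And>t. b_fun (cis t) * (\<Phi> (cis (- t)) * W_fun n \<mu> (cis (- t))) = R (cis t) + N (cis (- t))"
    by (rule wiener_hankel_split[OF b_fun_wiener W_mat_wiener[OF mu \<Phi>, of n]], rule that)
  have "(\<lambda>k. \<Sum>j. b_seq n \<mu> a (k + j) * ?m j) = DA_app n \<mu> a ?m"
    by (rule ext) (simp add: DA_app_hankel[OF coeff])
  then have R': "wiener R (DA_app n \<mu> a ?m)" using R by simp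
  have Rr: "R z = r_fun \<phi> z" if "norm z \<le> 1" for z
    using R' that by (simp add: wiener_def r_fun_def)
  have r: "wiener (r_fun \<phi>) (DA_app n \<mu> a ?m)" by (rule wiener_cong[OF R']) (simp add: Rr)
  show thesis by (rule that[OF r N]) (use eq Rr in simp)
qed

text \<open>Parseval's identity.\<close>

lemma objective_eq:
  assumes \<Phi>: "wiener \<Phi> \<phi>"
  shows "objective n \<mu> a \<phi> = (LINT t|circ. (cmod (r_fun \<phi> (cis t)))\<^sup>2) / (2 * pi)"
proof -
  obtain N y where r: "wiener (r_fun \<phi>) (DA_app n \<mu> a (mat_app (W_mat n \<mu>) \<phi>))"
    by (rule r_fun_split[OF \<Phi>])
  have "(\<Sum>k. (cmod (DA_app n \<mu> a (mat_app (W_mat n \<mu>) \<phi>) k))\<^sup>2) = (LINT t|circ. (cmod (r_fun \<phi> (cis t)))\<^sup>2) / (2 * pi)"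
    using wiener_parseval[OF r] by (simp add: sums_iff)
  moreover have "(LINT t|circ. (cmod (r_fun \<phi> (cis t)))\<^sup>2) \<ge> 0" by simp
  ultimately show ?thesis by (simp add: objective_def l2_norm_def)
qed

text \<open>Let \<open>N\<close> be the part of \<open>b(cis t) * (\<Phi> * W)(cis (- t))\<close> with negative frequencies. The characteristic
  \<open>N / (\<Phi> * W)\<close> is admissible for every density. It leaves the error \<open>r_fun \<phi> / (\<Phi> * W)\<close>, and \<open>W\<close> cancels against the
  kernel, so that the mean square error is linear in the density.\<close>

lemma canonical_characteristic:
  assumes \<phi>: "conv_radius \<phi> > 1" "\<And>z. cmod z \<le> 1 \<Longrightarrow> (\<Sum>k. \<phi> k * z ^ k) \<noteq> 0" and f: "is_density f"
  shows "\<exists>g\<in>L2_past n \<mu> f. (norm2 (spectral_measure f) (\<lambda>t. target t - g t))\<^sup>2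
     = 1 / (2 * pi) * (LINT t|circ. (cmod (r_fun \<phi> (cis t)))\<^sup>2 / spec \<phi> t * f t)"
proof -
  let ?\<Phi> = "\<lambda>z. \<Sum>k. \<phi> k * z ^ k" and ?W = "W_fun n \<mu>" and ?F = "spectral_measure f"
  have \<Phi>: "wiener ?\<Phi> \<phi>" by (rule wiener_conv_radius[OF \<phi>(1)])
  obtain N y where r: "wiener (r_fun \<phi>) (DA_app n \<mu> a (mat_app (W_mat n \<mu>) \<phi>))" and N: "wiener N y" "N 0 = 0"
    and split: "\<And>t. b_fun (cis t) * (?\<Phi> (cis (- t)) * ?W (cis (- t))) = r_fun \<phi> (cis t) + N (cis (- t))"
    by (rule r_fun_split[OF \<Phi>], rule that)
  obtain R where R: "R > 1" "(\<lambda>z. 1 / ?\<Phi> z) holomorphic_on ball 0 R"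
    by (rule conv_radius_inverse_holomorphic[OF \<phi>(1)], erule \<phi>(2), rule that)
  obtain p where p: "wiener (\<lambda>z. 1 / ?\<Phi> z) p" by (rule wiener_holomorphic[OF R(2,1)], rule that)
  define X where "X z = N z * (1 / ?\<Phi> z)" for z
  have X: "wiener X (\<lambda>k. \<Sum>i\<le>k. y i * p (k - i))" unfolding X_def[abs_def] by (rule wiener_mult[OF N(1) p])
  have X0: "X 0 = 0" by (simp add: X_def N(2))
  let ?g = "\<lambda>t. X (cis (- t)) / ?W (cis (- t)) * K t"
  have g: "?g \<in> L2_past n \<mu> f" by (rule L2_past_quotient[OF f mu X X0])
  have gm: "?g \<in> borel_measurable circ" using g L2_past_iff[OF f mu] by (simp add: square_integrable_def)
  have tm: "target \<in> borel_measurable circ" using target_square_integrable[OF f] by (simp add: square_integrable_def)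
  have spec: "spec \<phi> t = (cmod (?\<Phi> (cis (- t))))\<^sup>2" for t
    by (simp add: spec_def Complex.DeMoivre)
  have ae: "AE t in circ. (cmod (target t - ?g t))\<^sup>2 * f t = (cmod (r_fun \<phi> (cis t)))\<^sup>2 / spec \<phi> t * f t"
    using W_fun_boundary[OF mu, of n] incr_kernel_AE_nonzero[OF mu, of n]
  proof eventually_elim
    case (elim t)
    let ?P = "?\<Phi> (cis (- t))"
    have P: "?P \<noteq> 0" by (rule \<phi>(2)) simp
    have W: "?W (cis (- t)) \<noteq> 0" using elim by auto
    have "target t - ?g t = (b_fun (cis t) - N (cis (- t)) / (?P * ?W (cis (- t)))) * K t"
      unfolding target_def X_def by (simp add: left_diff_distrib)
    also have "b_fun (cis t) - N (cis (- t)) / (?P * ?W (cis (- t)))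
        = (b_fun (cis t) * (?P * ?W (cis (- t))) - N (cis (- t))) / (?P * ?W (cis (- t)))"
      using P W by (simp add: diff_divide_distrib)
    also have "b_fun (cis t) * (?P * ?W (cis (- t))) - N (cis (- t)) = r_fun \<phi> (cis t)"
      unfolding split by simp
    finally have "cmod (target t - ?g t) = cmod (r_fun \<phi> (cis t)) / cmod ?P"
      using elim W by (simp add: norm_mult norm_divide)
    then show ?case by (simp add: spec power_divide)
  qed
  have "(norm2 ?F (\<lambda>t. target t - ?g t))\<^sup>2 = 1 / (2 * pi) * (LINT t|circ. (cmod (target t - ?g t))\<^sup>2 * f t)"
    unfolding norm2_power2
    by (rule spectral_measure_integral[OF f]) (intro cmod_power2_measurable borel_measurable_diff gm tm)
  also have "(LINT t|circ. (cmod (target t - ?g t))\<^sup>2 * f t) = (LINT t|circ. (cmod (r_fun \<phi> (cis t)))\<^sup>2 / spec \<phi> t * f t)"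
  proof (rule integral_cong_AE[OF _ _ ae])
    show "(\<lambda>t. (cmod (target t - ?g t))\<^sup>2 * f t) \<in> borel_measurable circ"
      by (intro borel_measurable_times cmod_power2_measurable borel_measurable_diff gm tm density_measurable[OF f])
    show "(\<lambda>t. (cmod (r_fun \<phi> (cis t)))\<^sup>2 / spec \<phi> t * f t) \<in> borel_measurable circ"
      unfolding spec
      by (intro borel_measurable_times borel_measurable_divide cmod_power2_measurable
          wiener_circle_measurable(1)[OF r] wiener_circle_measurable(2)[OF \<Phi>] density_measurable[OF f])
  qed
  finally show ?thesis by (rule bexI[OF _ g])
qed

text \<open>After multiplication by \<open>\<Phi> * W\<close>, of modulus \<open>sqrt f\<close> times that of the kernel, the error of a past polynomial is
  \<open>r_fun \<phi>\<close>, with nonnegative frequencies, plus a function with negative frequencies only, and the two are orthogonal.\<close>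

lemma canonical_lower_bound:
  assumes \<Phi>: "wiener \<Phi> \<phi>" and f: "is_density f" "AE t in circ. f t = (cmod (\<Phi> (cis (- t))))\<^sup>2"
    and g: "g \<in> L2_past n \<mu> f"
  shows "1 / (2 * pi) * (LINT t|circ. (cmod (r_fun \<phi> (cis t)))\<^sup>2) \<le> (norm2 (spectral_measure f) (\<lambda>t. target t - g t))\<^sup>2"
proof -
  let ?W = "W_fun n \<mu>" and ?F = "spectral_measure f"
  obtain N y where r: "wiener (r_fun \<phi>) (DA_app n \<mu> a (mat_app (W_mat n \<mu>) \<phi>))" and N: "wiener N y" "N 0 = 0"
    and split: "\<And>t. b_fun (cis t) * (\<Phi> (cis (- t)) * ?W (cis (- t))) = r_fun \<phi> (cis t) + N (cis (- t))"
    by (rule r_fun_split[OF \<Phi>], rule that)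
  define \<rho> where "\<rho> = sqrt (1 / (2 * pi) * (LINT t|circ. (cmod (r_fun \<phi> (cis t)))\<^sup>2))"
  have \<rho>2: "\<rho>\<^sup>2 = 1 / (2 * pi) * (LINT t|circ. (cmod (r_fun \<phi> (cis t)))\<^sup>2)" and \<rho>0: "\<rho> \<ge> 0"
    by (simp_all add: \<rho>_def)
  note ts = target_square_integrable[OF f(1)] and ps = past_poly_square_integrable[OF f(1) mu, of n]
  have poly: "\<rho> \<le> norm2 ?F (\<lambda>t. target t - past_poly n \<mu> S c t)" if S: "finite S" "S \<subseteq> {..-1}" for S c
  proof -
    define p where "p z = (\<Sum>k\<in>S. c k * z ^ nat (- k))" for z :: complex
    have "\<exists>x. wiener p x"
      unfolding p_def[abs_def] by (rule exI, rule wiener_sum[OF S(1)], rule wiener_cmult, rule wiener_monomial)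
    then obtain x where p: "wiener p x" by (elim exE)
    have pc: "p (cis (- t)) = (\<Sum>k\<in>S. c k * cis (of_int k * t))" for t
      unfolding p_def by (intro sum.cong refl) (use S(2) in \<open>auto simp: Complex.DeMoivre\<close>)
    have p0: "p 0 = 0" unfolding p_def by (intro sum.neutral) (use S(2) in auto)
    define Y where "Y z = N z - p z * (\<Phi> z * ?W z)" for z
    have "\<exists>v. wiener Y v" unfolding Y_def[abs_def]
      by (rule exI, rule wiener_diff[OF N(1)], rule wiener_mult[OF p], rule W_mat_wiener[OF mu \<Phi>])
    then obtain v where Y: "wiener Y v" by (elim exE)
    have Y0: "Y 0 = 0" by (simp add: Y_def N p0)
    have m: "(\<lambda>t. target t - past_poly n \<mu> S c t) \<in> borel_measurable circ"
      using square_integrable_diff[OF ts ps] by (simp add: square_integrable_def)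
    have "(norm2 ?F (\<lambda>t. target t - past_poly n \<mu> S c t))\<^sup>2 = 1 / (2 * pi) * (LINT t|circ. (cmod (target t - past_poly n \<mu> S c t))\<^sup>2 * f t)"
      unfolding norm2_power2
      by (rule spectral_measure_integral[OF f(1)]) (intro cmod_power2_measurable m)
    also have "(LINT t|circ. (cmod (target t - past_poly n \<mu> S c t))\<^sup>2 * f t) = (LINT t|circ. (cmod (r_fun \<phi> (cis t) + Y (cis (- t))))\<^sup>2)"
    proof (rule integral_cong_AE)
      show "(\<lambda>t. (cmod (target t - past_poly n \<mu> S c t))\<^sup>2 * f t) \<in> borel_measurable circ"
        by (intro borel_measurable_times cmod_power2_measurable m density_measurable[OF f(1)])
      show "(\<lambda>t. (cmod (r_fun \<phi> (cis t) + Y (cis (- t))))\<^sup>2) \<in> borel_measurable circ"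
        by (intro cmod_power2_measurable borel_measurable_add wiener_circle_measurable(1)[OF r] wiener_circle_measurable(2)[OF Y])
      show "AE t in circ. (cmod (target t - past_poly n \<mu> S c t))\<^sup>2 * f t = (cmod (r_fun \<phi> (cis t) + Y (cis (- t))))\<^sup>2"
        using f(2) W_fun_boundary[OF mu, of n]
      proof eventually_elim
        case (elim t)
        have "target t - past_poly n \<mu> S c t = (b_fun (cis t) - p (cis (- t))) * K t"
          unfolding target_def past_poly_factor pc by (simp add: left_diff_distrib)
        then have "(cmod (target t - past_poly n \<mu> S c t))\<^sup>2 * f t
            = (cmod ((b_fun (cis t) - p (cis (- t))) * (\<Phi> (cis (- t)) * ?W (cis (- t)))))\<^sup>2"
          unfolding elim(1) by (simp add: norm_mult elim(2) power_mult_distrib)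
        also have "(b_fun (cis t) - p (cis (- t))) * (\<Phi> (cis (- t)) * ?W (cis (- t))) = r_fun \<phi> (cis t) + Y (cis (- t))"
          unfolding Y_def left_diff_distrib split by simp
        finally show ?case .
      qed
    qed
    also have "\<dots> = (LINT t|circ. (cmod (r_fun \<phi> (cis t)))\<^sup>2) + (LINT t|circ. (cmod (Y (cis (- t))))\<^sup>2)"
      by (rule wiener_orthogonal_norm[OF r Y Y0])
    also have "1 / (2 * pi) * \<dots> \<ge> \<rho>\<^sup>2" unfolding \<rho>2 by (intro mult_left_mono) auto
    finally show ?thesis by (rule power2_le_imp_le) simp
  qed
  have gs: "square_integrable ?F g" using g L2_past_iff[OF f(1) mu] by simp
  have "\<rho> \<le> norm2 ?F (\<lambda>t. target t - g t)"
  proof (rule field_le_epsilon)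
    fix e :: real assume "e > 0"
    from g[unfolded L2_past_iff[OF f(1) mu], THEN conjunct2, rule_format, OF this]
    obtain S c where S: "finite S" "S \<subseteq> {..-1}" "norm2 ?F (\<lambda>t. g t - past_poly n \<mu> S c t) < e" by (elim exE conjE)
    show "\<rho> \<le> norm2 ?F (\<lambda>t. target t - g t) + e"
      using poly[OF S(1,2), of c] norm2_triangle_diff[OF ts gs ps, of S c] S(3) by linarith
  qed
  then show ?thesis unfolding \<rho>2[symmetric] by (rule power_mono[OF _ \<rho>0])
qed

text \<open>The canonical characteristic of \<open>f\<^sub>0\<close> bounds the optimal error under every \<open>f\<close> from above by the linear functional,
  whose value at \<open>f\<^sub>0\<close> is the optimal error under \<open>f\<^sub>0\<close>.\<close>

lemma least_favorable_canonical:
  assumes sd: "\<And>f. f \<in> D \<Longrightarrow> has_spectral_density n (P f) (\<xi> f) (Z f) f" "\<And>f. f \<in> D \<Longrightarrow> stationary_increments n (P f) (\<xi> f)"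
    and f0: "f\<^sub>0 \<in> D" "canonical_factorization \<phi> f\<^sub>0"
    and le: "\<And>f. f \<in> D \<Longrightarrow> (LINT t|circ. (cmod (r_fun \<phi> (cis t)))\<^sup>2 / spec \<phi> t * f t) \<le> (LINT t|circ. (cmod (r_fun \<phi> (cis t)))\<^sup>2)"
  shows "least_favorable n \<mu> a P \<xi> Z D f\<^sub>0"
  unfolding least_favorable_def
proof (intro conjI f0(1) ballI)
  fix f assume f: "f \<in> D"
  have \<phi>: "conv_radius \<phi> > 1" "\<And>z. cmod z \<le> 1 \<Longrightarrow> (\<Sum>k. \<phi> k * z ^ k) \<noteq> 0"
    and ae: "AE t in circ. f\<^sub>0 t = (cmod (\<Sum>k. \<phi> k * cis (- t) ^ k))\<^sup>2"
    using f0(2) unfolding canonical_factorization_def circ_AE by auto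
  have d: "is_density f" and d0: "is_density f\<^sub>0" using sd(1)[OF f] sd(1)[OF f0(1)] by (auto simp: has_spectral_density_def)
  let ?J = "1 / (2 * pi) * (LINT t|circ. (cmod (r_fun \<phi> (cis t)))\<^sup>2)"
  obtain g where g: "g \<in> L2_past n \<mu> f" "(norm2 (spectral_measure f) (\<lambda>t. target t - g t))\<^sup>2
     = 1 / (2 * pi) * (LINT t|circ. (cmod (r_fun \<phi> (cis t)))\<^sup>2 / spec \<phi> t * f t)"
    using canonical_characteristic[OF \<phi> d] by blast
  note ad = admissible_of_past[OF d g(1)]
  have "mse n \<mu> a P \<xi> Z (optimal_char n \<mu> a P \<xi> Z f) f \<le> mse n \<mu> a P \<xi> Z (\<lambda>t. g t / K t) f"
    by (rule optimal_char(2)[where P = P and \<xi> = \<xi> and Z = Z, OF sd(1)[OF f] sd(2)[OF f] ad(1)])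
  also have "\<dots> = 1 / (2 * pi) * (LINT t|circ. (cmod (r_fun \<phi> (cis t)))\<^sup>2 / spec \<phi> t * f t)"
    unfolding mse_eq[where P = P and \<xi> = \<xi> and Z = Z, OF sd(1)[OF f] sd(2)[OF f] ad(1)] ad(2) g(2) ..
  also have "\<dots> \<le> ?J" by (intro mult_left_mono le[OF f]) simp
  also have "\<dots> \<le> mse n \<mu> a P \<xi> Z (optimal_char n \<mu> a P \<xi> Z f\<^sub>0) f\<^sub>0"
  proof -
    note o = optimal_char(1)[where P = P and \<xi> = \<xi> and Z = Z, OF sd(1)[OF f0(1)] sd(2)[OF f0(1)]]
    show ?thesis
      unfolding mse_eq[where P = P and \<xi> = \<xi> and Z = Z, OF sd(1)[OF f0(1)] sd(2)[OF f0(1)] o]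
      by (rule canonical_lower_bound[OF wiener_conv_radius[OF \<phi>(1)] d0 ae]) (use o in \<open>simp add: admissible_def\<close>)
  qed
  finally show "mse n \<mu> a P \<xi> Z (optimal_char n \<mu> a P \<xi> Z f) f \<le> mse n \<mu> a P \<xi> Z (optimal_char n \<mu> a P \<xi> Z f\<^sub>0) f\<^sub>0" .
qed

end

section \<open>Factorization of a small perturbation\<close>

text \<open>Every function on the discrete space \<^typ>\<open>nat\<close> is continuous, so that \<^typ>\<open>nat \<Rightarrow>\<^sub>C complex\<close> is the space of
  bounded sequences with the supremum norm.\<close>

lemma bcontfun_nat: "bounded (range f) \<Longrightarrow> apply_bcontfun (Bcontfun f) = f" for f :: "nat \<Rightarrow> complex"
  by (rule Bcontfun_inverse) (simp add: bcontfun_def)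

lemma bounded_sequences_Cauchy_convergent:
  fixes f :: "nat \<Rightarrow> nat \<Rightarrow>\<^sub>C complex" assumes C: "Cauchy f" shows "\<exists>l. f \<longlonglongrightarrow> l"
proof -
  have "Cauchy (\<lambda>n. apply_bcontfun (f n) k)" for k
  proof (rule metric_CauchyI)
    fix e :: real assume "0 < e"
    from metric_CauchyD[OF C this] obtain N where N: "\<forall>m\<ge>N. \<forall>n\<ge>N. dist (f m) (f n) < e" by blast
    show "\<exists>N. \<forall>m\<ge>N. \<forall>n\<ge>N. dist (apply_bcontfun (f m) k) (apply_bcontfun (f n) k) < e"
      using N by (intro exI[of _ N] allI impI dist_fun_lt_imp_dist_val_lt) simp
  qed
  then have "\<forall>k. \<exists>x. (\<lambda>n. apply_bcontfun (f n) k) \<longlonglongrightarrow> x" by (simp add: Cauchy_convergent_iff convergent_def)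
  then obtain l where l: "\<And>k. (\<lambda>n. apply_bcontfun (f n) k) \<longlonglongrightarrow> l k" using choice by metis
  have lim: "dist (apply_bcontfun (f n) k) (l k) \<le> e" if N: "\<forall>m\<ge>N. \<forall>n\<ge>N. dist (f m) (f n) < e" and n: "n \<ge> N" for e N n k
  proof (rule LIMSEQ_le_const2[OF tendsto_dist[OF tendsto_const l]], intro exI allI impI)
    fix m assume m: "N \<le> m"
    have "dist (f n) (f m) < e" using N n m by blast
    from dist_fun_lt_imp_dist_val_lt[OF this, of k]
    show "dist (apply_bcontfun (f n) k) (apply_bcontfun (f m) k) \<le> e" by simp
  qed
  obtain N where N: "\<forall>m\<ge>N. \<forall>n\<ge>N. dist (f m) (f n) < 1" using metric_CauchyD[OF C, of 1] by auto
  have "bounded (range l)"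
  proof -
    obtain B where B: "\<And>k. norm (apply_bcontfun (f N) k) \<le> B"
      using bounded_apply_bcontfun[of "f N"] unfolding bounded_iff by (metis rangeI)
    have "norm (l k) \<le> B + 1" for k
    proof -
      have d: "norm (apply_bcontfun (f N) k - l k) \<le> 1" using lim[OF N order_refl, of k] by (simp only: dist_norm)
      show ?thesis using norm_triangle_sub[of "l k" "apply_bcontfun (f N) k"] B[of k] d by (simp add: norm_minus_commute)
    qed
    then show ?thesis unfolding bounded_iff by blast
  qed
  then have L: "apply_bcontfun (Bcontfun l) = l" by (rule bcontfun_nat)
  have "f \<longlonglongrightarrow> Bcontfun l"
  proof (rule metric_LIMSEQ_I)
    fix e :: real assume "0 < e"
    then have e2: "0 < e / 2" by simp
    from metric_CauchyD[OF C e2] obtain N where N: "\<forall>m\<ge>N. \<forall>n\<ge>N. dist (f m) (f n) < e / 2" by blast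
    have "dist (f n) (Bcontfun l) < e" if "n \<ge> N" for n
    proof -
      have "dist (f n) (Bcontfun l) \<le> e / 2" by (rule dist_bound) (unfold L, rule lim[OF N that])
      then show ?thesis using \<open>0 < e\<close> by linarith
    qed
    then show "\<exists>N. \<forall>n\<ge>N. dist (f n) (Bcontfun l) < e" by blast
  qed
  then show ?thesis by blast
qed

text \<open>Up to the scaling of \<open>\<epsilon>\<close>, this is the equation \<open>2 Re U + |U|\<^sup>2 = \<epsilon> Re T\<close> on the unit circle in terms of the weighted coefficients
  \<open>x k = u k * r ^ k\<close> of \<open>U\<close>, with \<open>q = 1 / r\<^sup>2\<close>. Its right-hand side is a contraction of the ball of radius
  \<open>2 * \<epsilon> * A\<close> in the space of bounded sequences, because the quadratic term is small there.\<close>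

lemma quadratic_fixed_point:
  fixes \<tau> c :: "nat \<Rightarrow> complex"
  assumes q: "0 \<le> q" "q < 1" and \<tau>: "\<And>k. norm (\<tau> k) \<le> A" and A: "A > 0" and c: "\<And>k. norm (c k) \<le> 1"
    and \<epsilon>: "0 < \<epsilon>" "8 * \<epsilon> * A \<le> 1 - q"
  shows "\<exists>x. (\<forall>k. norm (x k) \<le> 2 * \<epsilon> * A) \<and> (\<forall>k. x k = of_real \<epsilon> * \<tau> k - c k * (\<Sum>j. x (j + k) * cnj (x j) * of_real q ^ j))"
proof -
  define \<delta> where "\<delta> = 2 * \<epsilon> * A"
  have \<delta>: "\<delta> > 0" "4 * \<delta> \<le> 1 - q" using \<epsilon> A by (auto simp: \<delta>_def)
  have gs: "(\<Sum>j. B * q ^ j) = B / (1 - q)" "summable (\<lambda>j. B * q ^ j)" for B :: real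
    using q suminf_mult[OF summable_geometric[of q], of B] by (simp_all add: suminf_geometric summable_mult)
  define Q where "Q x k = (\<Sum>j. x (j + k) * cnj (x j) * of_real q ^ j)" for x :: "nat \<Rightarrow> complex" and k
  have tm: "norm (u * v * of_real q ^ j) \<le> (a * b) * q ^ j" if "norm u \<le> a" "norm v \<le> b" "0 \<le> a" for u v :: complex and a b j
    using that q by (auto simp: norm_mult norm_power intro!: mult_right_mono mult_mono)
  have Qb: "norm (Q x k) \<le> B * B / (1 - q)" "summable (\<lambda>j. x (j + k) * cnj (x j) * of_real q ^ j)" if "\<And>k. norm (x k) \<le> B" for x B k
  proof -
    have B0: "B \<ge> 0" using that[of 0] norm_ge_zero order_trans by blast
    have t: "norm (x (j + k) * cnj (x j) * of_real q ^ j) \<le> (B * B) * q ^ j" for j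
      by (rule tm) (use that B0 in auto)
    show "norm (Q x k) \<le> B * B / (1 - q)" unfolding Q_def gs(1)[symmetric] by (rule norm_suminf_le[OF t gs(2)])
    show "summable (\<lambda>j. x (j + k) * cnj (x j) * of_real q ^ j)" by (rule summable_comparison_test[OF _ gs(2)]) (use t in auto)
  qed
  define S where "S x k = of_real \<epsilon> * \<tau> k - c k * Q x k" for x k
  define T where "T x = Bcontfun (S (apply_bcontfun x))" for x :: "nat \<Rightarrow>\<^sub>C complex"
  have dA: "\<epsilon> * A = \<delta> / 2" by (simp add: \<delta>_def)
  have Sb: "norm (S x k) \<le> \<delta>" if "\<And>k. norm (x k) \<le> \<delta>" for x k
  proof -
    have "norm (S x k) \<le> norm (of_real \<epsilon> * \<tau> k) + norm (c k * Q x k)" unfolding S_def by (rule norm_triangle_ineq4)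
    also have "norm (of_real \<epsilon> * \<tau> k) \<le> \<delta> / 2" using \<epsilon>(1) mult_left_mono[OF \<tau>[of k], of \<epsilon>] by (simp add: norm_mult dA)
    also have "norm (c k * Q x k) \<le> 1 * (\<delta> * \<delta> / (1 - q))"
      unfolding norm_mult by (rule mult_mono[OF c Qb(1)[OF that]]) auto
    also have "1 * (\<delta> * \<delta> / (1 - q)) \<le> \<delta> / 2"
    proof -
      have "\<delta> / (1 - q) \<le> 1 / 2" using \<delta> q by (simp add: field_simps)
      from mult_left_mono[OF this, of \<delta>] show ?thesis using \<delta> by simp
    qed
    finally show ?thesis by simp
  qed
  have cb: "norm (apply_bcontfun x k) \<le> \<delta>" if "x \<in> cball 0 \<delta>" for x :: "nat \<Rightarrow>\<^sub>C complex" and k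
    using dist_bounded[of x k 0] that by (simp add: zero_bcontfun.rep_eq dist_commute)
  have TS: "apply_bcontfun (T x) = S (apply_bcontfun x)" if "x \<in> cball 0 \<delta>" for x
  proof -
    have "\<forall>k. norm (S (apply_bcontfun x) k) \<le> \<delta>" by (intro allI Sb cb that)
    then show ?thesis unfolding T_def by (intro bcontfun_nat) (auto simp: bounded_iff)
  qed
  have ne: "cball (0 :: nat \<Rightarrow>\<^sub>C complex) \<delta> \<noteq> {}" using \<delta> by simp
  have sub: "T ` cball 0 \<delta> \<subseteq> cball 0 \<delta>"
    proof
      fix y assume "y \<in> T ` cball 0 \<delta>"
      then obtain x where x: "x \<in> cball 0 \<delta>" "y = T x" by blast
      have "dist (T x) 0 \<le> \<delta>"
      proof (rule dist_bound)
        fix k show "dist (apply_bcontfun (T x) k) (apply_bcontfun 0 k) \<le> \<delta>"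
        proof -
          have "norm (S (apply_bcontfun x) k) \<le> \<delta>" by (rule Sb, rule cb, rule x(1))
          then show ?thesis unfolding TS[OF x(1)] by (simp add: zero_bcontfun.rep_eq)
        qed
      qed
      then show "y \<in> cball 0 \<delta>" using x by (simp add: dist_commute)
    qed
  have lip: "dist (T x) (T y) \<le> 1/2 * dist x y" if x: "x \<in> cball 0 \<delta>" and y: "y \<in> cball 0 \<delta>" for x y
  proof -
    let ?d = "dist x y" and ?x = "apply_bcontfun x" and ?y = "apply_bcontfun y"
    have dd: "norm (?x k - ?y k) \<le> ?d" for k using dist_bounded[of x k y] by (simp add: dist_norm)
    have "dist (T x) (T y) \<le> 2 * \<delta> / (1 - q) * ?d"
    proof (rule dist_bound)
      fix k
      have "norm (Q ?x k - Q ?y k) \<le> 2 * \<delta> * ?d / (1 - q)"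
      proof -
        have "Q ?x k - Q ?y k = (\<Sum>j. ?x (j + k) * cnj (?x j) * of_real q ^ j - ?y (j + k) * cnj (?y j) * of_real q ^ j)"
          unfolding Q_def by (rule suminf_diff[OF Qb(2)[OF cb[OF x]] Qb(2)[OF cb[OF y]]])
        also have "norm \<dots> \<le> 2 * \<delta> * ?d / (1 - q)"
          unfolding gs(1)[symmetric]
        proof (rule norm_suminf_le[OF _ gs(2)])
          fix j
          have "?x (j + k) * cnj (?x j) * of_real q ^ j - ?y (j + k) * cnj (?y j) * of_real q ^ j
              = ?x (j + k) * cnj (?x j - ?y j) * of_real q ^ j + (?x (j + k) - ?y (j + k)) * cnj (?y j) * of_real q ^ j"
            by (simp add: algebra_simps)
          also have "norm \<dots> \<le> (\<delta> * ?d) * q ^ j + (?d * \<delta>) * q ^ j"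
          proof (rule norm_triangle_mono)
            show "norm (?x (j + k) * cnj (?x j - ?y j) * of_real q ^ j) \<le> (\<delta> * ?d) * q ^ j"
              by (rule tm) (use cb[OF x] dd[of j] \<delta> in \<open>auto simp del: complex_cnj_diff\<close>)
            show "norm ((?x (j + k) - ?y (j + k)) * cnj (?y j) * of_real q ^ j) \<le> (?d * \<delta>) * q ^ j"
              by (rule tm) (use cb[OF y] dd in auto)
          qed
          finally show "norm (?x (j + k) * cnj (?x j) * of_real q ^ j - ?y (j + k) * cnj (?y j) * of_real q ^ j) \<le> 2 * \<delta> * ?d * q ^ j"
            by (simp add: algebra_simps)
        qed
        finally show ?thesis .
      qed
      then have "norm (c k * (Q ?x k - Q ?y k)) \<le> 1 * (2 * \<delta> * ?d / (1 - q))"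
        unfolding norm_mult by (intro mult_mono c) auto
      moreover have "S ?x k - S ?y k = - (c k * (Q ?x k - Q ?y k))" by (simp add: S_def algebra_simps)
      ultimately show "dist (apply_bcontfun (T x) k) (apply_bcontfun (T y) k) \<le> 2 * \<delta> / (1 - q) * ?d"
        unfolding TS[OF x] TS[OF y] dist_norm by (simp only: norm_minus_cancel) simp
    qed
    also have "2 * \<delta> / (1 - q) * ?d \<le> 1/2 * ?d"
      using \<delta> q by (intro mult_right_mono) (auto simp: field_simps)
    finally show ?thesis .
  qed
  have cpl: "uniform_space_class.complete (cball (0 :: nat \<Rightarrow>\<^sub>C complex) \<delta>)"
  proof (rule completeI)
    fix f :: "nat \<Rightarrow> nat \<Rightarrow>\<^sub>C complex" assume f: "\<forall>n. f n \<in> cball 0 \<delta>" and C: "Cauchy f"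
    obtain l where l: "f \<longlonglongrightarrow> l" using bounded_sequences_Cauchy_convergent[OF C] by (elim exE)
    have "l \<in> cball 0 \<delta>" by (rule closed_sequentially[OF closed_cball f[rule_format] l])
    with l show "\<exists>l\<in>cball 0 \<delta>. f \<longlonglongrightarrow> l" by (intro bexI)
  qed
  have half: "0 \<le> (1/2 :: real)" "(1/2 :: real) < 1" by auto
  have "\<exists>!x. x \<in> cball 0 \<delta> \<and> T x = x"
    by (rule Banach_fix[OF cpl ne half sub]) (rule lip)
  then obtain x where x: "x \<in> cball 0 \<delta>" "T x = x" by blast
  have "apply_bcontfun x = S (apply_bcontfun x)" using TS[OF x(1)] x(2) by simp
  then have "apply_bcontfun x k = of_real \<epsilon> * \<tau> k - c k * (\<Sum>j. apply_bcontfun x (j + k) * cnj (apply_bcontfun x j) * of_real q ^ j)" for k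
    unfolding S_def Q_def by (rule fun_cong)
  then show ?thesis using cb[OF x(1)] unfolding \<delta>_def by (intro exI[of _ "apply_bcontfun x"] conjI allI)
qed

lemma wiener_eqI: "wiener F x \<Longrightarrow> wiener G x \<Longrightarrow> norm z \<le> 1 \<Longrightarrow> F z = G z"
  by (simp add: wiener_def)

lemma cnj_suminf: "summable f \<Longrightarrow> cnj (\<Sum>k. f k) = (\<Sum>k. cnj (f k))"
  using sums_cnj[of f "\<Sum>k. f k"] by (simp add: sums_iff)

lemma Cauchy_coeff_bound:
  assumes x: "summable (\<lambda>k. norm (x k))" and y: "\<And>k. norm (y k) * r ^ k \<le> B" and r: "r \<ge> 1"
  shows "norm (\<Sum>j. x j * y (j + k)) * r ^ k \<le> B * (\<Sum>j. norm (x j :: complex))"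
    and "summable (\<lambda>j. x j * y (j + k) :: complex)"
proof -
  have "norm (x j * y (j + k)) * r ^ k \<le> norm (x j) * B" for j
  proof -
    have "norm (y (j + k)) * r ^ k \<le> norm (y (j + k)) * r ^ (j + k)"
      using r by (intro mult_left_mono power_increasing) auto
    then have "norm (y (j + k)) * r ^ k \<le> B" using y[of "j + k"] by linarith
    then show ?thesis by (simp add: norm_mult mult.assoc mult_left_mono)
  qed
  then have le: "norm (x j * y (j + k)) \<le> norm (x j) * B / r ^ k" for j
    using r by (simp add: field_simps)
  have s: "summable (\<lambda>j. norm (x j) * B / r ^ k)" using x by (intro summable_divide summable_mult2)
  show "summable (\<lambda>j. x j * y (j + k))" by (rule summable_comparison_test[OF _ s]) (use le in auto)
  have "norm (\<Sum>j. x j * y (j + k)) \<le> (\<Sum>j. norm (x j) * B / r ^ k)" by (rule norm_suminf_le[OF le s])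
  also have "\<dots> = (\<Sum>j. norm (x j)) * B / r ^ k"
    using suminf_mult2[OF x, of "B / r ^ k"] by simp
  finally show "norm (\<Sum>j. x j * y (j + k)) * r ^ k \<le> B * (\<Sum>j. norm (x j))"
    using r by (simp add: field_simps)
qed

text \<open>A real function is determined on the circle by its nonnegative frequencies: reflecting the others turns the product
  into the real part of a power series.\<close>

lemma wiener_Re_product:
  assumes X: "wiener X x" and Y: "wiener Y y" and real: "\<And>t. cnj (Y (cis (- t))) * X (cis (- t)) \<in> \<real>"
  obtains T where "wiener T (\<lambda>k. (\<Sum>j. cnj (x j) * y (j + k)) + (if k = 0 then 0 else \<Sum>j. cnj (y j) * x (j + k)))"
    "\<And>t. cnj (Y (cis (- t))) * X (cis (- t)) = of_real (Re (T (cis (- t))))"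
proof -
  obtain R N where R: "wiener R (\<lambda>k. \<Sum>j. cnj (y (k + j)) * x j)"
    and N: "wiener N (\<lambda>k. if k = 0 then 0 else \<Sum>j. cnj (y j) * x (j + k))"
    and eq: "\<And>t. cnj (Y (cnj (cis t))) * X (cis (- t)) = R (cis t) + N (cis (- t))"
    by (rule wiener_hankel_split[OF wiener_cnj[OF Y] X], rule that)
  obtain B where B: "\<And>k. norm (y k) * 1 ^ k \<le> B"
    using summable_imp_Bseq[OF wiener_summable_norm[OF Y]] unfolding Bseq_def by auto
  have sx: "summable (\<lambda>k. norm (cnj (x k)))" using wiener_summable_norm[OF X] by simp
  have "cnj (\<Sum>j. cnj (y (k + j)) * x j) = (\<Sum>j. cnj (x j) * y (j + k))" for k
  proof -
    have "(\<Sum>j. cnj (y (k + j)) * x j) = (\<Sum>j. cnj (cnj (x j) * y (j + k)))" by (simp add: mult.commute add.commute)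
    also have "\<dots> = cnj (\<Sum>j. cnj (x j) * y (j + k))"
      by (rule cnj_suminf[symmetric]) (rule Cauchy_coeff_bound(2)[OF sx B], simp)
    finally show ?thesis by simp
  qed
  then have T: "wiener (\<lambda>z. cnj (R (cnj z)) + N z) (\<lambda>k. (\<Sum>j. cnj (x j) * y (j + k)) + (if k = 0 then 0 else \<Sum>j. cnj (y j) * x (j + k)))"
    using wiener_add[OF wiener_cnj[OF R] N] by simp
  show thesis
  proof (rule that[OF T])
    fix t
    have "cnj (Y (cis (- t))) * X (cis (- t)) = R (cis t) + N (cis (- t))" using eq[of t] by (simp add: cis_cnj)
    moreover have "cnj (Y (cis (- t))) * X (cis (- t)) = of_real (Re (cnj (Y (cis (- t))) * X (cis (- t))))"
      using real[of t] by (simp only: of_real_Re)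
    ultimately show "cnj (Y (cis (- t))) * X (cis (- t)) = of_real (Re (cnj (R (cnj (cis (- t)))) + N (cis (- t))))"
      by (simp add: cis_cnj)
  qed
qed

text \<open>Since \<open>v\<close> is a trigonometric polynomial, \<open>v / |\<Phi>|\<^sup>2\<close> is the real part of a power series with geometrically decaying
  coefficients. The equation \<open>|1 + U|\<^sup>2 = 1 + \<epsilon> v / |\<Phi>|\<^sup>2\<close> is then a quadratic equation for the coefficients of \<open>U\<close>, and
  solving it with weights \<open>r ^ k\<close>, \<open>r > 1\<close>, keeps the radius of convergence above \<open>1\<close>.\<close>

lemma factor_perturbation:
  fixes p :: "complex \<Rightarrow> complex" and v :: "real \<Rightarrow> real"
  assumes \<phi>: "conv_radius \<phi> > 1" "\<And>z. cmod z \<le> 1 \<Longrightarrow> (\<Sum>k. \<phi> k * z ^ k) \<noteq> 0"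
    and p: "p holomorphic_on UNIV" "\<And>t. p (cis (- t)) = cis (- t) ^ M * of_real (v t)"
  shows "\<exists>C \<epsilon>\<^sub>0. \<epsilon>\<^sub>0 > 0 \<and> C > 0 \<and> (\<forall>\<epsilon>. 0 < \<epsilon> \<longrightarrow> \<epsilon> < \<epsilon>\<^sub>0 \<longrightarrow> (\<exists>U u. wiener U u \<and> conv_radius u > 1 \<and>
     (\<forall>z. norm z \<le> 1 \<longrightarrow> norm (U z) \<le> C * \<epsilon>) \<and>
     (\<forall>t. (cmod (1 + U (cis (- t))))\<^sup>2 = 1 + \<epsilon> * v t / (cmod (\<Sum>k. \<phi> k * cis (- t) ^ k))\<^sup>2)))"
proof -
  let ?\<Phi> = "\<lambda>z. \<Sum>k. \<phi> k * z ^ k"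
  obtain R where R: "R > 1" "(\<lambda>z. 1 / ?\<Phi> z) holomorphic_on ball 0 R"
    by (rule conv_radius_inverse_holomorphic[OF \<phi>(1)], erule \<phi>(2), rule that)
  define r where "r = (1 + R) / 2"
  have r: "r > 1" "r < R" using R(1) by (auto simp: r_def)
  \<comment> \<open>On the circle \<open>v / |\<Phi>|\<^sup>2\<close> is \<open>cnj Y * X\<close>, and both factors are analytic beyond the unit disk.\<close>
  define X where "X z = p z * (1 / ?\<Phi> z)" for z
  define Y where "Y z = z ^ M * (1 / ?\<Phi> z)" for z
  have "X holomorphic_on ball 0 R" unfolding X_def[abs_def]
    by (intro holomorphic_on_mult R(2) holomorphic_on_subset[OF p(1)]) auto
  from wiener_holomorphic[OF this R(1)] obtain x where X: "wiener X x"
    and xr: "\<And>r. 0 \<le> r \<Longrightarrow> r < R \<Longrightarrow> summable (\<lambda>k. norm (x k) * r ^ k)" by metis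
  have "Y holomorphic_on ball 0 R" unfolding Y_def[abs_def]
    by (intro holomorphic_on_mult R(2) holomorphic_intros)
  from wiener_holomorphic[OF this R(1)] obtain y where Y: "wiener Y y"
    and yr: "\<And>r. 0 \<le> r \<Longrightarrow> r < R \<Longrightarrow> summable (\<lambda>k. norm (y k) * r ^ k)" by metis
  have bnd: "\<exists>B. \<forall>k. norm (x k) * r ^ k \<le> B" if s: "summable (\<lambda>k. norm (x k) * r ^ k)" for x :: "nat \<Rightarrow> complex"
  proof -
    obtain B where B: "\<forall>k. norm (norm (x k) * r ^ k) \<le> B" using summable_imp_Bseq[OF s] unfolding Bseq_def by blast
    have "norm (x k) * r ^ k \<le> B" for k
      using B[rule_format, of k] abs_ge_self[of "norm (x k) * r ^ k"] unfolding real_norm_def by linarith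
    then show ?thesis by blast
  qed
  obtain Bx where Bx: "\<And>k. norm (x k) * r ^ k \<le> Bx" using bnd[OF xr[of r]] r by auto
  obtain By where By: "\<And>k. norm (y k) * r ^ k \<le> By" using bnd[OF yr[of r]] r by auto
  have XY: "cnj (Y (cis (- t))) * X (cis (- t)) = of_real (v t / (cmod (?\<Phi> (cis (- t))))\<^sup>2)" for t
  proof -
    let ?z = "cis (- t)" and ?P = "?\<Phi> (cis (- t))"
    have "cnj (Y ?z) * X ?z = (cnj (?z ^ M) * ?z ^ M) * of_real (v t) / (cnj ?P * ?P)"
      by (simp add: X_def Y_def p(2) mult_ac)
    also have "cnj (?z ^ M) * ?z ^ M = 1"
      by (simp add: complex_norm_square[symmetric] mult.commute norm_power flip: complex_cnj_power)
    also have "cnj ?P * ?P = of_real ((cmod ?P)\<^sup>2)" by (simp only: complex_norm_square mult.commute)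
    finally show ?thesis by simp
  qed
  obtain T where T: "wiener T (\<lambda>k. (\<Sum>j. cnj (x j) * y (j + k)) + (if k = 0 then 0 else \<Sum>j. cnj (y j) * x (j + k)))"
    and Te: "\<And>t. cnj (Y (cis (- t))) * X (cis (- t)) = of_real (Re (T (cis (- t))))"
    by (rule wiener_Re_product[OF X Y]) (use XY that in auto)
  have Tv: "Re (T (cis (- t))) = v t / (cmod (?\<Phi> (cis (- t))))\<^sup>2" for t
    using Te[of t] unfolding XY of_real_eq_iff by simp
  define \<theta> where "\<theta> k = (\<Sum>j. cnj (x j) * y (j + k)) + (if k = 0 then 0 else \<Sum>j. cnj (y j) * x (j + k))" for k
  have T: "wiener T \<theta>" using T by (simp add: \<theta>_def[abs_def])
  define A where "A = By * (\<Sum>j. norm (x j)) + Bx * (\<Sum>j. norm (y j)) + 1"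
  have sx: "summable (\<lambda>k. norm (cnj (x k)))" and sy: "summable (\<lambda>k. norm (cnj (y k)))"
    using wiener_summable_norm[OF X] wiener_summable_norm[OF Y] by auto
  have B0: "0 \<le> By * (\<Sum>j. norm (x j))" "0 \<le> Bx * (\<Sum>j. norm (y j))"
    using By[of 0] Bx[of 0] sx sy by (auto intro!: mult_nonneg_nonneg suminf_nonneg intro: order_trans[OF norm_ge_zero])
  have A: "A > 0" using B0 by (simp add: A_def)
  have \<theta>b: "norm (\<theta> k * of_real (r ^ k)) \<le> A" for k
  proof -
    have r1: "1 \<le> r" using r by simp
    have 1: "norm (\<Sum>j. cnj (x j) * y (j + k)) * r ^ k \<le> By * (\<Sum>j. norm (x j))"
      using Cauchy_coeff_bound(1)[OF sx By r1, of k] by simp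
    have 2: "norm (if k = 0 then 0 else \<Sum>j. cnj (y j) * x (j + k)) * r ^ k \<le> Bx * (\<Sum>j. norm (y j))"
      using Cauchy_coeff_bound(1)[OF sy Bx r1, of k] B0(2) by simp
    have "norm (\<theta> k * of_real (r ^ k)) = norm (\<theta> k) * r ^ k" using r by (simp add: norm_mult norm_power)
    also have "\<dots> \<le> (norm (\<Sum>j. cnj (x j) * y (j + k)) + norm (if k = 0 then 0 else \<Sum>j. cnj (y j) * x (j + k))) * r ^ k"
      unfolding \<theta>_def using r by (intro mult_right_mono norm_triangle_ineq) auto
    also have "\<dots> \<le> A" using 1 2 unfolding A_def distrib_right by linarith
    finally show ?thesis .
  qed
  define q where "q = 1 / r\<^sup>2"
  have q: "0 \<le> q" "q < 1" using r by (auto simp: q_def power_strict_mono[of 1 r 2, simplified])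
  \<comment> \<open>The quadratic sum enters the constant coefficient of the real part once and the others twice.\<close>
  define c where "c k = (if k = 0 then 1 / 2 else 1 :: complex)" for k :: nat
  have c: "norm (c k) \<le> 1" for k by (simp add: c_def)
  define \<epsilon>\<^sub>0 where "\<epsilon>\<^sub>0 = (1 - q) / (4 * A)"
  \<comment> \<open>The coefficients of \<open>U\<close> will be at most \<open>\<epsilon> * A / r ^ k\<close>.\<close>
  define C where "C = A / (1 - 1 / r)"
  have C: "C > 0" using A r by (simp add: C_def)
  have e0: "\<epsilon>\<^sub>0 > 0" using q A by (simp add: \<epsilon>\<^sub>0_def)
  have "\<exists>U u. wiener U u \<and> conv_radius u > 1 \<and> (\<forall>z. norm z \<le> 1 \<longrightarrow> norm (U z) \<le> C * \<epsilon>) \<and>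
     (\<forall>t. (cmod (1 + U (cis (- t))))\<^sup>2 = 1 + \<epsilon> * v t / (cmod (?\<Phi> (cis (- t))))\<^sup>2)"
    if \<epsilon>: "0 < \<epsilon>" "\<epsilon> < \<epsilon>\<^sub>0" for \<epsilon>
  proof -
    have \<epsilon>': "0 < \<epsilon> / 2" "8 * (\<epsilon> / 2) * A \<le> 1 - q" using \<epsilon> A by (auto simp: \<epsilon>\<^sub>0_def field_simps)
    have "\<exists>w. (\<forall>k. norm (w k) \<le> 2 * (\<epsilon> / 2) * A) \<and>
      (\<forall>k. w k = of_real (\<epsilon> / 2) * (\<theta> k * of_real (r ^ k)) - c k * (\<Sum>j. w (j + k) * cnj (w j) * of_real q ^ j))"
      by (rule quadratic_fixed_point[OF q]) (rule \<theta>b A c \<epsilon>')+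
    then obtain w where w: "\<And>k. norm (w k) \<le> 2 * (\<epsilon> / 2) * A"
      "\<And>k. w k = of_real (\<epsilon> / 2) * (\<theta> k * of_real (r ^ k)) - c k * (\<Sum>j. w (j + k) * cnj (w j) * of_real q ^ j)"
      by blast
    define u where "u k = w k / of_real (r ^ k)" for k
    have ub: "norm (u k) \<le> \<epsilon> * A * (1 / r) ^ k" for k
      using w(1)[of k] r by (simp add: u_def norm_divide norm_power power_divide divide_right_mono)
    have gs: "summable (\<lambda>k. \<epsilon> * A * (1 / r) ^ k)" using r by (intro summable_mult summable_geometric) simp
    have us: "summable (\<lambda>k. norm (u k))" by (rule summable_comparison_test[OF _ gs]) (use ub in auto)
    define U where "U z = (\<Sum>k. u k * z ^ k)" for z
    have U: "wiener U u" using us by (simp add: wiener_def U_def[abs_def])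
    have Ub: "norm (U z) \<le> C * \<epsilon>" if "norm z \<le> 1" for z
    proof -
      have "norm (U z) \<le> (\<Sum>k. norm (u k))" by (rule wiener_bound[OF U that])
      also have "\<dots> \<le> (\<Sum>k. \<epsilon> * A * (1 / r) ^ k)" by (rule suminf_le[OF ub us gs])
      also have "\<dots> = \<epsilon> * A * (1 / (1 - 1 / r))"
        using r by (subst suminf_mult) (auto simp: suminf_geometric intro!: summable_geometric)
      finally show ?thesis by (simp add: C_def mult_ac)
    qed
    have rad: "conv_radius u > 1"
    proof -
      define s where "s = (1 + r) / 2"
      have s: "1 < s" "s < r" using r by (auto simp: s_def)
      have "summable (\<lambda>k. u k * of_real s ^ k)"
      proof (rule summable_comparison_test[OF _ summable_mult[OF summable_geometric]], intro exI allI impI)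
        fix k
        have "norm (u k * of_real s ^ k) = norm (u k) * s ^ k" using s by (simp add: norm_mult norm_power)
        also have "\<dots> \<le> \<epsilon> * A * (1 / r) ^ k * s ^ k" using ub[of k] s by (intro mult_right_mono) auto
        finally show "norm (u k * of_real s ^ k) \<le> \<epsilon> * A * (s / r) ^ k" by (simp add: power_divide)
        show "norm (s / r) < 1" using s by simp
      qed
      from conv_radius_geI[OF this] have "ereal s \<le> conv_radius u" using s by simp
      then show ?thesis using s by (metis ereal_less_eq(3) less_le_not_le one_ereal_def order_trans)
    qed
    have Qu: "(\<Sum>j. cnj (u j) * u (j + k)) = (\<Sum>j. w (j + k) * cnj (w j) * of_real q ^ j) / of_real (r ^ k)" for k
    proof -
      have s: "summable (\<lambda>j. w (j + k) * cnj (w j) * of_real q ^ j)"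
      proof (rule summable_comparison_test[OF _ summable_mult[OF summable_geometric]], intro exI allI impI)
        fix j
        have "norm (w (j + k)) * norm (w j) \<le> (2 * (\<epsilon> / 2) * A) * (2 * (\<epsilon> / 2) * A)"
          by (rule mult_mono[OF w(1) w(1)]) (use \<epsilon> A in auto)
        then show "norm (w (j + k) * cnj (w j) * of_real q ^ j) \<le> ((2 * (\<epsilon> / 2) * A) * (2 * (\<epsilon> / 2) * A)) * q ^ j"
          using q by (simp add: norm_mult norm_power mult_right_mono)
        show "norm q < 1" using q by simp
      qed
      have "cnj (u j) * u (j + k) = w (j + k) * cnj (w j) * of_real q ^ j / of_real (r ^ k)" for j
        using r by (simp add: u_def q_def power_add power_divide power2_eq_square power_mult_distrib field_simps)
      then show ?thesis using suminf_divide[OF s] by simp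
    qed
    have re: "cnj (U z) * U z \<in> \<real>" for z
      by (metis complex_norm_square mult.commute Reals_of_real)
    obtain Q where Q: "wiener Q (\<lambda>k. (\<Sum>j. cnj (u j) * u (j + k)) + (if k = 0 then 0 else \<Sum>j. cnj (u j) * u (j + k)))"
      and Qe: "\<And>t. cnj (U (cis (- t))) * U (cis (- t)) = of_real (Re (Q (cis (- t))))"
      by (rule wiener_Re_product[OF U U], rule re, rule that)
    have coeff: "2 * u k = of_real \<epsilon> * \<theta> k - ((\<Sum>j. cnj (u j) * u (j + k)) + (if k = 0 then 0 else \<Sum>j. cnj (u j) * u (j + k)))" for k
    proof -
      have rk: "complex_of_real (r ^ k) \<noteq> 0" using r by simp
      have "u k = of_real (\<epsilon> / 2) * \<theta> k - c k * (\<Sum>j. cnj (u j) * u (j + k))"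
        unfolding Qu unfolding u_def using w(2)[of k] rk by (simp add: field_simps)
      then show ?thesis by (cases "k = 0") (simp_all add: c_def algebra_simps)
    qed
    have "wiener (\<lambda>z. 2 * U z) (\<lambda>k. of_real \<epsilon> * \<theta> k - ((\<Sum>j. cnj (u j) * u (j + k)) + (if k = 0 then 0 else \<Sum>j. cnj (u j) * u (j + k))))"
      using wiener_cmult[OF U, of 2] unfolding coeff .
    from wiener_eqI[OF this wiener_diff[OF wiener_cmult[OF T] Q]]
    have eq: "2 * U z = of_real \<epsilon> * T z - Q z" if "norm z \<le> 1" for z using that .
    have "(cmod (1 + U (cis (- t))))\<^sup>2 = 1 + \<epsilon> * v t / (cmod (?\<Phi> (cis (- t))))\<^sup>2" for t
    proof -
      let ?U = "U (cis (- t))"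
      have "(cmod ?U)\<^sup>2 = Re (Q (cis (- t)))"
        using Qe[of t] complex_norm_square[of ?U] by (metis mult.commute of_real_eq_iff)
      moreover have "2 * Re ?U = \<epsilon> * Re (T (cis (- t))) - Re (Q (cis (- t)))"
        using arg_cong[OF eq[of "cis (- t)"], of Re] by simp
      moreover have "(cmod (1 + ?U))\<^sup>2 = 1 + 2 * Re ?U + (cmod ?U)\<^sup>2"
        unfolding cmod_power2 by (simp add: power2_eq_square algebra_simps)
      ultimately show ?thesis by (simp add: Tv)
    qed
    with U rad Ub show ?thesis by blast
  qed
  with C e0 show ?thesis by blast
qed

section \<open>Even and odd trigonometric polynomials\<close>

lemma circ_integral_uminus:
  fixes g :: "real \<Rightarrow> real" shows "(LINT t|circ. g (- t)) = (LINT t|circ. g t)"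
proof -
  have "(LINT t|circ. g t) = (LINT t|lborel. indicator {-pi..pi} t * g t)" by (simp add: integral_restrict_space)
  also have "\<dots> = (LINT t|lborel. indicator {-pi..pi} (- t) * g (- t))"
    using lborel_integral_real_affine[of "-1" "\<lambda>t. indicator {-pi..pi} t * g t" 0] by simp
  also have "\<dots> = (LINT t|lborel. indicator {-pi..pi} t * g (- t))"
    by (intro Bochner_Integration.integral_cong refl) (auto split: split_indicator)
  also have "\<dots> = (LINT t|circ. g (- t))" by (simp add: integral_restrict_space)
  finally show ?thesis by simp
qed

lemma circ_integral_odd:
  fixes g :: "real \<Rightarrow> real" assumes "\<And>t. g (- t) = - g t" shows "(LINT t|circ. g t) = 0"
  using circ_integral_uminus[of g] assms by simp

definition trig_even :: "nat \<Rightarrow> (nat \<Rightarrow> complex) \<Rightarrow> real \<Rightarrow> real" where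
  "trig_even M c t = (\<Sum>k=1..M. \<Sum>l=1..M. Re (c k * cnj (c l)) * cos (of_int (int l - int k) * t))"

definition trig_odd :: "nat \<Rightarrow> (nat \<Rightarrow> complex) \<Rightarrow> real \<Rightarrow> real" where
  "trig_odd M c t = (\<Sum>k=1..M. \<Sum>l=1..M. - Im (c k * cnj (c l)) * sin (of_int (int l - int k) * t))"

lemma trig_even_uminus: "trig_even M c (- t) = trig_even M c t"
  by (simp add: trig_even_def)

lemma trig_odd_uminus: "trig_odd M c (- t) = - trig_odd M c t"
  by (simp add: trig_odd_def sum_negf)

lemma trig_even_continuous: "continuous_on S (trig_even M c)"
  unfolding trig_even_def[abs_def] by (intro continuous_intros)

lemma trig_odd_continuous: "continuous_on S (trig_odd M c)"
  unfolding trig_odd_def[abs_def] by (intro continuous_intros)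

lemma trig_square:
  "(cmod (\<Sum>k=1..M. c k * cis (- (real k * t))))\<^sup>2 = trig_even M c t + trig_odd M c t"
proof -
  let ?S = "\<Sum>k=1..M. c k * cis (- (real k * t))"
  have Re_cis: "Re (w * cis s) = Re w * cos s + - Im w * sin s" for w s by simp
  have "complex_of_real ((cmod ?S)\<^sup>2) = (\<Sum>k=1..M. \<Sum>l=1..M. (c k * cis (- (real k * t))) * cnj (c l * cis (- (real l * t))))"
    unfolding complex_norm_square cnj_sum sum_product ..
  also have "\<dots> = (\<Sum>k=1..M. \<Sum>l=1..M. (c k * cnj (c l)) * cis (of_int (int l - int k) * t))"
  proof (intro sum.cong refl)
    fix k l
    have "cis (- (real k * t)) * cis (real l * t) = cis (of_int (int l - int k) * t)"
      by (simp add: cis_mult algebra_simps)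
    then show "(c k * cis (- (real k * t))) * cnj (c l * cis (- (real l * t))) = (c k * cnj (c l)) * cis (of_int (int l - int k) * t)"
      by (simp add: cis_cnj mult_ac)
  qed
  finally have "(cmod ?S)\<^sup>2 = Re (\<Sum>k=1..M. \<Sum>l=1..M. (c k * cnj (c l)) * cis (of_int (int l - int k) * t))"
    by (metis Re_complex_of_real)
  also have "\<dots> = trig_even M c t + trig_odd M c t"
    unfolding trig_even_def trig_odd_def sum.distrib[symmetric] Re_sum
    by (intro sum.cong refl Re_cis)
  finally show ?thesis .
qed

text \<open>All frequencies are at most \<open>M\<close> in modulus, so the factor \<open>cis (- t) ^ M\<close> leaves only nonnegative powers of
  \<open>cis (- t)\<close>.\<close>

lemma trig_odd_polynomial:
  "\<exists>p. p holomorphic_on UNIV \<and> (\<forall>t. p (cis (- t)) = cis (- t) ^ M * of_real (trig_odd M c t))"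
proof (intro exI conjI allI)
  let ?p = "\<lambda>z. \<Sum>k=1..M. \<Sum>l=1..M. - of_real (Im (c k * cnj (c l))) * (z ^ (M + k - l) - z ^ (M + l - k)) / (2 * \<i>)"
  show "?p holomorphic_on UNIV" by (intro holomorphic_intros) auto
  fix t
  have key: "cis (- t) ^ M * of_real (sin (of_int (int l - int k) * t)) = (cis (- t) ^ (M + k - l) - cis (- t) ^ (M + l - k)) / (2 * \<i>)"
    if "k \<in> {1..M}" "l \<in> {1..M}" for k l
  proof -
    let ?d = "of_int (int l - int k) * t"
    have 1: "cis (- t) ^ (M + k - l) = cis (- t) ^ M * cis ?d"
      using that by (simp add: Complex.DeMoivre cis_mult of_nat_diff algebra_simps)
    have 2: "cis (- t) ^ (M + l - k) = cis (- t) ^ M * cis (- ?d)"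
      using that by (simp add: Complex.DeMoivre cis_mult of_nat_diff algebra_simps)
    have "of_real (sin ?d) = (cis ?d - cis (- ?d)) / (2 * \<i>)" by (simp add: complex_eq_iff)
    then show ?thesis unfolding 1 2 by (simp add: algebra_simps)
  qed
  have gen: "- w * D / (2 * \<i>) = E * (- w * s)" if "E * s = D / (2 * \<i>)" for w D E s :: complex
  proof -
    have "E * (- w * s) = - w * (E * s)" by (simp add: mult.left_commute)
    then show ?thesis unfolding that by simp
  qed
  show "?p (cis (- t)) = cis (- t) ^ M * of_real (trig_odd M c t)"
    unfolding trig_odd_def of_real_sum sum_distrib_left of_real_mult of_real_minus
    by (intro sum.cong refl gen key)
qed

lemma density_times_bounded:
  fixes g :: "real \<Rightarrow> real"
  assumes f: "is_density f" and g: "continuous_on {-pi..pi} g" shows "integrable circ (\<lambda>t. f t * g t)"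
proof -
  have "bounded (g ` {-pi..pi})" by (intro compact_imp_bounded compact_continuous_image[OF g]) simp
  then obtain B where B: "\<And>t. t \<in> {-pi..pi} \<Longrightarrow> norm (g t) \<le> B"
    unfolding bounded_iff by blast
  have fi: "integrable circ f" using f by (simp add: is_density_def circ_integrable)
  show ?thesis
  proof (rule Bochner_Integration.integrable_bound[where f = "\<lambda>t. B * f t"])
    show "integrable circ (\<lambda>t. B * f t)" using fi by simp
    show "(\<lambda>t. f t * g t) \<in> borel_measurable circ"
      by (rule borel_measurable_times[OF density_measurable[OF f] borel_measurable_integrable[OF circ_continuous_integrable[OF g]]])
    show "AE t in circ. norm (f t * g t) \<le> norm (B * f t)"
    proof (rule AE_I2)
      fix t assume "t \<in> space circ"
      then have "norm (g t) \<le> norm B" using B[of t] by simp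
      then have "norm (f t) * norm (g t) \<le> norm (f t) * norm B" by (rule mult_left_mono) simp
      then show "norm (f t * g t) \<le> norm (B * f t)" by (simp only: norm_mult mult.commute)
    qed
  qed
qed

lemma D_class_cos:
  assumes f: "f \<in> D_class M \<rho>" and d: "nat \<bar>d\<bar> \<le> M"
  shows "(LINT t|circ. f t * cos (of_int d * t)) = 2 * pi * \<rho> (nat \<bar>d\<bar>)"
proof -
  have "cos (of_int d * t) = cos (real (nat \<bar>d\<bar>) * t)" for t by (cases "d \<ge> 0") auto
  moreover have "1 / (2 * pi) * (LINT t|circ. f t * cos (real (nat \<bar>d\<bar>) * t)) = \<rho> (nat \<bar>d\<bar>)"
    using f d unfolding D_class_def circ_integral by blast
  ultimately show ?thesis by (simp add: field_simps)
qed

text \<open>All frequencies that occur are among those prescribed in the class, so the integral does not depend on \<open>f\<close>.\<close>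

lemma D_class_trig_even:
  assumes f: "f \<in> D_class M \<rho>"
  shows "(LINT t|circ. trig_even M c t * f t)
    = (\<Sum>k=1..M. \<Sum>l=1..M. Re (c k * cnj (c l)) * (2 * pi * \<rho> (nat \<bar>int l - int k\<bar>)))"
proof -
  have d: "is_density f" using f by (simp add: D_class_def)
  have i: "integrable circ (\<lambda>t. Re (c k * cnj (c l)) * (f t * cos (of_int (int l - int k) * t)))" for k l
    by (intro integrable_mult_right density_times_bounded[OF d] continuous_intros)
  have "(LINT t|circ. trig_even M c t * f t)
      = (LINT t|circ. (\<Sum>k=1..M. \<Sum>l=1..M. Re (c k * cnj (c l)) * (f t * cos (of_int (int l - int k) * t))))"
    unfolding trig_even_def sum_distrib_right
    by (intro Bochner_Integration.integral_cong sum.cong refl) (simp only: mult_ac)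
  also have "\<dots> = (\<Sum>k=1..M. \<Sum>l=1..M. LINT t|circ. Re (c k * cnj (c l)) * (f t * cos (of_int (int l - int k) * t)))"
    by (subst Bochner_Integration.integral_sum, rule Bochner_Integration.integrable_sum, rule i,
        subst Bochner_Integration.integral_sum, rule i, rule refl)
  also have "\<dots> = (\<Sum>k=1..M. \<Sum>l=1..M. Re (c k * cnj (c l)) * (2 * pi * \<rho> (nat \<bar>int l - int k\<bar>)))"
  proof (intro sum.cong refl)
    fix k l assume "k \<in> {1..M}" "l \<in> {1..M}"
    then have "nat \<bar>int l - int k\<bar> \<le> M" by auto
    from D_class_cos[OF f this]
    show "(LINT t|circ. Re (c k * cnj (c l)) * (f t * cos (of_int (int l - int k) * t)))
        = Re (c k * cnj (c l)) * (2 * pi * \<rho> (nat \<bar>int l - int k\<bar>))"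
      by (simp only: integral_mult_right_zero)
  qed
  finally show ?thesis .
qed

lemma spec_cis_power: "spec \<phi> t = (cmod (\<Sum>k. \<phi> k * cis (- t) ^ k))\<^sup>2"
  by (simp add: spec_def Complex.DeMoivre)

lemma spec_continuous:
  assumes "conv_radius \<phi> > 1" shows "continuous_on {-pi..pi} (spec \<phi>)"
  unfolding spec_cis_power[abs_def]
  by (intro continuous_intros wiener_circle_continuous(2)[OF wiener_conv_radius[OF assms]])

section \<open>First variation of the objective\<close>

context extrapolation
begin

text \<open>Write the perturbed factor as \<open>\<Phi> * (1 + U)\<close> with \<open>U\<close> of order \<open>\<epsilon>\<close>. Then \<open>r_fun \<psi>\<close> is the part of \<open>r_fun \<phi> * (1 + U)\<close> with
  nonnegative frequencies. Testing with \<open>r_fun \<phi>\<close> shows that the objective grows at least by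
  \<open>2 Re U = \<epsilon> v / |\<Phi>|\<^sup>2 - |U|\<^sup>2\<close> weighted with \<open>|r_fun \<phi>|\<^sup>2\<close>, where the last term is of second order.\<close>

lemma objective_variation:
  assumes \<phi>: "conv_radius \<phi> > 1" "\<And>z. cmod z \<le> 1 \<Longrightarrow> (\<Sum>k. \<phi> k * z ^ k) \<noteq> 0"
    and v: "continuous_on {-pi..pi} v" "\<exists>p. p holomorphic_on UNIV \<and> (\<forall>t. p (cis (- t)) = cis (- t) ^ m * of_real (v t))"
    and max: "\<And>\<psi> \<epsilon>. \<epsilon> > 0 \<Longrightarrow> conv_radius \<psi> > 1 \<Longrightarrow> (\<And>z. cmod z \<le> 1 \<Longrightarrow> (\<Sum>k. \<psi> k * z ^ k) \<noteq> 0) \<Longrightarrow>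
        (\<And>t. spec \<psi> t = spec \<phi> t + \<epsilon> * v t) \<Longrightarrow> objective n \<mu> a \<psi> \<le> objective n \<mu> a \<phi>"
  shows "(LINT t|circ. (cmod (r_fun \<phi> (cis t)))\<^sup>2 / spec \<phi> t * v t) \<le> 0"
proof -
  let ?\<Phi> = "\<lambda>z. \<Sum>k. \<phi> k * z ^ k" and ?W = "W_fun n \<mu>"
  have \<Phi>: "wiener ?\<Phi> \<phi>" by (rule wiener_conv_radius[OF \<phi>(1)])
  obtain N y where r: "wiener (r_fun \<phi>) (DA_app n \<mu> a (mat_app (W_mat n \<mu>) \<phi>))" and N: "wiener N y" "N 0 = 0"
    and split: "\<And>t. b_fun (cis t) * (?\<Phi> (cis (- t)) * ?W (cis (- t))) = r_fun \<phi> (cis t) + N (cis (- t))"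
    by (rule r_fun_split[OF \<Phi>], rule that)
  note rc = wiener_circle_continuous(1)[OF r]
  have spos: "spec \<phi> t > 0" for t using \<phi>(2)[of "cis (- t)"] by (simp add: spec_cis_power)
  note sc = spec_continuous[OF \<phi>(1)]
  obtain p where p: "p holomorphic_on UNIV" "\<And>t. p (cis (- t)) = cis (- t) ^ m * of_real (v t)" using v(2) by blast
  obtain C \<epsilon>\<^sub>0 where C: "\<epsilon>\<^sub>0 > 0" "C > 0" and ex: "\<And>\<epsilon>. 0 < \<epsilon> \<Longrightarrow> \<epsilon> < \<epsilon>\<^sub>0 \<Longrightarrow> \<exists>U u. wiener U u \<and> conv_radius u > 1 \<and>
     (\<forall>z. norm z \<le> 1 \<longrightarrow> norm (U z) \<le> C * \<epsilon>) \<and>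
     (\<forall>t. (cmod (1 + U (cis (- t))))\<^sup>2 = 1 + \<epsilon> * v t / (cmod (?\<Phi> (cis (- t))))\<^sup>2)"
    using factor_perturbation[OF \<phi> p] by blast
  let ?R = "\<lambda>t. (cmod (r_fun \<phi> (cis t)))\<^sup>2"
  let ?L = "LINT t|circ. ?R t / spec \<phi> t * v t"
  define J where "J = (LINT t|circ. ?R t)"
  have J0: "J \<ge> 0" by (simp add: J_def)
  have iR: "integrable circ ?R" by (intro circ_continuous_integrable continuous_intros rc)
  have iL: "integrable circ (\<lambda>t. ?R t / spec \<phi> t * v t)"
    by (intro circ_continuous_integrable continuous_intros rc sc v(1)) (use spos in \<open>simp add: less_imp_neq[symmetric]\<close>)
  \<comment> \<open>It suffices to bound the variation by a quantity of order \<open>\<epsilon>\<close>.\<close>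
  have key: "?L \<le> C\<^sup>2 * \<epsilon> * J" if \<epsilon>: "0 < \<epsilon>" "\<epsilon> < \<epsilon>\<^sub>0" "C * \<epsilon> < 1" for \<epsilon>
  proof -
    obtain U u where U: "wiener U u" "conv_radius u > 1" "\<And>z. norm z \<le> 1 \<Longrightarrow> norm (U z) \<le> C * \<epsilon>"
      "\<And>t. (cmod (1 + U (cis (- t))))\<^sup>2 = 1 + \<epsilon> * v t / spec \<phi> t"
      using ex[OF \<epsilon>(1,2)] unfolding spec_cis_power by blast
    define \<psi> where "\<psi> k = (\<Sum>i\<le>k. \<phi> i * ((if k - i = 0 then 1 else 0) + u (k - i)))" for k
    have \<Psi>: "wiener (\<lambda>z. ?\<Phi> z * (1 + U z)) \<psi>"
      unfolding \<psi>_def[abs_def] by (rule wiener_mult[OF \<Phi> wiener_add[OF wiener_const U(1)]])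
    have \<Psi>z: "(\<Sum>k. \<psi> k * z ^ k) = ?\<Phi> z * (1 + U z)" if "cmod z \<le> 1" for z
      using \<Psi> that by (simp add: wiener_def)
    have rad: "conv_radius \<psi> > 1"
    proof -
      have "\<psi> = fps_nth (Abs_fps \<phi> * (1 + Abs_fps u))"
        by (auto simp: \<psi>_def fps_mult_nth atLeast0AtMost fun_eq_iff intro!: sum.cong)
      then have "conv_radius \<psi> = fps_conv_radius (Abs_fps \<phi> * (1 + Abs_fps u))" by (simp add: fps_conv_radius_def)
      moreover have "1 < fps_conv_radius (1 + Abs_fps u)"
      proof (rule less_le_trans[OF _ fps_conv_radius_add])
        have "fps_conv_radius (Abs_fps u) = conv_radius u" by (simp add: fps_conv_radius_def)
        then show "1 < min (fps_conv_radius (1 :: complex fps)) (fps_conv_radius (Abs_fps u))" using U(2) by simp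
      qed
      moreover have "1 < fps_conv_radius (Abs_fps \<phi>)" using \<phi>(1) by (simp add: fps_conv_radius_def)
      ultimately show ?thesis
        using fps_conv_radius_mult[of "Abs_fps \<phi>" "1 + Abs_fps u"] by (metis less_le_trans min_less_iff_conj)
    qed
    have U1: "cmod (U z) < 1" if "cmod z \<le> 1" for z using U(3)[OF that] \<epsilon>(3) by linarith
    have nz: "(\<Sum>k. \<psi> k * z ^ k) \<noteq> 0" if "cmod z \<le> 1" for z
    proof -
      have "1 + U z \<noteq> 0" using U1[OF that] by (metis add_eq_0_iff less_irrefl norm_minus_cancel norm_one)
      then show ?thesis unfolding \<Psi>z[OF that] using \<phi>(2)[OF that] by simp
    qed
    have spec\<psi>: "spec \<psi> t = spec \<phi> t + \<epsilon> * v t" for t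
    proof -
      have "spec \<psi> t = spec \<phi> t * (cmod (1 + U (cis (- t))))\<^sup>2"
        unfolding spec_cis_power by (subst \<Psi>z) (simp_all add: norm_mult power_mult_distrib)
      also have "\<dots> = spec \<phi> t + \<epsilon> * v t" unfolding U(4) using spos[of t] by (simp add: field_simps)
      finally show ?thesis .
    qed
    have "objective n \<mu> a \<psi> \<le> objective n \<mu> a \<phi>" by (rule max[OF \<epsilon>(1) rad nz spec\<psi>])
    then have le: "(LINT t|circ. (cmod (r_fun \<psi> (cis t)))\<^sup>2) \<le> J"
      unfolding objective_eq[OF \<Psi>] objective_eq[OF \<Phi>] J_def by (simp add: divide_le_cancel)
    obtain N' y' where r': "wiener (r_fun \<psi>) (DA_app n \<mu> a (mat_app (W_mat n \<mu>) \<psi>))" and N': "wiener N' y'" "N' 0 = 0"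
      and split': "\<And>t. b_fun (cis t) * (?\<Phi> (cis (- t)) * (1 + U (cis (- t))) * ?W (cis (- t))) = r_fun \<psi> (cis t) + N' (cis (- t))"
      by (rule r_fun_split[OF \<Psi>], rule that)
    define Y where "Y z = N z * (1 + U z) - N' z" for z
    have "\<exists>x. wiener Y x" unfolding Y_def[abs_def]
      by (rule exI, rule wiener_diff[OF wiener_mult[OF N(1) wiener_add[OF wiener_const U(1)]] N'(1)])
    then obtain x where Y: "wiener Y x" by (elim exE)
    have Y0: "Y 0 = 0" by (simp add: Y_def N N')
    have r'e: "r_fun \<psi> (cis t) = r_fun \<phi> (cis t) * (1 + U (cis (- t))) + Y (cis (- t))" for t
    proof -
      have "r_fun \<psi> (cis t) + N' (cis (- t)) = (b_fun (cis t) * (?\<Phi> (cis (- t)) * ?W (cis (- t)))) * (1 + U (cis (- t)))"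
        unfolding split'[symmetric] by (simp only: mult_ac)
      then show ?thesis unfolding split Y_def by (simp add: algebra_simps)
    qed
    note Uc = wiener_circle_continuous(2)[OF U(1)] and Yc = wiener_circle_continuous(2)[OF Y] and r'c = wiener_circle_continuous(1)[OF r']
    \<comment> \<open>The square of \<open>r_fun \<phi> * U + Y\<close> is dropped; the term with \<open>Y\<close> integrates to \<open>0\<close>.\<close>
    have pw: "?R t + \<epsilon> * (?R t / spec \<phi> t * v t) - C\<^sup>2 * \<epsilon>\<^sup>2 * ?R t + 2 * Re (cnj (r_fun \<phi> (cis t)) * Y (cis (- t)))
        \<le> (cmod (r_fun \<psi> (cis t)))\<^sup>2" for t
    proof -
      let ?r = "r_fun \<phi> (cis t)" and ?u = "U (cis (- t))" and ?y = "Y (cis (- t))"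
      have "(cmod (1 + ?u))\<^sup>2 = 1 + 2 * Re ?u + (cmod ?u)\<^sup>2"
        unfolding cmod_power2 by (simp add: power2_eq_square algebra_simps)
      then have "2 * Re ?u = \<epsilon> * v t / spec \<phi> t - (cmod ?u)\<^sup>2" using U(4)[of t] by simp
      moreover have "(cmod ?u)\<^sup>2 \<le> (C * \<epsilon>)\<^sup>2" using U(3)[of "cis (- t)"] by (intro power_mono) auto
      ultimately have "\<epsilon> * v t / spec \<phi> t - C\<^sup>2 * \<epsilon>\<^sup>2 \<le> 2 * Re ?u" by (simp add: power_mult_distrib)
      then have "?R t * (\<epsilon> * v t / spec \<phi> t - C\<^sup>2 * \<epsilon>\<^sup>2) \<le> ?R t * (2 * Re ?u)" by (rule mult_left_mono) simp
      moreover have "?R t + ?R t * (2 * Re ?u) + 2 * Re (cnj ?r * ?y) \<le> (cmod (r_fun \<psi> (cis t)))\<^sup>2"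
      proof -
        have "0 \<le> (cmod (?r * ?u + ?y))\<^sup>2" by simp
        also have "(cmod (r_fun \<psi> (cis t)))\<^sup>2 = ?R t + ?R t * (2 * Re ?u) + 2 * Re (cnj ?r * ?y) + (cmod (?r * ?u + ?y))\<^sup>2"
          unfolding r'e cmod_power2 by (simp add: power2_eq_square algebra_simps)
        ultimately show ?thesis by linarith
      qed
      ultimately show ?thesis by (simp add: algebra_simps)
    qed
    have iY: "integrable circ (\<lambda>t. 2 * Re (cnj (r_fun \<phi> (cis t)) * Y (cis (- t))))"
      by (intro circ_continuous_integrable continuous_intros rc Yc)
    have "(LINT t|circ. ?R t + \<epsilon> * (?R t / spec \<phi> t * v t) - C\<^sup>2 * \<epsilon>\<^sup>2 * ?R t + 2 * Re (cnj (r_fun \<phi> (cis t)) * Y (cis (- t))))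
        \<le> (LINT t|circ. (cmod (r_fun \<psi> (cis t)))\<^sup>2)"
      by (rule integral_mono[OF _ _ pw])
         (intro Bochner_Integration.integrable_add Bochner_Integration.integrable_diff integrable_mult_right iR iL iY,
          intro circ_continuous_integrable continuous_intros r'c)
    also have "(LINT t|circ. ?R t + \<epsilon> * (?R t / spec \<phi> t * v t) - C\<^sup>2 * \<epsilon>\<^sup>2 * ?R t + 2 * Re (cnj (r_fun \<phi> (cis t)) * Y (cis (- t))))
        = J + \<epsilon> * ?L - C\<^sup>2 * \<epsilon>\<^sup>2 * J + 2 * 0"
    proof -
      have i2: "integrable circ (\<lambda>t. \<epsilon> * (?R t / spec \<phi> t * v t))" "integrable circ (\<lambda>t. C\<^sup>2 * \<epsilon>\<^sup>2 * ?R t)"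
        by (intro integrable_mult_right iL iR)+
      show ?thesis
        unfolding J_def wiener_orthogonal_integral[OF r Y Y0, symmetric]
          Bochner_Integration.integral_add[OF Bochner_Integration.integrable_diff[OF Bochner_Integration.integrable_add[OF iR i2(1)] i2(2)] iY]
          Bochner_Integration.integral_diff[OF Bochner_Integration.integrable_add[OF iR i2(1)] i2(2)]
          Bochner_Integration.integral_add[OF iR i2(1)] integral_mult_right_zero ..
    qed
    finally have "\<epsilon> * ?L \<le> \<epsilon> * (C\<^sup>2 * \<epsilon> * J)" using le by (simp add: power2_eq_square algebra_simps)
    then show ?thesis using \<epsilon>(1) by (simp add: mult_le_cancel_left_pos)
  qed
  show ?thesis
  proof (rule field_le_epsilon)
    fix e :: real assume e: "e > 0"
    define \<epsilon> where "\<epsilon> = min (\<epsilon>\<^sub>0 / 2) (min (1 / (2 * C)) (e / (C\<^sup>2 * (J + 1))))"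
    have "\<epsilon> > 0" "\<epsilon> < \<epsilon>\<^sub>0" using C e J0 by (auto simp: \<epsilon>_def)
    moreover have "C * \<epsilon> < 1"
    proof -
      have "\<epsilon> \<le> 1 / (2 * C)" by (simp add: \<epsilon>_def)
      then have "C * \<epsilon> \<le> C * (1 / (2 * C))" using C by (intro mult_left_mono) auto
      then show ?thesis using C by simp
    qed
    ultimately have "?L \<le> C\<^sup>2 * \<epsilon> * J" by (rule key)
    also have "\<dots> \<le> C\<^sup>2 * (e / (C\<^sup>2 * (J + 1))) * J"
      using J0 by (intro mult_right_mono mult_left_mono) (auto simp: \<epsilon>_def)
    also have "\<dots> = e * (J / (J + 1))" using C J0 by simp
    also have "\<dots> \<le> e * 1" using e J0 by (intro mult_left_mono) auto
    finally show "?L \<le> 0 + e" by simp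
  qed
qed

end

section \<open>Least favorable densities\<close>

theorem theorem6p1:
  fixes n \<mu> M :: nat
    and a :: "nat \<Rightarrow> complex"
    and \<rho> :: "nat \<Rightarrow> real"
    and P\<^sub>0 :: real
    and P :: "(real \<Rightarrow> real) \<Rightarrow> 'w measure"
    and \<xi> :: "(real \<Rightarrow> real) \<Rightarrow> int \<Rightarrow> 'w \<Rightarrow> complex"
    and Z :: "(real \<Rightarrow> real) \<Rightarrow> real set \<Rightarrow> 'w \<Rightarrow> complex"
  assumes "n \<ge> 1" and "\<mu> > 0" and "M \<ge> 1"
    and "coeff_condition n \<mu> a"
    and "toeplitz_pos_def M \<rho>" and "\<rho> 0 = P\<^sub>0"
    and "\<And>f. f \<in> D_class M \<rho> \<Longrightarrow> stationary_increments n (P f) (\<xi> f)"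
    and "\<And>f. f \<in> D_class M \<rho> \<Longrightarrow> has_spectral_density n (P f) (\<xi> f) (Z f) f"
  shows "(\<forall>\<phi>\<^sub>0 \<in> E_set n \<mu> a M \<rho> P\<^sub>0.
            nu n \<mu> a M \<rho> P\<^sub>0 * ereal P\<^sub>0 = nu_plus n \<mu> a M \<rho> P\<^sub>0 * ereal P\<^sub>0 \<and>
            nu_plus n \<mu> a M \<rho> P\<^sub>0 * ereal P\<^sub>0 = ereal (objective n \<mu> a \<phi>\<^sub>0)
            \<longrightarrow> least_favorable n \<mu> a P \<xi> Z (D_class M \<rho>) (spec \<phi>\<^sub>0))
       \<and> (nu n \<mu> a M \<rho> P\<^sub>0 < nu_plus n \<mu> a M \<rho> P\<^sub>0 \<longrightarrow>
            (\<forall>\<phi> c f\<^sub>0. form_F n \<mu> a M c \<phi> f\<^sub>0 \<and> canonical_factorization \<phi> f\<^sub>0 \<and>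
               f\<^sub>0 \<in> D_class M \<rho> \<and> solves_extremum n \<mu> a M \<rho> \<phi>
               \<longrightarrow> least_favorable n \<mu> a P \<xi> Z (D_class M \<rho>) f\<^sub>0))"
proof -
  interpret X: extrapolation n \<mu> a by unfold_locales (use assms in auto)
  note lf = X.least_favorable_canonical[where D = "D_class M \<rho>" and P = P and \<xi> = \<xi> and Z = Z, OF assms(8) assms(7)]
  have dens: "f \<in> D_class M \<rho> \<Longrightarrow> is_density f" for f by (simp add: D_class_def)
  have spos: "spec \<phi> t > 0" if "canonical_factorization \<phi> f" for \<phi> f t
    using that by (simp add: canonical_factorization_def spec_cis_power)
  have mass: "(LINT t|circ. f t) = 2 * pi * \<rho> 0" if "f \<in> D_class M \<rho>" for f
    using D_class_cos[OF that, of 0] by simp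
  have part1: "least_favorable n \<mu> a P \<xi> Z (D_class M \<rho>) (spec \<phi>)" if \<phi>: "\<phi> \<in> E_set n \<mu> a M \<rho> P\<^sub>0" for \<phi>
  proof -
    have can: "canonical_factorization \<phi> (spec \<phi>)" and inD: "spec \<phi> \<in> D_class M \<rho>" and E: "eq_E n \<mu> a \<phi>"
      using \<phi> by (auto simp: E_set_def factor_set_def)
    from E obtain \<alpha> where \<alpha>: "\<And>k. DA_app n \<mu> a (mat_app (W_mat n \<mu>) \<phi>) k = \<alpha> * cnj (\<phi> k)"
      unfolding eq_E_def by blast
    have \<Phi>: "wiener (\<lambda>z. \<Sum>k. \<phi> k * z ^ k) \<phi>"
      using can by (intro wiener_conv_radius) (simp add: canonical_factorization_def)
    have R: "(cmod (X.r_fun \<phi> (cis t)))\<^sup>2 = (cmod \<alpha>)\<^sup>2 * spec \<phi> t" for t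
    proof -
      have "(\<lambda>k. \<alpha> * (cnj (\<phi> k) * cis t ^ k)) sums (\<alpha> * cnj (\<Sum>k. \<phi> k * cnj (cis t) ^ k))"
        by (intro sums_mult wiener_sums[OF wiener_cnj[OF \<Phi>]]) simp
      then have "X.r_fun \<phi> (cis t) = \<alpha> * cnj (\<Sum>k. \<phi> k * cis (- t) ^ k)"
        unfolding X.r_fun_def \<alpha> by (simp add: sums_iff mult.assoc cis_cnj)
      then show ?thesis by (simp add: norm_mult power_mult_distrib spec_cis_power)
    qed
    have ne: "spec \<phi> t \<noteq> 0" for t using spos[OF can, of t] by simp
    show ?thesis
    proof (rule lf[OF _ _ inD can])
      fix f assume f: "f \<in> D_class M \<rho>"
      have "(cmod (X.r_fun \<phi> (cis t)))\<^sup>2 / spec \<phi> t * f t = (cmod \<alpha>)\<^sup>2 * f t" for t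
        unfolding R by (simp add: ne)
      then show "(LINT t|circ. (cmod (X.r_fun \<phi> (cis t)))\<^sup>2 / spec \<phi> t * f t) \<le> (LINT t|circ. (cmod (X.r_fun \<phi> (cis t)))\<^sup>2)"
        unfolding R by (simp add: ne mass[OF f] mass[OF inD])
    qed
  qed
  have part2: "least_favorable n \<mu> a P \<xi> Z (D_class M \<rho>) f\<^sub>0"
    if F: "form_F n \<mu> a M c \<phi> f\<^sub>0" and can: "canonical_factorization \<phi> f\<^sub>0" and f0: "f\<^sub>0 \<in> D_class M \<rho>"
      and ext: "solves_extremum n \<mu> a M \<rho> \<phi>" for \<phi> c f\<^sub>0
  proof -
    have \<phi>: "conv_radius \<phi> > 1" "\<And>z. cmod z \<le> 1 \<Longrightarrow> (\<Sum>k. \<phi> k * z ^ k) \<noteq> 0"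
      and f0s: "AE t in circ. f\<^sub>0 t = spec \<phi> t"
      using can unfolding canonical_factorization_def circ_AE spec_cis_power by auto
    let ?R = "\<lambda>t. (cmod (X.r_fun \<phi> (cis t)))\<^sup>2"
    let ?e = "trig_even M c" and ?o = "trig_odd M c"
    have rF: "(\<Sum>k. DA_app n \<mu> a (mat_app (W_mat n \<mu>) \<phi>) k * cis (real k * t)) = X.r_fun \<phi> (cis t)" for t
      by (simp add: X.r_fun_def Complex.DeMoivre)
    have AE1: "AE t in circ. c 0 \<noteq> 0 \<and> ?R t / spec \<phi> t = (?e t + ?o t) / (cmod (c 0))\<^sup>2"
      using F[unfolded form_F_def circ_AE rF trig_square] f0s
    proof eventually_elim
      case (elim t)
      then have eq: "spec \<phi> t = (cmod (c 0))\<^sup>2 * ?R t / (?e t + ?o t)" by (simp add: norm_mult power_mult_distrib)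
      have ne: "c 0 \<noteq> 0" "?e t + ?o t \<noteq> 0" "?R t \<noteq> 0" using spos[OF can, of t] unfolding eq by auto
      then show ?case unfolding eq by (simp add: field_simps)
    qed
    \<comment> \<open>The density is positive almost everywhere, so its numerator cannot vanish identically.\<close>
    have c0: "c 0 \<noteq> 0"
    proof
      assume "c 0 = 0"
      then have "AE t in circ. False" using AE1 by simp
      then have "ae_filter circ = bot" by (simp only: trivial_limit_def)
      then have "emeasure circ (space circ) = 0" by (simp only: ae_filter_eq_bot_iff)
      then have "measure circ (space circ) = 0" by (simp only: measure_def enn2real_0)
      then show False using measure_circ pi_gt_zero by simp
    qed
    define \<kappa> where "\<kappa> = 1 / (cmod (c 0))\<^sup>2"
    have \<kappa>: "\<kappa> > 0" using c0 by (simp add: \<kappa>_def)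
    have AE2: "AE t in circ. ?R t / spec \<phi> t = \<kappa> * (?e t + ?o t)"
      using AE1 by eventually_elim (simp add: \<kappa>_def)
    have rm: "(\<lambda>t. ?R t / spec \<phi> t) \<in> borel_measurable circ"
    proof -
      obtain N y where r: "wiener (X.r_fun \<phi>) (DA_app n \<mu> a (mat_app (W_mat n \<mu>) \<phi>))"
        by (rule X.r_fun_split[OF wiener_conv_radius[OF \<phi>(1)]])
      show ?thesis
        by (intro borel_measurable_divide cmod_power2_measurable wiener_circle_measurable(1)[OF r]
            borel_measurable_integrable[OF circ_continuous_integrable[OF spec_continuous[OF \<phi>(1)]]])
    qed
    note ec = trig_even_continuous[of "{-pi..pi}" M c] and oc = trig_odd_continuous[of "{-pi..pi}" M c]
    have tm: "?e \<in> borel_measurable circ" "?o \<in> borel_measurable circ"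
      by (rule borel_measurable_integrable[OF circ_continuous_integrable], rule ec oc)+
    have AEint: "(LINT t|circ. ?R t / spec \<phi> t * g t) = (LINT t|circ. \<kappa> * ((?e t + ?o t) * g t))"
      if "g \<in> borel_measurable circ" for g
    proof (rule integral_cong_AE)
      show "(\<lambda>t. ?R t / spec \<phi> t * g t) \<in> borel_measurable circ" by (rule borel_measurable_times[OF rm that])
      show "(\<lambda>t. \<kappa> * ((?e t + ?o t) * g t)) \<in> borel_measurable circ"
        by (intro borel_measurable_times borel_measurable_add borel_measurable_const tm that)
      show "AE t in circ. ?R t / spec \<phi> t * g t = \<kappa> * ((?e t + ?o t) * g t)"
        using AE2 by eventually_elim simp
    qed
    have sD: "spec \<phi> \<in> D_class M \<rho>" using ext by (simp add: solves_extremum_def factor_set_def)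
    \<comment> \<open>Adding a multiple of the odd part changes no cosine moment, so the extremum problem applies.\<close>
    have "(LINT t|circ. ?R t / spec \<phi> t * ?o t) \<le> 0"
    proof (rule X.objective_variation[OF \<phi> oc trig_odd_polynomial])
      fix \<psi> and \<epsilon> :: real
      assume \<psi>: "\<epsilon> > 0" "conv_radius \<psi> > 1" "\<And>z. cmod z \<le> 1 \<Longrightarrow> (\<Sum>k. \<psi> k * z ^ k) \<noteq> 0"
        and s: "\<And>t. spec \<psi> t = spec \<phi> t + \<epsilon> * ?o t"
      have "spec \<psi> \<in> D_class M \<rho>"
        unfolding D_class_def mem_Collect_eq circ_integral
      proof (intro conjI allI impI)
        show "is_density (spec \<psi>)"
          unfolding is_density_def circ_integrable
          using circ_continuous_integrable[OF spec_continuous[OF \<psi>(2)]] by (simp add: spec_def)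
        fix m assume m: "m \<le> M"
        have i1: "integrable circ (\<lambda>t. spec \<phi> t * cos (real m * t))" and i2: "integrable circ (\<lambda>t. \<epsilon> * (?o t * cos (real m * t)))"
          by (intro circ_continuous_integrable continuous_intros spec_continuous[OF \<phi>(1)] oc)+
        have "(LINT t|circ. spec \<psi> t * cos (real m * t)) = (LINT t|circ. spec \<phi> t * cos (real m * t) + \<epsilon> * (?o t * cos (real m * t)))"
          unfolding s by (simp only: distrib_right mult.assoc)
        also have "\<dots> = (LINT t|circ. spec \<phi> t * cos (real m * t)) + \<epsilon> * (LINT t|circ. ?o t * cos (real m * t))"
          unfolding Bochner_Integration.integral_add[OF i1 i2] integral_mult_right_zero ..
        also have "(LINT t|circ. ?o t * cos (real m * t)) = 0"
          by (rule circ_integral_odd) (simp add: trig_odd_uminus)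
        finally show "1 / (2 * pi) * (LINT t|circ. spec \<psi> t * cos (real m * t)) = \<rho> m"
          using sD m by (simp add: D_class_def circ_integral)
      qed
      then have "\<psi> \<in> factor_set M \<rho>"
        using \<psi> by (auto simp: factor_set_def canonical_factorization_def spec_cis_power)
      then show "objective n \<mu> a \<psi> \<le> objective n \<mu> a \<phi>" using ext by (simp add: solves_extremum_def)
    qed
    then have "(LINT t|circ. \<kappa> * ((?e t + ?o t) * ?o t)) \<le> 0" unfolding AEint[OF tm(2)] .
    moreover have "(LINT t|circ. \<kappa> * ((?e t + ?o t) * ?o t)) = \<kappa> * (LINT t|circ. (?o t)\<^sup>2)"
    proof -
      have i: "integrable circ (\<lambda>t. ?e t * ?o t)" "integrable circ (\<lambda>t. (?o t)\<^sup>2)"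
        by (intro circ_continuous_integrable continuous_intros ec oc)+
      have "(LINT t|circ. (?e t + ?o t) * ?o t) = (LINT t|circ. ?e t * ?o t + (?o t)\<^sup>2)"
        by (simp only: distrib_right power2_eq_square)
      also have "\<dots> = (LINT t|circ. ?e t * ?o t) + (LINT t|circ. (?o t)\<^sup>2)" by (rule Bochner_Integration.integral_add[OF i])
      also have "(LINT t|circ. ?e t * ?o t) = 0"
        by (rule circ_integral_odd) (simp add: trig_odd_uminus trig_even_uminus)
      finally show ?thesis by (simp only: integral_mult_right_zero add_0)
    qed
    ultimately have "(LINT t|circ. (?o t)\<^sup>2) \<le> 0" using \<kappa> by (simp add: mult_le_0_iff)
    then have "(LINT t|circ. (?o t)\<^sup>2) = 0" by (intro antisym) auto
    moreover have "integrable circ (\<lambda>t. (?o t)\<^sup>2)" by (intro circ_continuous_integrable continuous_intros oc)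
    ultimately have "AE t in circ. (?o t)\<^sup>2 = 0" by (subst (asm) integral_nonneg_eq_0_iff_AE) auto
    then have o0: "AE t in circ. ?o t = 0" by eventually_elim simp
    have val: "(LINT t|circ. ?R t / spec \<phi> t * f t) = \<kappa> * (LINT t|circ. ?e t * f t)" if f: "f \<in> D_class M \<rho>" for f
    proof -
      have fm: "f \<in> borel_measurable circ" by (rule density_measurable[OF dens[OF f]])
      have "(LINT t|circ. (?e t + ?o t) * f t) = (LINT t|circ. ?e t * f t)"
      proof (rule integral_cong_AE)
        show "AE t in circ. (?e t + ?o t) * f t = ?e t * f t" using o0 by eventually_elim simp
        show "(\<lambda>t. (?e t + ?o t) * f t) \<in> borel_measurable circ" "(\<lambda>t. ?e t * f t) \<in> borel_measurable circ"
          by (intro borel_measurable_times borel_measurable_add tm fm)+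
      qed
      then show ?thesis unfolding AEint[OF fm] by (simp only: integral_mult_right_zero)
    qed
    show ?thesis
    proof (rule lf[OF _ _ f0 can])
      fix f assume f: "f \<in> D_class M \<rho>"
      have "(LINT t|circ. ?R t / spec \<phi> t * f t) = (LINT t|circ. ?R t / spec \<phi> t * spec \<phi> t)"
        unfolding val[OF f] val[OF sD] D_class_trig_even[OF f] D_class_trig_even[OF sD] ..
      also have "\<dots> = (LINT t|circ. ?R t)"
        using spos[OF can] by (simp add: less_imp_neq[symmetric])
      finally show "(LINT t|circ. ?R t / spec \<phi> t * f t) \<le> (LINT t|circ. ?R t)" by simp
    qed
  qed
  show ?thesis using part1 part2 by blast
qed

end
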